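(* Let $m\le n$ and $a_1<\cdots<a_m$ be positive integers, $\mathcal{A}=\{a_1,\ldots,a_m\}$. Let $\Delta_{m-1}=\{u\in\mathbb{R}^m_{\ge0}:u_1+\cdots+u_m=1\}$ and let $\psi_{\mathcal{A}}:\mathbb{R}^n_{\ge0}\setminus\{0\}\to\Delta_{m-1}$, $x\mapsto\bigl(\sum_{j}\|x\|_{a_j}\bigr)^{-1}(\|x\|_{a_1},\ldots,\|x\|_{a_m})$, where $\|x\|_p=(\sum_i x_i^p)^{1/p}$. For $1\le\ell\le m$ and $\nu=(\nu_1<\cdots<\nu_\ell)$ with $\nu_i\in[n]=\{1,\ldots,n\}$, let $R_\nu$ be the set of $x\in\mathbb{R}^n_{\ge0}$ with $x_1=\cdots=x_{\nu_1}\ge x_{\nu_1+1}=\cdots=x_{\nu_2}\ge\cdots\ge x_{\nu_{\ell-1}+1}=\cdots=x_{\nu_\ell}\ge 0$ and $x_i=0$ for $i>\nu_\ell$, and let $B_\nu=\psi_{\mathcal{A}}(R_\nu\setminus\{0\})$. The type of $\nu$ is the multiset $\{\nu_1,\nu_2-\nu_1,\ldots,\nu_\ell-\nu_{\ell-1}\}$, and $T_{n,\ell}$ denotes the set of partitions with exactly $\ell$ parts of an integer between $\ell$ and $n$. Then: (i) $\mathrm{im}(\psi_{\mathcal{A}})$ is the union of the sets $B_\nu$ for $\nu\in\binom{[n]}{m}$; each $B_\nu$ with $|\nu|=\ell\le m$ is a curvy $(\ell-1)$-simplex, and the curvy facets of the curvy $(m-1)$-simplices $B_\nu$, $\nu\in\binom{[n]}{m}$,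 are the sets $B_\mu$ with $\mu\in\binom{[n]}{m-1}$, $\mu\subset\nu$. The boundary of the semialgebraic set $\mathrm{im}(\psi_{\mathcal{A}})$ is formed by some of these curvy $(m-2)$-simplices $B_\mu$, $\mu\in\binom{[n]}{m-1}$. (ii) If $\mu,\mu'\in\binom{[n]}{m-1}$ have the same type, then $B_\mu$ and $B_{\mu'}$ have the same Zariski closure. Thus the branch hypersurfaces $H_\tau$ (the common Zariski closures of the $B_\mu$ of type $\tau$) are indexed by $\tau\in T_{n,m-1}$.
   Context: $R_\nu$ is an $\ell$-dimensional simplicial polyhedral cone and $\psi_{\mathcal{A}}$ is invariant under positive scaling; a curvy $(\ell-1)$-simplex $B_\nu$ here means the image of $R_\nu\setminus\{0\}$, which is the homeomorphic image of an $(\ell-1)$-simplex (a cross-section of $R_\nu$) under $\psi_{\mathcal{A}}$, its curvy facets being the images of the facets of that simplex. Zariski closures are taken in the affine hyperplane $\{u_1+\cdots+u_m=1\}$. *)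

theory Defs
  imports "HOL-Analysis.Analysis" "HOL-Library.Multiset"
begin

text \<open>Points of R^k are functions nat => real, coordinates indexed 1..k, zero elsewhere.
  The topology on nat => real is the product topology (Function_Topology).\<close>

definition orthant :: "nat \<Rightarrow> (nat \<Rightarrow> real) set" where
  "orthant n = {x. (\<forall>i\<in>{1..n}. 0 \<le> x i) \<and> (\<forall>i. i \<notin> {1..n} \<longrightarrow> x i = 0)}"

definition hyperplane :: "nat \<Rightarrow> (nat \<Rightarrow> real) set" where
  "hyperplane m = {u. (\<forall>j. j \<notin> {1..m} \<longrightarrow> u j = 0) \<and> (\<Sum>j=1..m. u j) = 1}"

definition pnorm :: "nat \<Rightarrow> nat \<Rightarrow> (nat \<Rightarrow> real) \<Rightarrow> real" where
  "pnorm n p x = (\<Sum>i=1..n. x i ^ p) powr (1 / real p)"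

definition psiA :: "nat \<Rightarrow> (nat \<Rightarrow> nat) \<Rightarrow> nat \<Rightarrow> (nat \<Rightarrow> real) \<Rightarrow> (nat \<Rightarrow> real)" where
  "psiA m a n x = (\<lambda>j. if j \<in> {1..m}
      then pnorm n (a j) x / (\<Sum>k=1..m. pnorm n (a k) x) else 0)"

definition topidx :: "nat set \<Rightarrow> nat" where
  "topidx \<nu> = (if \<nu> = {} then 0 else Max \<nu>)"

definition Rcone :: "nat \<Rightarrow> nat set \<Rightarrow> (nat \<Rightarrow> real) set" where
  "Rcone n \<nu> = {x \<in> orthant n.
      (\<forall>i. 1 \<le> i \<and> i < n \<longrightarrow> x (i + 1) \<le> x i) \<and>
      (\<forall>i. 1 \<le> i \<and> i < topidx \<nu> \<and> i \<notin> \<nu> \<longrightarrow> x i = x (i + 1)) \<and>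
      (\<forall>i. topidx \<nu> < i \<longrightarrow> x i = 0)}"

definition Bset :: "nat \<Rightarrow> (nat \<Rightarrow> nat) \<Rightarrow> nat \<Rightarrow> nat set \<Rightarrow> (nat \<Rightarrow> real) set" where
  "Bset m a n \<nu> = psiA m a n ` (Rcone n \<nu> - {\<lambda>_. 0})"

text \<open>Ray generators of R_nu: indicator vectors of {1..k}, k in nu.\<close>
definition gen :: "nat \<Rightarrow> (nat \<Rightarrow> real)" where
  "gen k = (\<lambda>i. if 1 \<le> i \<and> i \<le> k then 1 else 0)"

definition simplex_hull :: "(nat \<Rightarrow> real) set \<Rightarrow> (nat \<Rightarrow> real) set" where
  "simplex_hull V = {(\<lambda>i. \<Sum>v\<in>V. c v * v i) | c.
      (\<forall>v\<in>V. 0 \<le> c v) \<and> (\<Sum>v\<in>V. c v) = 1}"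

definition cross_section :: "nat set \<Rightarrow> (nat \<Rightarrow> real) set" where
  "cross_section \<nu> = simplex_hull (gen ` \<nu>)"

definition nu_type :: "nat set \<Rightarrow> nat multiset" where
  "nu_type \<nu> = mset (map2 (\<lambda>a b. a - b) (sorted_list_of_set \<nu>) (0 # sorted_list_of_set \<nu>))"

definition Tpart :: "nat \<Rightarrow> nat \<Rightarrow> nat multiset set" where
  "Tpart n l = {\<tau>. size \<tau> = l \<and> (\<forall>x\<in>#\<tau>. 0 < x) \<and> l \<le> sum_mset \<tau> \<and> sum_mset \<tau> \<le> n}"

inductive_set poly_fun :: "nat \<Rightarrow> ((nat \<Rightarrow> real) \<Rightarrow> real) set" for m where
  const: "(\<lambda>u. c) \<in> poly_fun m"
| var: "j \<in> {1..m} \<Longrightarrow> (\<lambda>u. u j) \<in> poly_fun m"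
| add: "p \<in> poly_fun m \<Longrightarrow> q \<in> poly_fun m \<Longrightarrow> (\<lambda>u. p u + q u) \<in> poly_fun m"
| mult: "p \<in> poly_fun m \<Longrightarrow> q \<in> poly_fun m \<Longrightarrow> (\<lambda>u. p u * q u) \<in> poly_fun m"

definition zariski_closure :: "nat \<Rightarrow> (nat \<Rightarrow> real) set \<Rightarrow> (nat \<Rightarrow> real) set" where
  "zariski_closure m S = {u \<in> hyperplane m.
      \<forall>p \<in> poly_fun m. (\<forall>v\<in>S. p v = 0) \<longrightarrow> p u = 0}"

end

theory Submission
  imports Defs "HOL-Homology.Homology" "HOL-Complex_Analysis.Complex_Analysis"
begin

text \<open>
  Everything rests on a variation diminishing principle. If x and y are distinct nonnegative
  decreasing vectors whose power sums agree for M positive exponents, then x - y has at least M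
  sign changes; if the last of the M equations is only an inequality, then there are still M - 1
  sign changes, and if there are exactly M - 1 of them, the inequality determines the sign pattern.

  A difference of two points of one cone with l generators is a step function with l steps, so it
  has at most l - 1 sign changes. Hence the first m power sums are injective on cones with at most
  m generators, and (by invariance of domain) open on the interiors of those with exactly m. A
  minimiser of one further power sum on a fibre therefore lies in a cone with m generators, which
  gives the description of the image.

  The cones are glued like the boundary complex of a cyclic polytope. If a set of generators is
  contained in no (m-1)-set satisfying Gale's evenness condition, it contains the elements of one
  rank parity of some (m+1)-set F; then the power sums are still injective on a complete
  m-dimensional fan of cones with generators in F, and its image is a neighbourhood. If an
  (m-1)-set satisfies Gale's condition, the sign pattern forced by changing only the last norm in
  one direction cannot occur, so its cone maps to the boundary.

  Finally, power sums do not see the order of the blocks. A segment from a point of the one cone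
  to the reordered point of the other lies in the former for small times, and a polynomial in the
  norms is real analytic along it; so a polynomial vanishing on one cell vanishes on the other.
\<close>

section \<open>Sign changes and power sums\<close>

text \<open>For positive p, the p-th power sum of x is p times the integral of t^(p-1) against the
  counting function #{i. x i > t}. Equal power sums are thus vanishing moments of a function of the
  level t, and since x and y decrease, alternation in t can be read as alternation in the index.
  Counting functions jump, so the first equation is spent on passing to a weighted antiderivative,
  which is continuous.

  On an (m+1)-set F the m equations alone are one relation short. A fictitious further exponent
  supplies it: whichever of x and y has the larger power sum there, one of two inequalities holds,
  and then the signs of all m + 1 steps of x - y are known up to a common sign. Flatness of x at one
  element and of y at another of the same rank parity contradicts this.

  The map \<psi> remembers the norms only up to a common factor. As norms are homogeneous, its
  fibres become fibres of m power sums after rescaling, so everything can be argued in m-space, and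
  no derivative of \<psi> is ever computed.\<close>

lemma alternating_increments:
  fixes G :: "real \<Rightarrow> real"
  assumes G0: "G 0 = 0" and GT: "G T = 0" and \<tau>: "strict_antimono_on {..M} \<tau>"
    "\<And>k. k \<le> M \<Longrightarrow> \<tau> k \<in> {0<..T}" "\<And>k. k \<le> M \<Longrightarrow> 0 < (-1) ^ k * - G (\<tau> k)"
  obtains \<sigma> where "\<And>k l. k \<le> l \<Longrightarrow> l \<le> Suc (Suc M) \<Longrightarrow> \<sigma> l \<le> \<sigma> k"
    "\<And>k. k \<le> Suc M \<Longrightarrow> \<sigma> (Suc k) < \<sigma> k" "\<And>k. k \<le> Suc (Suc M) \<Longrightarrow> \<sigma> k \<in> {0..T}"
    "\<And>k. k \<le> Suc M \<Longrightarrow> 0 < (-1) ^ k * (G (\<sigma> k) - G (\<sigma> (Suc k)))"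
proof -
  \<comment> \<open>The end points T and 0, where G vanishes, are appended, so M + 1 alternating
    values give M + 2 alternating increments.\<close>
  define \<sigma> where "\<sigma> k = (if k = 0 then T else if k \<le> Suc M then \<tau> (k - 1) else 0)" for k
  have \<tau>T: "\<tau> k < T" if "k \<le> M" for k
    using \<tau>(2,3)[OF that] GT by (cases "\<tau> k = T") auto
  have \<sigma>_step: "\<sigma> (Suc k) < \<sigma> k" if "k \<le> Suc M" for k
    using that \<tau>(1,2) \<tau>T by (cases k) (auto simp: \<sigma>_def monotone_on_def)
  have \<sigma>_anti: "\<sigma> l \<le> \<sigma> k" if "k \<le> l" "l \<le> Suc (Suc M)" for k l
    using that
  proof (induction l rule: dec_induct)
    case (step l)
    then show ?case using \<sigma>_step[of l] by linarith
  qed simp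
  have \<sigma>_range: "\<sigma> k \<in> {0..T}" if "k \<le> Suc (Suc M)" for k
    using \<sigma>_anti[of 0 k] \<sigma>_anti[of k "Suc (Suc M)"] that by (simp add: \<sigma>_def split: if_splits)
  have "0 < (-1) ^ k * (G (\<sigma> k) - G (\<sigma> (Suc k)))" if k: "k \<le> Suc M" for k
  proof -
    have "0 \<le> (-1) ^ k * G (\<sigma> k)" "k \<noteq> 0 \<Longrightarrow> 0 < (-1) ^ k * G (\<sigma> k)"
      using \<tau>(3)[of "k - 1"] k GT by (cases k; simp add: \<sigma>_def)+
    moreover have "0 \<le> (-1) ^ Suc k * G (\<sigma> (Suc k))" "k \<noteq> Suc M \<Longrightarrow> 0 < (-1) ^ Suc k * G (\<sigma> (Suc k))"
      using \<tau>(3)[of k] k G0 by (cases "k = Suc M"; simp add: \<sigma>_def)+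
    ultimately show "0 < (-1) ^ k * (G (\<sigma> k) - G (\<sigma> (Suc k)))"
      using k by (cases "k = 0") (auto simp: algebra_simps)
  qed
  with \<sigma>_anti \<sigma>_step \<sigma>_range show thesis
    by (rule that)
qed

text \<open>Integration by parts trades one vanishing moment of g against one sign change of its
  weighted antiderivative G, and by the mean value theorem g changes sign once more than G.\<close>

lemma moment_sign_changes:
  fixes g :: "real \<Rightarrow> real" and b :: "nat \<Rightarrow> nat"
  assumes "0 < T" and "continuous_on {0..T} g" and "\<exists>t\<in>{0<..T}. g t \<noteq> 0"
    and "strict_mono_on {..M} b"
    and "\<And>j. j < M \<Longrightarrow> integral {0..T} (\<lambda>t. t ^ b j * g t) = 0"
    and "0 \<le> integral {0..T} (\<lambda>t. t ^ b M * g t)"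
  shows "\<exists>\<tau>. strict_antimono_on {..M} \<tau> \<and> (\<forall>k\<le>M. \<tau> k \<in> {0<..T} \<and> 0 < (-1) ^ k * g (\<tau> k))"
  using assms
proof (induction M arbitrary: g b)
  case 0
  have cont: "continuous_on {0..T} (\<lambda>t. t ^ b 0 * g t)"
    using 0 by (intro continuous_intros)
  have "\<exists>t\<in>{0<..T}. 0 < g t"
  proof (rule ccontr)
    assume "\<not> ?thesis"
    then have neg: "g t \<le> 0" if "t \<in> {0<..T}" for t
      using that by force
    have neg0: "t ^ b 0 * g t \<le> 0" if "t \<in> {0<..<T}" for t
      using neg[of t] that by (simp add: mult_nonneg_nonpos)
    have neg1: "t ^ b 0 * g t \<le> 0" if "t \<in> {0..T}" for t
      using continuous_le_on_closure[of "{0<..<T}" "\<lambda>t. t ^ b 0 * g t" t 0] neg0 that cont 0(1)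
      by auto
    have "0 \<le> integral {0..T} (\<lambda>t. - (t ^ b 0 * g t))"
      using neg1 by (intro integral_nonneg integrable_continuous_interval continuous_intros cont) auto
    then have "integral {0..T} (\<lambda>t. - (t ^ b 0 * g t)) = 0"
      using 0(6) by simp
    moreover have "(\<lambda>t. - (t ^ b 0 * g t)) integrable_on {0..T}"
      by (intro integrable_continuous_interval continuous_intros cont)
    ultimately have "((\<lambda>t. - (t ^ b 0 * g t)) has_integral 0) {0..T}"
      by (simp add: has_integral_integrable_integral)
    then have z: "- (t ^ b 0 * g t) = 0" if "t \<in> {0..T}" for t
      using has_integral_0_cbox_imp_0[of 0 T "\<lambda>t. - (t ^ b 0 * g t)" t] neg1 that 0(1)
        continuous_on_minus[OF cont] by (auto simp del: mult_eq_0_iff)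
    show False
      using 0(3) z by (metis greaterThanAtMost_iff atLeastAtMost_iff less_imp_le mult_eq_0_iff neg_equal_0_iff_equal order_less_irrefl power_eq_0_iff)
  qed
  then obtain t where "t \<in> {0<..T}" "0 < g t" by blast
  then show ?case
    by (intro exI[of _ "\<lambda>_. t"]) (auto simp: monotone_on_def)
next
  case (Suc M)
  have contb: "continuous_on {0..T} (\<lambda>t. t ^ c * g t)" for c
    using Suc.prems by (intro continuous_intros)
  define G where "G t = integral {0..t} (\<lambda>s. s ^ b 0 * g s)" for t
  have G0: "G 0 = 0" by (simp add: G_def)
  have GT: "G T = 0" using Suc.prems(5)[of 0] by (simp add: G_def)
  have G': "(G has_real_derivative t ^ b 0 * g t) (at t within {0..T})" if "t \<in> {0..T}" for t
    using integral_has_vector_derivative[OF contb that] 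
    by (simp add: G_def[abs_def] has_real_derivative_iff_has_vector_derivative)
  have contG: "continuous_on {0..T} G"
    by (rule DERIV_continuous_on) (rule G')
  have bmono: "b 0 < b (Suc j)" if "j \<le> M" for j
    using Suc.prems(4) that by (auto simp: monotone_on_def)
  have parts: "integral {0..T} (\<lambda>t. t ^ (b (Suc j) - b 0 - 1) * - G t)
      = integral {0..T} (\<lambda>t. t ^ b (Suc j) * g t) / (b (Suc j) - b 0)" if "j \<le> M" for j
  proof -
    define c where "c = b (Suc j) - b 0"
    have c: "c > 0" "b (Suc j) = c + b 0" using bmono[OF that] by (simp_all add: c_def)
    have "((\<lambda>t. real c * t ^ (c - 1) * G t + t ^ c * (t ^ b 0 * g t)) has_integral
        T ^ c * G T - 0 ^ c * G 0) {0..T}"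
    proof (rule fundamental_theorem_of_calculus)
      fix t assume t: "t \<in> {0..T}"
      have "((\<lambda>t. t ^ c * G t) has_real_derivative
          real c * t ^ (c - 1) * G t + t ^ c * (t ^ b 0 * g t)) (at t within {0..T})"
        by (rule derivative_eq_intros G'[OF t] refl)+ simp
      then show "((\<lambda>t. t ^ c * G t) has_vector_derivative
          real c * t ^ (c - 1) * G t + t ^ c * (t ^ b 0 * g t)) (at t within {0..T})"
        by (simp add: has_real_derivative_iff_has_vector_derivative)
    qed (use Suc.prems in simp)
    then have "integral {0..T} (\<lambda>t. real c * t ^ (c - 1) * G t + t ^ c * (t ^ b 0 * g t)) = 0"
      using G0 GT by (simp add: integral_unique)
    moreover have i1: "(\<lambda>t. real c * (t ^ (c - 1) * G t)) integrable_on {0..T}"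
      by (intro integrable_continuous_interval continuous_on_mult continuous_on_const
          continuous_on_power continuous_on_id contG)
    moreover have i2: "(\<lambda>t. t ^ b (Suc j) * g t) integrable_on {0..T}"
      by (rule integrable_continuous_interval[OF contb])
    moreover have "(\<lambda>t. real c * t ^ (c - 1) * G t + t ^ c * (t ^ b 0 * g t))
        = (\<lambda>t. real c * (t ^ (c - 1) * G t) + t ^ b (Suc j) * g t)"
      by (simp only: c(2) power_add mult.assoc)
    ultimately have "integral {0..T} (\<lambda>t. real c * (t ^ (c - 1) * G t))
        + integral {0..T} (\<lambda>t. t ^ b (Suc j) * g t) = 0"
      by (simp only: integral_add[OF i1 i2, symmetric])
    then have "real c * integral {0..T} (\<lambda>t. t ^ (c - 1) * G t)
        = - integral {0..T} (\<lambda>t. t ^ b (Suc j) * g t)"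
      by simp
    then show ?thesis
      using c(1) unfolding c_def[symmetric] by (simp add: nonzero_eq_divide_eq mult.commute)
  qed
  \<comment> \<open>The minus sign of integration by parts is absorbed into \<open>- G\<close>, so
    the inequality for the last exponent keeps its direction.\<close>
  have "\<exists>\<tau>. strict_antimono_on {..M} \<tau> \<and> (\<forall>k\<le>M. \<tau> k \<in> {0<..T} \<and> 0 < (-1) ^ k * - G (\<tau> k))"
  proof (rule Suc.IH[where b="\<lambda>j. b (Suc j) - b 0 - 1"])
    show "\<exists>t\<in>{0<..T}. - G t \<noteq> 0"
    proof (rule ccontr)
      assume "\<not> ?thesis"
      then have Gz: "G t = 0" if "t \<in> {0..T}" for t
        using that G0 by (cases "t = 0") auto
      have "t ^ b 0 * g t = 0" if t: "t \<in> {0<..<T}" for t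
      proof -
        have "(G has_real_derivative t ^ b 0 * g t) (at t)"
          using G'[of t] t by (simp add: at_within_Icc_at)
        moreover have "(G has_real_derivative 0) (at t)"
          by (rule has_field_derivative_transform_within_open[where f="\<lambda>_. 0" and S="{0<..<T}"])
            (use t Gz in auto)
        ultimately show ?thesis by (rule DERIV_unique)
      qed
      then have gz: "g t = 0" if "t \<in> {0<..<T}" for t
        using that by fastforce
      have "g t = 0" if "t \<in> {0..T}" for t
        using continuous_constant_on_closure[of "{0<..<T}" g 0 t] gz that Suc.prems(1,2) by auto
      then show False
        using Suc.prems(3) by fastforce
    qed
    show "strict_mono_on {..M} (\<lambda>j. b (Suc j) - b 0 - 1)"
    proof (rule strict_mono_onI)
      fix i j assume "i \<in> {..M}" "j \<in> {..M}" "i < j"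
      then show "b (Suc i) - b 0 - 1 < b (Suc j) - b 0 - 1"
        using bmono[of i] Suc.prems(4) by (auto simp: monotone_on_def Suc_le_eq intro!: diff_less_mono)
    qed
    show "integral {0..T} (\<lambda>t. t ^ (b (Suc j) - b 0 - 1) * - G t) = 0" if "j < M" for j
      using parts[of j] Suc.prems(5)[of "Suc j"] that by simp
    show "0 \<le> integral {0..T} (\<lambda>t. t ^ (b (Suc M) - b 0 - 1) * - G t)"
      using parts[of M] Suc.prems(6) bmono[of M] by simp
  qed (use Suc.prems contG in \<open>auto intro: continuous_on_minus\<close>)
  then obtain \<tau> where \<tau>: "strict_antimono_on {..M} \<tau>" "\<And>k. k \<le> M \<Longrightarrow> \<tau> k \<in> {0<..T}"
    "\<And>k. k \<le> M \<Longrightarrow> 0 < (-1) ^ k * - G (\<tau> k)"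
    by blast
  obtain \<sigma> where \<sigma>_anti: "\<And>k l. k \<le> l \<Longrightarrow> l \<le> Suc (Suc M) \<Longrightarrow> \<sigma> l \<le> \<sigma> k"
    and \<sigma>_step: "\<And>k. k \<le> Suc M \<Longrightarrow> \<sigma> (Suc k) < \<sigma> k"
    and \<sigma>_range: "\<And>k. k \<le> Suc (Suc M) \<Longrightarrow> \<sigma> k \<in> {0..T}"
    and pos: "\<And>k. k \<le> Suc M \<Longrightarrow> 0 < (-1) ^ k * (G (\<sigma> k) - G (\<sigma> (Suc k)))"
    using alternating_increments[of G T M \<tau>, OF G0 GT \<tau>] by metis
  have "\<exists>s\<in>{\<sigma> (Suc k)<..<\<sigma> k}. 0 < (-1) ^ k * g s" if k: "k \<le> Suc M" for k
  proof -
    have sub: "0 \<le> \<sigma> (Suc k)" "\<sigma> k \<le> T" using \<sigma>_range k by auto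
    have "continuous_on {\<sigma> (Suc k)..\<sigma> k} G"
      using contG sub by (auto intro: continuous_on_subset)
    moreover have der: "(G has_real_derivative s ^ b 0 * g s) (at s)" if "\<sigma> (Suc k) < s" "s < \<sigma> k" for s
      using G'[of s] sub that by (simp add: at_within_Icc_at)
    ultimately obtain l s where s: "\<sigma> (Suc k) < s" "s < \<sigma> k" "DERIV G s :> l"
      "G (\<sigma> k) - G (\<sigma> (Suc k)) = (\<sigma> k - \<sigma> (Suc k)) * l"
      using MVT[OF \<sigma>_step[OF k], of G] by (metis real_differentiable_def)
    have l: "l = s ^ b 0 * g s"
      using DERIV_unique[OF s(3) der[OF s(1,2)]] .
    have "0 < (\<sigma> k - \<sigma> (Suc k)) * s ^ b 0 * ((-1) ^ k * g s)"
      using pos[OF k] unfolding s(4) l by (simp add: algebra_simps)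
    moreover have "0 \<le> (\<sigma> k - \<sigma> (Suc k)) * s ^ b 0"
      using s(1,2) sub by simp
    ultimately show ?thesis
      using s(1,2) by (auto simp: zero_less_mult_iff)
  qed
  then obtain \<tau>' where \<tau>': "\<And>k. k \<le> Suc M \<Longrightarrow> \<tau>' k \<in> {\<sigma> (Suc k)<..<\<sigma> k}"
    "\<And>k. k \<le> Suc M \<Longrightarrow> 0 < (-1) ^ k * g (\<tau>' k)"
    by metis
  show ?case
  proof (intro exI conjI allI impI)
    show "strict_antimono_on {..Suc M} \<tau>'"
    proof (rule monotone_onI)
      fix k l assume "k \<in> {..Suc M}" "l \<in> {..Suc M}" "k < l"
      then show "\<tau>' k > \<tau>' l"
        using \<tau>'(1)[of k] \<tau>'(1)[of l] \<sigma>_anti[of "Suc k" l] by force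
    qed
    fix k assume "k \<le> Suc M"
    then show "\<tau>' k \<in> {0<..T}" "0 < (-1) ^ k * g (\<tau>' k)"
      using \<tau>'[of k] \<sigma>_range[of k] \<sigma>_range[of "Suc k"] by auto
  qed
qed

section \<open>Variation diminishing for power sums of decreasing vectors\<close>

definition psum :: "nat \<Rightarrow> nat \<Rightarrow> (nat \<Rightarrow> real) \<Rightarrow> real" where
  "psum n p x = (\<Sum>i=1..n. x i ^ p)"

definition decr :: "nat \<Rightarrow> (nat \<Rightarrow> real) set" where
  "decr n = {x \<in> orthant n. \<forall>i. 1 \<le> i \<and> i < n \<longrightarrow> x (i + 1) \<le> x i}"

text \<open>M counts the positions, so it stands for M - 1 sign changes.\<close>

definition alternates :: "nat \<Rightarrow> nat \<Rightarrow> real \<Rightarrow> (nat \<Rightarrow> real) \<Rightarrow> bool" where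
  "alternates n M s d \<longleftrightarrow>
    (\<exists>\<iota>. strict_mono_on {..<M} \<iota> \<and> (\<forall>k<M. \<iota> k \<in> {1..n} \<and> 0 < s * (-1) ^ k * d (\<iota> k)))"

lemma strict_mono_on_lessThanI:
  fixes f :: "nat \<Rightarrow> nat"
  assumes "\<And>k. Suc k < M \<Longrightarrow> f k < f (Suc k)"
  shows "strict_mono_on {..<M} f"
proof (rule strict_mono_onI)
  fix k l assume "k \<in> {..<M}" "l \<in> {..<M}" "k < l"
  from \<open>k < l\<close> have "Suc k \<le> l" by simp
  then have "l < M \<longrightarrow> f k < f l"
  proof (induction l rule: dec_induct)
    case (step l)
    then show ?case using assms[of l] by force
  qed (use assms in blast)
  then show "f k < f l" using \<open>l \<in> {..<M}\<close> by simp
qed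

lemma orthant_nonneg: "x \<in> orthant n \<Longrightarrow> 0 \<le> x i"
  by (cases "i \<in> {1..n}") (auto simp: orthant_def)

lemma decr_nonneg: "x \<in> decr n \<Longrightarrow> 0 \<le> x i"
  unfolding decr_def by (blast intro: orthant_nonneg)

lemma decr_antimono:
  assumes "x \<in> decr n" "1 \<le> i" "i \<le> j"
  shows "x j \<le> x i"
  using assms(3)
proof (induction j rule: dec_induct)
  case (step j)
  have "x (Suc j) \<le> x j"
  proof (cases "j < n")
    case True
    then show ?thesis using assms step.hyps by (auto simp: decr_def)
  next
    case False
    then have "x (Suc j) = 0" using assms by (auto simp: decr_def orthant_def)
    then show ?thesis using decr_nonneg[OF assms(1)] by simp
  qed
  with step.IH show ?case by simp
qed simp

text \<open>Split at z. A moment of a clamped p-th power becomes a power of exponent p + c, and the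
  other term depends on z only through z^p, so after summation it cancels between vectors with equal
  p-th power sums.\<close>

lemma has_integral_pow_min:
  fixes z T :: real
  assumes "0 \<le> z" "z \<le> T" "1 \<le> c" "1 \<le> p"
  shows "((\<lambda>t. t ^ (c - 1) * min t z ^ p) has_integral
    z ^ p * T ^ c / c - z ^ (p + c) * p / (c * (p + c))) {0..T}"
proof -
  have d: "((\<lambda>t::real. t ^ k / k) has_vector_derivative t ^ (k - 1)) (at t within S)"
    if "1 \<le> k" for k t S
  proof -
    have "((\<lambda>t::real. t ^ k / k) has_real_derivative t ^ (k - 1)) (at t within S)"
      using that by (auto intro!: derivative_eq_intros)
    then show ?thesis by (simp add: has_real_derivative_iff_has_vector_derivative)
  qed
  have "((\<lambda>t. t ^ (p + c - 1)) has_integral z ^ (p + c) / real (p + c) - 0 ^ (p + c) / real (p + c)) {0..z}"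
    by (rule fundamental_theorem_of_calculus) (use assms d[of "p + c"] in \<open>simp_all del: of_nat_add\<close>)
  moreover have "0 ^ (p + c) = (0::real)"
    using assms by simp
  ultimately have "((\<lambda>t. t ^ (p + c - 1)) has_integral z ^ (p + c) / real (p + c)) {0..z}"
    by (simp only: div_0 diff_zero)
  then have A: "((\<lambda>t. t ^ (c - 1) * min t z ^ p) has_integral z ^ (p + c) / (p + c)) {0..z}"
    using assms by (subst has_integral_cong[where g="\<lambda>t. t ^ (p + c - 1)"])
      (auto simp: power_add[symmetric] add.commute)
  have "((\<lambda>t. t ^ (c - 1)) has_integral T ^ c / real c - z ^ c / real c) {z..T}"
    by (rule fundamental_theorem_of_calculus) (use assms d in auto)
  then have "((\<lambda>t. t ^ (c - 1) * z ^ p) has_integral (T ^ c / c - z ^ c / c) * z ^ p) {z..T}"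
    by (rule has_integral_mult_left)
  then have B: "((\<lambda>t. t ^ (c - 1) * min t z ^ p) has_integral (T ^ c / c - z ^ c / c) * z ^ p) {z..T}"
    by (subst has_integral_cong[where g="\<lambda>t. t ^ (c - 1) * z ^ p"]) auto
  have "((\<lambda>t. t ^ (c - 1) * min t z ^ p) has_integral
      z ^ (p + c) / (p + c) + (T ^ c / c - z ^ c / c) * z ^ p) {0..T}"
    by (rule has_integral_combine[OF assms(1,2) A B])
  moreover have "z ^ (p + c) / (p + c) + (T ^ c / c - z ^ c / c) * z ^ p
      = z ^ p * T ^ c / c - z ^ (p + c) * p / (c * (p + c))"
  proof -
    have "real c \<noteq> 0" "real p + real c \<noteq> 0" using assms by linarith+
    then have "1 / (real p + real c) - 1 / c = - (p / (c * (real p + real c)))"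
      by (simp add: field_simps)
    then have "z ^ (p + c) * (1 / (real p + real c) - 1 / c) = - (z ^ (p + c) * p / (c * (real p + real c)))"
      by simp
    then show ?thesis by (simp add: power_add algebra_simps)
  qed
  ultimately show ?thesis by simp
qed

text \<open>The growth of min r u ^ p for r from s to t is the mass of the part of [s, t] below u,
  for the measure with distribution function r^p. If u catches more mass than v, then u reaches into
  the interval and v does not fill it.\<close>

lemma min_power_diff_less:
  fixes u v :: real
  assumes "0 \<le> s" "s < t" "0 \<le> u" "0 \<le> v"
    and "min t v ^ p - min s v ^ p < min t u ^ p - min s u ^ p"
  shows "v < u \<and> s < u \<and> v < t"
proof -
  have mono: "min s w ^ p \<le> min t w ^ p" if "0 \<le> w" for w
    using assms that by (intro power_mono) auto
  have "v < t"
  proof (rule ccontr)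
    assume "\<not> v < t"
    then have "min t v = t" "min s v = s" using assms by auto
    moreover have "min t u ^ p - min s u ^ p \<le> t ^ p - s ^ p"
    proof (cases "u \<le> s")
      case True
      have "s ^ p \<le> t ^ p" using assms by (intro power_mono) auto
      moreover have "min t u = u" "min s u = u" using True assms by auto
      ultimately show ?thesis by simp
    next
      case False
      have "min t u ^ p \<le> t ^ p" using assms by (intro power_mono) auto
      then show ?thesis using False by (simp add: min_def)
    qed
    ultimately show False using assms(5) by simp
  qed
  moreover have "s < u"
  proof (rule ccontr)
    assume "\<not> s < u"
    then have "min t u = u" "min s u = u" using assms by auto
    then show False using mono[of v] assms by simp
  qed
  moreover have "v < u"
  proof (rule ccontr)
    assume "\<not> v < u"
    with \<open>v < t\<close> \<open>s < u\<close> have "min t u = u" "min t v = v" "min s u = s" "min s v = s" "u \<le> v" by auto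
    moreover have "u ^ p \<le> v ^ p" using assms \<open>u \<le> v\<close> by (intro power_mono) auto
    ultimately show False using assms(5) by simp
  qed
  ultimately show ?thesis by blast
qed

text \<open>This keeps the antiderivative G below from vanishing identically: at the first
  disagreement i0 it takes different values at the two levels v i0 and u i0. Earlier terms cancel,
  later entries of v lie below both levels, and the entries of u can only add to the growth,
  strictly so at i0.\<close>

lemma clamp_sum_less:
  assumes v: "v \<in> decr n" and u: "u \<in> decr n" and i0: "i0 \<in> {1..n}" "v i0 < u i0"
    and eq: "\<And>i. i \<in> {1..n} \<Longrightarrow> i < i0 \<Longrightarrow> u i = v i" and p: "1 \<le> p"
  shows "(\<Sum>i=1..n. min (v i0) (u i) ^ p - min (v i0) (v i) ^ p)
    < (\<Sum>i=1..n. min (u i0) (u i) ^ p - min (u i0) (v i) ^ p)"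
proof (rule sum_strict_mono_ex1)
  have nn: "0 \<le> v i" for i using decr_nonneg[OF v] .
  have 1: "min (v i0) (v i) = v i" "min (u i0) (v i) = v i" if "i0 \<le> i" for i
    using decr_antimono[OF v, of i0 i] i0 that by auto
  show "\<forall>i\<in>{1..n}. min (v i0) (u i) ^ p - min (v i0) (v i) ^ p
      \<le> min (u i0) (u i) ^ p - min (u i0) (v i) ^ p"
  proof
    fix i assume i: "i \<in> {1..n}"
    show "min (v i0) (u i) ^ p - min (v i0) (v i) ^ p \<le> min (u i0) (u i) ^ p - min (u i0) (v i) ^ p"
    proof (cases "i < i0")
      case True
      then show ?thesis using eq[OF i] by simp
    next
      case False
      have "min (v i0) (u i) ^ p \<le> min (u i0) (u i) ^ p"
        using i0 nn decr_nonneg[OF u] by (intro power_mono) auto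
      then show ?thesis using False 1[of i] by simp
    qed
  qed
  have "v i0 ^ p < u i0 ^ p"
    using i0 nn p by (intro power_strict_mono) auto
  then show "\<exists>i\<in>{1..n}. min (v i0) (u i) ^ p - min (v i0) (v i) ^ p
      < min (u i0) (u i) ^ p - min (u i0) (v i) ^ p"
    using i0 by (intro bexI[of _ i0]) auto
qed simp

text \<open>On successive level intervals, from the top down, x and y take turns in having the
  larger growth of clamped powers. Each interval yields an index where the leading vector is larger,
  and as levels fall, indices rise. The first equation is used up in G T = 0, hence the separate
  case M = 0.\<close>

lemma psum_alternates:
  assumes x: "x \<in> decr n" and y: "y \<in> decr n" and "x \<noteq> y"
    and a: "strict_mono_on {..M} a" "0 < a 0"
    and eq: "\<And>j. j < M \<Longrightarrow> psum n (a j) x = psum n (a j) y"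
    and le: "psum n (a M) y \<le> psum n (a M) x"
  shows "alternates n (Suc M) 1 (\<lambda>i. x i - y i)"
proof -
  have nn: "0 \<le> x i" "0 \<le> y i" for i
    using x y decr_nonneg by auto
  have "\<exists>i\<in>{1..n}. x i \<noteq> y i"
  proof (rule ccontr)
    assume "\<not> ?thesis"
    then have "x i = y i" for i
      using x y by (cases "i \<in> {1..n}") (auto simp: decr_def orthant_def)
    with \<open>x \<noteq> y\<close> show False by auto
  qed
  then obtain i0 where i0: "i0 \<in> {1..n}" "x i0 \<noteq> y i0" "\<And>i. i \<in> {1..n} \<Longrightarrow> i < i0 \<Longrightarrow> x i = y i"
    using exists_least_iff[of "\<lambda>i. i \<in> {1..n} \<and> x i \<noteq> y i"] by blast
  show ?thesis
  proof (cases M)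
    case 0
    have "\<exists>i\<in>{1..n}. y i < x i"
    proof (rule ccontr)
      assume "\<not> ?thesis"
      then have xy: "x i \<le> y i" if "i \<in> {1..n}" for i
        using that by force
      have "psum n (a 0) x < psum n (a 0) y"
        unfolding psum_def
      proof (rule sum_strict_mono_ex1)
        show "\<forall>i\<in>{1..n}. x i ^ a 0 \<le> y i ^ a 0"
          using xy nn by (auto intro: power_mono)
        show "\<exists>i\<in>{1..n}. x i ^ a 0 < y i ^ a 0"
          using xy[OF i0(1)] i0 nn a(2) by (intro bexI[of _ i0] power_strict_mono) auto
      qed simp
      with le 0 show False by simp
    qed
    then obtain i where "i \<in> {1..n}" "y i < x i" by blast
    then show ?thesis
      unfolding alternates_def 0 by (intro exI[of _ "\<lambda>_. i"]) (auto simp: monotone_on_def)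
  next
    case (Suc M')
    \<comment> \<open>T bounds all entries, so clamping at T changes nothing; the summand 1 makes T
      positive.\<close>
    define T where "T = x 1 + y 1 + 1"
    have T: "0 < T" using nn by (simp add: T_def add_nonneg_pos)
    have leT: "x i \<le> T" "y i \<le> T" if "i \<in> {1..n}" for i
      using decr_antimono[OF x, of 1 i] decr_antimono[OF y, of 1 i] nn(1)[of 1] nn(2)[of 1] that
      by (auto simp: T_def)
    define p where "p = a 0"
    have p: "1 \<le> p" using a by (simp add: p_def)
    \<comment> \<open>Up to the factor p, the antiderivative of t^(p-1) (#{i. x i > t} - #{i. y i > t}); the
      remaining equations are moment conditions on G.\<close>
    define G where "G t = (\<Sum>i=1..n. min t (x i) ^ p - min t (y i) ^ p)" for t
    have G0: "G 0 = 0"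
      using nn p by (simp add: G_def min_def)
    have GT: "G T = 0"
    proof -
      have "G T = psum n p x - psum n p y"
        unfolding G_def psum_def sum_subtractf using leT
        by (intro arg_cong2[where f="(-)"] sum.cong) (auto simp: min_absorb2)
      then show ?thesis using eq[of 0] by (simp add: Suc p_def)
    qed
    have contG: "continuous_on S G" for S
      unfolding G_def by (intro continuous_intros)
    have amono: "p < a (Suc j)" if "j \<le> M'" for j
      using a that by (auto simp: monotone_on_def Suc p_def)
    have int: "integral {0..T} (\<lambda>t. t ^ (a (Suc j) - p - 1) * - G t)
        = p / ((a (Suc j) - p) * a (Suc j)) * (psum n (a (Suc j)) x - psum n (a (Suc j)) y)"
      if "j \<le> M'" for j
    proof -
      define c where "c = a (Suc j) - p"
      have c: "1 \<le> c" "a (Suc j) = p + c" using amono[OF that] by (auto simp: c_def)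
      have "((\<lambda>t. \<Sum>i=1..n. t ^ (c - 1) * min t (y i) ^ p - t ^ (c - 1) * min t (x i) ^ p) has_integral
        (\<Sum>i=1..n. (y i ^ p * T ^ c / c - y i ^ (p + c) * p / (c * (p + c)))
          - (x i ^ p * T ^ c / c - x i ^ (p + c) * p / (c * (p + c))))) {0..T}"
        by (intro has_integral_sum has_integral_diff has_integral_pow_min nn leT p c) auto
      moreover have "(\<Sum>i=1..n. t ^ (c - 1) * min t (y i) ^ p - t ^ (c - 1) * min t (x i) ^ p)
          = t ^ (c - 1) * - G t" for t
        by (simp add: G_def sum_distrib_left sum_negf[symmetric] algebra_simps)
      moreover have "(\<Sum>i=1..n. (y i ^ p * T ^ c / c - y i ^ (p + c) * p / (c * (p + c)))
          - (x i ^ p * T ^ c / c - x i ^ (p + c) * p / (c * (p + c))))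
          = T ^ c / c * (psum n p y - psum n p x)
            + p / (c * (p + c)) * (psum n (p + c) x - psum n (p + c) y)"
        unfolding psum_def sum_subtractf[symmetric] sum_distrib_left sum.distrib[symmetric]
        by (rule sum.cong) (simp_all add: algebra_simps add_divide_distrib diff_divide_distrib)
      ultimately have "((\<lambda>t. t ^ (c - 1) * - G t) has_integral
          p / (c * (p + c)) * (psum n (p + c) x - psum n (p + c) y)) {0..T}"
        using eq[of 0] by (simp add: Suc p_def[symmetric])
      then show ?thesis
        unfolding c_def[symmetric] c(2)[symmetric] by (rule integral_unique)
    qed
    have "\<exists>\<tau>. strict_antimono_on {..M'} \<tau> \<and> (\<forall>k\<le>M'. \<tau> k \<in> {0<..T} \<and> 0 < (-1) ^ k * - G (\<tau> k))"
    proof (rule moment_sign_changes[where b="\<lambda>j. a (Suc j) - p - 1"])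
      define z w where "z = max (x i0) (y i0)" and "w = min (x i0) (y i0)"
      have zw: "w < z" "0 \<le> w" "z \<le> T" using i0 nn leT[OF i0(1)] by (auto simp: z_def w_def)
      have "G z \<noteq> G w"
      proof (cases "y i0 < x i0")
        case True
        then show ?thesis
          using clamp_sum_less[OF y x i0(1) True _ p] i0(3) by (auto simp: G_def z_def w_def sum_subtractf)
      next
        case False
        then have "x i0 < y i0" using i0(2) by simp
        then show ?thesis
          using clamp_sum_less[OF x y i0(1) _ _ p] i0(3) by (force simp: G_def z_def w_def sum_subtractf)
      qed
      then have "G z \<noteq> 0 \<or> G w \<noteq> 0" by auto
      then show "\<exists>t\<in>{0<..T}. - G t \<noteq> 0"
        using zw G0 by (cases "w = 0") (auto intro: bexI[of _ z] bexI[of _ w])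
      show "strict_mono_on {..M'} (\<lambda>j. a (Suc j) - p - 1)"
      proof (rule strict_mono_onI)
        fix i j assume "i \<in> {..M'}" "j \<in> {..M'}" "i < j"
        then show "a (Suc i) - p - 1 < a (Suc j) - p - 1"
          using amono[of i] a by (auto simp: monotone_on_def Suc Suc_le_eq intro!: diff_less_mono)
      qed
      show "integral {0..T} (\<lambda>t. t ^ (a (Suc j) - p - 1) * - G t) = 0" if "j < M'" for j
        using int[of j] eq[of "Suc j"] that Suc by simp
      show "0 \<le> integral {0..T} (\<lambda>t. t ^ (a (Suc M') - p - 1) * - G t)"
        using int[of M'] le Suc amono[of M'] by simp
    qed (use T contG in \<open>auto intro: continuous_on_minus\<close>)
    then obtain \<tau> where \<tau>: "strict_antimono_on {..M'} \<tau>" "\<And>k. k \<le> M' \<Longrightarrow> \<tau> k \<in> {0<..T}"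
      "\<And>k. k \<le> M' \<Longrightarrow> 0 < (-1) ^ k * - G (\<tau> k)"
      by blast
    obtain \<sigma> where \<sigma>_anti: "\<And>k l. k \<le> l \<Longrightarrow> l \<le> Suc (Suc M') \<Longrightarrow> \<sigma> l \<le> \<sigma> k"
      and \<sigma>_step: "\<And>k. k \<le> Suc M' \<Longrightarrow> \<sigma> (Suc k) < \<sigma> k"
      and \<sigma>_range: "\<And>k. k \<le> Suc (Suc M') \<Longrightarrow> \<sigma> k \<in> {0..T}"
      and pos: "\<And>k. k \<le> Suc M' \<Longrightarrow> 0 < (-1) ^ k * (G (\<sigma> k) - G (\<sigma> (Suc k)))"
      using alternating_increments[of G T M' \<tau>, OF G0 GT \<tau>] by metis
    define u v where "u k = (if even k then x else y)" and "v k = (if even k then y else x)" for k :: nat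
    have "\<exists>i\<in>{1..n}. v k i < u k i \<and> \<sigma> (Suc k) < u k i \<and> v k i < \<sigma> k" if k: "k \<le> Suc M'" for k
    proof -
      have "0 < (\<Sum>i=1..n. (min (\<sigma> k) (u k i) ^ p - min (\<sigma> (Suc k)) (u k i) ^ p)
          - (min (\<sigma> k) (v k i) ^ p - min (\<sigma> (Suc k)) (v k i) ^ p))"
        using pos[OF k] by (auto simp: G_def u_def v_def sum_subtractf)
      then obtain i where "i \<in> {1..n}" "0 < (min (\<sigma> k) (u k i) ^ p - min (\<sigma> (Suc k)) (u k i) ^ p)
          - (min (\<sigma> k) (v k i) ^ p - min (\<sigma> (Suc k)) (v k i) ^ p)"
        by (metis (no_types, lifting) not_less sum_nonpos)
      then show ?thesis
        using min_power_diff_less[of "\<sigma> (Suc k)" "\<sigma> k" "u k i" "v k i" p] \<sigma>_step[OF k]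
          \<sigma>_range[of "Suc k"] k nn by (auto simp: u_def v_def)
    qed
    then obtain \<iota> where \<iota>: "\<And>k. k \<le> Suc M' \<Longrightarrow> \<iota> k \<in> {1..n}"
      "\<And>k. k \<le> Suc M' \<Longrightarrow> v k (\<iota> k) < u k (\<iota> k)"
      "\<And>k. k \<le> Suc M' \<Longrightarrow> \<sigma> (Suc k) < u k (\<iota> k)"
      "\<And>k. k \<le> Suc M' \<Longrightarrow> v k (\<iota> k) < \<sigma> k"
      by metis
    have "strict_mono_on {..<Suc M} \<iota>"
    proof (rule strict_mono_on_lessThanI)
      fix k assume k: "Suc k < Suc M"
      \<comment> \<open>The vector leading on interval k trails on the next one. Hence \<sigma> (Suc
        k) separates its entries at the two indices, and monotonicity orders the indices.\<close>
      have "v (Suc k) = u k" by (auto simp: u_def v_def)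
      then have "u k (\<iota> (Suc k)) < u k (\<iota> k)"
        using \<iota>(3)[of k] \<iota>(4)[of "Suc k"] k Suc by simp
      moreover have "u k \<in> decr n" using x y by (simp add: u_def)
      ultimately show "\<iota> k < \<iota> (Suc k)"
        using decr_antimono[of "u k" n "\<iota> (Suc k)" "\<iota> k"] \<iota>(1)[of "Suc k"] k Suc
        by (meson atLeastAtMost_iff less_Suc_eq_le not_le)
    qed
    moreover have "0 < 1 * (-1) ^ k * (x (\<iota> k) - y (\<iota> k))" if "k < Suc M" for k
      using \<iota>(2)[of k] that Suc by (auto simp: u_def v_def split: if_splits)
    ultimately show ?thesis
      unfolding alternates_def using \<iota>(1) Suc by (intro exI[of _ \<iota>]) auto
  qed
qed

section \<open>Step functions and Gale's evenness condition\<close>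

text \<open>A sequence with steps at F is constant on the blocks of consecutive positive indices with the
  same value of rk F.\<close>

definition rk :: "nat set \<Rightarrow> nat \<Rightarrow> nat" where
  "rk F i = card (F \<inter> {..<i})"

definition steps_at :: "nat set \<Rightarrow> (nat \<Rightarrow> real) \<Rightarrow> bool" where
  "steps_at F d \<longleftrightarrow> (\<forall>i\<ge>1. i \<notin> F \<longrightarrow> d i = d (Suc i))"

definition same_parity :: "nat set \<Rightarrow> nat set \<Rightarrow> bool" where
  "same_parity F G \<longleftrightarrow> (\<forall>g\<in>G. \<forall>g'\<in>G. even (rk F g) = even (rk F g'))"

lemma same_parityI:
  assumes "\<And>g. g \<in> G \<Longrightarrow> even (rk F g) = \<epsilon>"
  shows "same_parity F G"
  using assms by (simp add: same_parity_def)

lemma same_parityD: "same_parity F G \<Longrightarrow> g \<in> G \<Longrightarrow> g' \<in> G \<Longrightarrow> even (rk F g) = even (rk F g')"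
  unfolding same_parity_def by (drule (1) bspec)+

lemma rk_mono: "finite F \<Longrightarrow> i \<le> j \<Longrightarrow> rk F i \<le> rk F j"
  unfolding rk_def by (intro card_mono) auto

lemma rk_le_card: "finite F \<Longrightarrow> rk F i \<le> card F"
  unfolding rk_def by (intro card_mono) auto

lemma rk_Suc: "finite F \<Longrightarrow> rk F (Suc i) = (if i \<in> F then Suc (rk F i) else rk F i)"
  by (auto simp: rk_def lessThan_Suc Int_insert_right)

lemma rk_strict: "finite F \<Longrightarrow> i \<in> F \<Longrightarrow> i < j \<Longrightarrow> rk F i < rk F j"
  using rk_Suc[of F i] rk_mono[of F "Suc i" j] by simp

lemma rk_less_card:
  assumes "finite F" "i \<in> F" shows "rk F i < card F"
  using rk_Suc[of F i] rk_le_card[of F "Suc i"] assms by simp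

lemma rk_eq_card: "F \<subseteq> {..<i} \<Longrightarrow> rk F i = card F"
  by (simp add: rk_def Int_absorb2)

lemma rk_insert:
  "finite F \<Longrightarrow> g \<notin> F \<Longrightarrow> rk (insert g F) i = (if g < i then Suc (rk F i) else rk F i)"
  by (simp add: rk_def)

lemma steps_atD: "steps_at F d \<Longrightarrow> 1 \<le> i \<Longrightarrow> i \<notin> F \<Longrightarrow> d i = d (Suc i)"
  unfolding steps_at_def by (drule spec[of _ i]) simp

lemma steps_atI: "(\<And>i. 1 \<le> i \<Longrightarrow> i \<notin> F \<Longrightarrow> d i = d (Suc i)) \<Longrightarrow> steps_at F d"
  unfolding steps_at_def by blast

lemma steps_at_mono: "steps_at F d \<Longrightarrow> F \<subseteq> F' \<Longrightarrow> steps_at F' d"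
  by (auto simp: steps_at_def)

lemma steps_at_diff: "steps_at F d \<Longrightarrow> steps_at F e \<Longrightarrow> steps_at F (\<lambda>i. d i - e i)"
  by (simp add: steps_at_def)

lemma steps_at_rk_eq:
  assumes F: "finite F" and d: "steps_at F d" and "1 \<le> i" "1 \<le> j" "rk F i = rk F j"
  shows "d i = d j"
proof -
  have *: "d i = d j" if "1 \<le> i" "i \<le> j" "rk F i = rk F j" for i j
    using that(2,3)
  proof (induction j rule: dec_induct)
    case (step j)
    have "rk F i \<le> rk F j" "rk F j \<le> rk F (Suc j)" using F step.hyps by (auto intro: rk_mono)
    with step.prems have "rk F i = rk F j" "rk F (Suc j) = rk F j" by simp_all
    moreover from this(2) have "j \<notin> F" using rk_Suc[OF F, of j] by auto
    ultimately show ?case using step.IH step.hyps d \<open>1 \<le> i\<close> by (auto simp: steps_at_def)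
  qed simp
  show ?thesis
  proof (cases "i \<le> j")
    case True
    then show ?thesis using *[of i j] assms by simp
  next
    case False
    then show ?thesis using *[of j i] assms by simp
  qed
qed

lemma strict_mono_on_lessThan_gap:
  fixes r :: "nat \<Rightarrow> nat"
  assumes "strict_mono_on {..<K} r" "k \<le> l" "l < K"
  shows "r k + (l - k) \<le> r l"
  using assms(2,3)
proof (induction l rule: dec_induct)
  case (step l)
  then have "r l < r (Suc l)" using assms(1) by (auto simp: monotone_on_def)
  with step show ?case by simp
qed simp

text \<open>One value belongs to each rank, and it is 0 at rank card F because d vanishes far out;
  so alternating positions have strictly increasing ranks below card F. If there are card F of them,
  position k lies in block k, and each step compares two neighbouring blocks of known sign, the last
  block being followed by 0.\<close>

lemma alternates_steps_at:
  assumes F: "finite F" and d: "steps_at F d" and z: "\<And>i. N < i \<Longrightarrow> d i = 0"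
    and alt: "alternates n K s d"
  shows "K \<le> card F"
    and "K = card F \<Longrightarrow> f \<in> F \<Longrightarrow> 1 \<le> f \<Longrightarrow> 0 < s * (-1) ^ rk F f * (d f - d (Suc f))"
proof -
  from alt obtain \<iota> where \<iota>: "strict_mono_on {..<K} \<iota>"
    "\<And>k. k < K \<Longrightarrow> 1 \<le> \<iota> k" "\<And>k. k < K \<Longrightarrow> 0 < s * (-1) ^ k * d (\<iota> k)"
    unfolding alternates_def by force
  have zero: "d i = 0" if "1 \<le> i" "rk F i = card F" for i
  proof -
    have "F \<subseteq> {..<max i (Suc N) + Suc (Max F)}"
    proof
      fix j assume "j \<in> F"
      with F have "j \<le> Max F" by (rule Max_ge)
      then show "j \<in> {..<max i (Suc N) + Suc (Max F)}" by simp
    qed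
    then have "rk F (max i (Suc N) + Suc (Max F)) = card F" by (rule rk_eq_card)
    then have "d i = d (max i (Suc N) + Suc (Max F))"
      using that by (intro steps_at_rk_eq[OF F d]) auto
    then show ?thesis using z by simp
  qed
  define r where "r k = rk F (\<iota> k)" for k
  have "strict_mono_on {..<K} r"
  proof (rule strict_mono_on_lessThanI)
    fix k assume k: "Suc k < K"
    have "\<iota> k < \<iota> (Suc k)" using \<iota>(1) k by (auto simp: monotone_on_def)
    then have "r k \<le> r (Suc k)" unfolding r_def by (intro rk_mono F) simp
    moreover have "r k \<noteq> r (Suc k)"
    proof
      assume "r k = r (Suc k)"
      then have "d (\<iota> k) = d (\<iota> (Suc k))"
        unfolding r_def using \<iota>(2)[of k] \<iota>(2)[of "Suc k"] k by (intro steps_at_rk_eq[OF F d]) auto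
      then show False using \<iota>(3)[of k] \<iota>(3)[of "Suc k"] k by simp
    qed
    ultimately show "r k < r (Suc k)" by simp
  qed
  note gap = strict_mono_on_lessThan_gap[OF this]
  have rlt: "r k < card F" if "k < K" for k
  proof -
    have "rk F (\<iota> k) \<noteq> card F" using zero[OF \<iota>(2)[OF that]] \<iota>(3)[OF that] by auto
    then show ?thesis using rk_le_card[OF F, of "\<iota> k"] by (simp add: r_def)
  qed
  show "K \<le> card F"
    using gap[of 0 "K - 1"] rlt[of "K - 1"] by (cases K) auto
  assume K: "K = card F" and f: "f \<in> F" "1 \<le> f"
  have rk: "r k = k" if "k < K" for k
  proof -
    have "r 0 + (k - 0) \<le> r k" "r k + (K - 1 - k) \<le> r (K - 1)"
      by (rule gap; use that in simp)+
    moreover have "r (K - 1) < K" using rlt[of "K - 1"] that K by simp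
    ultimately show ?thesis using that by linarith
  qed
  define k where "k = rk F f"
  have k: "k < K" using rk_less_card[OF F f(1)] K by (simp add: k_def)
  have dk: "d f = d (\<iota> k)"
    using rk[OF k] f \<iota>(2)[OF k] by (intro steps_at_rk_eq[OF F d]) (auto simp: r_def k_def)
  have rS: "rk F (Suc f) = Suc k" using rk_Suc[OF F, of f] f by (simp add: k_def)
  show "0 < s * (-1) ^ rk F f * (d f - d (Suc f))"
  proof (cases "Suc k < K")
    case True
    have "d (Suc f) = d (\<iota> (Suc k))"
      using rk[OF True] rS \<iota>(2)[OF True] by (intro steps_at_rk_eq[OF F d]) (auto simp: r_def)
    then show ?thesis
      using \<iota>(3)[OF k] \<iota>(3)[OF True] by (simp add: dk k_def[symmetric] right_diff_distrib)
  next
    case False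
    then have "d (Suc f) = 0" using zero[of "Suc f"] rS k K by simp
    then show ?thesis using \<iota>(3)[OF k] by (simp add: dk k_def[symmetric])
  qed
qed

text \<open>For card F \<le> m there are too few blocks for m + 1 alternating positions. For card F
  = m + 1 all steps of x - y at elements of G have the same strict sign. But the step is \<le> 0
  where x is flat and \<ge> 0 where y is flat.\<close>

lemma psum_inj_steps_at:
  assumes x: "x \<in> decr N" and y: "y \<in> decr N" and st: "steps_at F (\<lambda>i. x i - y i)"
    and F: "finite F" "card F \<le> Suc m" "0 \<notin> F"
    and G: "card F = Suc m \<Longrightarrow> G \<subseteq> F \<and> same_parity F G
      \<and> (\<exists>g\<in>G. x g = x (Suc g)) \<and> (\<exists>g\<in>G. y g = y (Suc g))"
    and a: "strict_mono_on {..<m} a" "0 < a 0" "1 \<le> m"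
    and eq: "\<And>j. j < m \<Longrightarrow> psum N (a j) x = psum N (a j) y"
  shows "x = y"
proof (rule ccontr)
  assume ne: "x \<noteq> y"
  \<comment> \<open>For one more exponent, one of the two inequalities holds.\<close>
  define a' where "a' = a(m := Suc (a (m - 1)))"
  have a': "strict_mono_on {..m} a'" "0 < a' 0"
  proof -
    have "a j \<le> a (m - 1)" if "j < m" for j
    proof -
      have "a j + (m - 1 - j) \<le> a (m - 1)"
        by (rule strict_mono_on_lessThan_gap[OF a(1)]) (use that in auto)
      then show ?thesis by linarith
    qed
    then show "strict_mono_on {..m} a'"
      using a(1) by (auto simp: monotone_on_def a'_def less_Suc_eq_le)
    show "0 < a' 0" using a by (simp add: a'_def)
  qed
  have eq': "psum N (a' j) x = psum N (a' j) y" if "j < m" for j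
    using eq[OF that] that by (simp add: a'_def)
  have contra: False if u: "u \<in> decr N" and v: "v \<in> decr N" and st: "steps_at F (\<lambda>i. u i - v i)"
      and ne: "u \<noteq> v" and eq: "\<And>j. j < m \<Longrightarrow> psum N (a' j) u = psum N (a' j) v"
      and le: "psum N (a' m) v \<le> psum N (a' m) u"
      and G: "card F = Suc m \<Longrightarrow> G \<subseteq> F \<and> same_parity F G
        \<and> (\<exists>g\<in>G. u g = u (Suc g)) \<and> (\<exists>g\<in>G. v g = v (Suc g))" for u v
  proof -
    have alt: "alternates N (Suc m) 1 (\<lambda>i. u i - v i)"
      by (rule psum_alternates[OF u v ne a' eq le])
    have z: "u i - v i = 0" if "N < i" for i
      using u v that by (simp add: decr_def orthant_def)
    have card: "card F = Suc m"
      using alternates_steps_at(1)[OF F(1) st z alt] F(2) by simp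
    from G[OF card] obtain g h where gh: "g \<in> G" "h \<in> G" "u g = u (Suc g)" "v h = v (Suc h)"
      "G \<subseteq> F" "same_parity F G" by auto
    have par: "even (rk F g) = even (rk F h)"
      by (rule same_parityD[OF gh(6,1,2)])
    have g1: "1 \<le> g" "1 \<le> h" "g \<in> F" "h \<in> F" using F(3) gh(1,2,5) by (auto simp: Suc_le_eq intro!: gr0I)
    have "0 < 1 * (-1) ^ rk F g * (u g - v g - (u (Suc g) - v (Suc g)))"
      "0 < 1 * (-1) ^ rk F h * (u h - v h - (u (Suc h) - v (Suc h)))"
      using alternates_steps_at(2)[OF F(1) st z alt card[symmetric]] g1 by blast+
    moreover have "v (Suc g) \<le> v g" "u (Suc h) \<le> u h"
      using decr_antimono[OF v, of g "Suc g"] decr_antimono[OF u, of h "Suc h"] g1 by auto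
    ultimately show False
      using gh(3,4) par by (cases "even (rk F g)") simp_all
  qed
  show False
  proof (cases "psum N (a' m) y \<le> psum N (a' m) x")
    case True
    show False by (rule contra[OF x y st ne eq' True G])
  next
    case False
    have "steps_at F (\<lambda>i. y i - x i)"
      unfolding steps_at_def
    proof (intro allI impI)
      fix i assume "1 \<le> i" "i \<notin> F"
      then have "x i - y i = x (Suc i) - y (Suc i)" using st unfolding steps_at_def by blast
      then show "y i - x i = y (Suc i) - x (Suc i)" by simp
    qed
    then show False by (rule contra[OF y x _ ne[symmetric] eq'[symmetric]]) (use False G in auto)
  qed
qed

text \<open>Gale's evenness condition: between two non-members in {1..n} lies an even number of
  members. Only the parity of \<rho> matters; it records the common rank parity, which decides in
  which direction the last norm cannot be moved.\<close>

definition gale :: "nat \<Rightarrow> nat set \<Rightarrow> nat \<Rightarrow> bool" where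
  "gale n \<mu> \<rho> \<longleftrightarrow> (\<forall>g\<in>{1..n} - \<mu>. even (rk \<mu> g) = even \<rho>)"

text \<open>The k-th position has rank at least k: if two successive positions share a rank, then x
  agrees there and x - y does not decrease, so the sign at the first is negative; by evenness its
  rank then has the wrong parity to be exactly k. The last position thus has rank card \<mu>, where
  x vanishes, although the pattern asks for x > y.\<close>

lemma gale_not_alternates:
  assumes \<mu>: "\<mu> \<subseteq> {1..n}" "gale n \<mu> \<rho>"
    and x: "x \<in> decr n" "steps_at \<mu> x" and y: "y \<in> decr n"
  shows "\<not> alternates n (Suc (card \<mu>)) ((-1) ^ \<rho>) (\<lambda>i. x i - y i)"
proof
  have fin: "finite \<mu>" by (rule finite_subset[OF \<mu>(1) finite_atLeastAtMost])
  assume "alternates n (Suc (card \<mu>)) ((-1) ^ \<rho>) (\<lambda>i. x i - y i)"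
  then obtain \<iota> where \<iota>1: "strict_mono_on {..<Suc (card \<mu>)} \<iota>"
    and \<iota>2: "\<forall>k<Suc (card \<mu>). \<iota> k \<in> {1..n} \<and> 0 < (-1) ^ \<rho> * (-1) ^ k * (x (\<iota> k) - y (\<iota> k))"
    unfolding alternates_def by (elim exE conjE)
  have \<iota>: "strict_mono_on {..<Suc (card \<mu>)} \<iota>" "\<iota> k \<in> {1..n}"
    "0 < (-1) ^ \<rho> * (-1) ^ k * (x (\<iota> k) - y (\<iota> k))" if "k \<le> card \<mu>" for k
    using \<iota>1 \<iota>2[rule_format, of k] that by (simp_all del: zero_less_mult_iff)
  have ge: "k \<le> rk \<mu> (\<iota> k)" if "k \<le> card \<mu>" for k
    using that
  proof (induction k)
    case (Suc k)
    have lt: "\<iota> k < \<iota> (Suc k)" using \<iota>1 Suc.prems by (auto simp: monotone_on_def)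
    have le: "rk \<mu> (\<iota> k) \<le> rk \<mu> (\<iota> (Suc k))" using lt by (intro rk_mono fin) simp
    have k: "k \<le> rk \<mu> (\<iota> k)" using Suc by simp
    show ?case
    proof (cases "rk \<mu> (\<iota> k) = rk \<mu> (\<iota> (Suc k))")
      case True
      have "\<iota> k \<notin> \<mu>" using rk_strict[OF fin _ lt] True by auto
      then have par: "even (rk \<mu> (\<iota> k)) = even \<rho>"
        using \<mu>(2) \<iota>(2)[of k] Suc.prems by (simp add: gale_def)
      have "x (\<iota> k) = x (\<iota> (Suc k))"
        using \<iota>(2)[of k] \<iota>(2)[of "Suc k"] Suc.prems True by (intro steps_at_rk_eq[OF fin x(2)]) auto
      moreover have "y (\<iota> (Suc k)) \<le> y (\<iota> k)"
        using \<iota>(2)[of k] Suc.prems lt by (intro decr_antimono[OF y]) auto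
      ultimately have "x (\<iota> k) - y (\<iota> k) \<le> x (\<iota> (Suc k)) - y (\<iota> (Suc k))" by simp
      with \<iota>(3)[of k] \<iota>(3)[of "Suc k"] Suc.prems have "odd (\<rho> + k)"
        by (cases "even (\<rho> + k)") (auto simp: power_add[symmetric])
      with par have "rk \<mu> (\<iota> k) \<noteq> k" by auto
      with k le show ?thesis by simp
    qed (use k le in simp)
  qed simp
  define l where "l = \<iota> (card \<mu>)"
  have rl: "rk \<mu> l = card \<mu>"
    using ge[of "card \<mu>"] rk_le_card[OF fin, of l] by (simp add: l_def)
  then have "l \<notin> \<mu>" using rk_less_card[OF fin, of l] by auto
  then have "even (card \<mu>) = even \<rho>"
    using \<mu>(2)[unfolded gale_def, rule_format, of l] rl \<iota>(2)[of "card \<mu>"] by (simp add: l_def)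
  then have "0 < x l - y l"
    using \<iota>(3)[of "card \<mu>"] by (cases "even \<rho>") (auto simp: l_def)
  moreover have "x l = x (Suc n)"
  proof (rule steps_at_rk_eq[OF fin x(2)])
    have "\<mu> \<subseteq> {..<Suc n}" using \<mu>(1) by auto
    then show "rk \<mu> l = rk \<mu> (Suc n)" using rl by (simp add: rk_eq_card)
    show "1 \<le> l" using \<iota>(2)[of "card \<mu>"] by (simp add: l_def)
  qed simp
  moreover have "x (Suc n) = 0" using x(1) by (simp add: decr_def orthant_def)
  ultimately show False using decr_nonneg[OF y, of l] by simp
qed

text \<open>Adding the least non-member raises the rank of every other non-member by one, so their
  parities still agree.\<close>

lemma gale_extend:
  assumes "B \<subseteq> {1..n}" "card B + k \<le> n" "gale n B \<rho>"
  shows "\<exists>\<mu> \<rho>. B \<subseteq> \<mu> \<and> \<mu> \<subseteq> {1..n} \<and> card \<mu> = card B + k \<and> gale n \<mu> \<rho>"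
  using assms
proof (induction k arbitrary: B \<rho>)
  case (Suc k)
  have fin: "finite B" by (rule finite_subset[OF Suc.prems(1) finite_atLeastAtMost])
  define g where "g = Min ({1..n} - B)"
  have "card B < card {1..n}" using Suc.prems by simp
  then have "{1..n} - B \<noteq> {}"
    using card_mono[OF fin, of "{1..n}"] by fastforce
  then have g: "g \<in> {1..n} - B" "\<And>h. h \<in> {1..n} - B \<Longrightarrow> g \<le> h"
    unfolding g_def by (rule Min_in[rotated], simp) (rule Min_le, simp_all)
  have "gale n (insert g B) (Suc \<rho>)"
    unfolding gale_def
  proof
    fix h assume h: "h \<in> {1..n} - insert g B"
    then have "g < h" using g(2)[of h] by auto
    then show "even (rk (insert g B) h) = even (Suc \<rho>)"
      using g h Suc.prems(3) rk_insert[OF fin, of g h] by (auto simp: gale_def)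
  qed
  from Suc.IH[OF _ _ this] show ?case
    using g Suc.prems fin by auto
qed auto

text \<open>The dichotomy between faces and non-faces of a cyclic polytope. In the inductive step an element
  h is added to B, where h < f are consecutive non-members of different parity; if h has the wrong
  parity in the resulting F, it is exchanged for f.\<close>

lemma gale_or_same_parity:
  assumes "B \<subseteq> {1..n}" "Suc (card B + k) \<le> n"
  shows "(\<exists>\<mu> \<rho>. B \<subseteq> \<mu> \<and> \<mu> \<subseteq> {1..n} \<and> card \<mu> = card B + k \<and> gale n \<mu> \<rho>) \<or>
    (\<exists>F. B \<subseteq> F \<and> F \<subseteq> {1..n} \<and> card F = card B + k + 2
      \<and> same_parity F (F - B))"
  using assms
proof (induction k arbitrary: B)
  have adj: "\<exists>h f. h \<in> {1..n} - B \<and> f \<in> {1..n} - B \<and> h < f \<and> even (rk B h) \<noteq> even (rk B f)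
      \<and> (\<forall>g. h < g \<and> g < f \<longrightarrow> g \<in> B)" if ng: "\<And>\<rho>. \<not> gale n B \<rho>" for B
  proof -
    define P where "P h f \<longleftrightarrow> h \<in> {1..n} - B \<and> f \<in> {1..n} - B \<and> h < f
      \<and> even (rk B h) \<noteq> even (rk B f)" for h f
    have "\<exists>h f. P h f"
    proof (rule ccontr)
      assume no: "\<nexists>h f. P h f"
      have same: "even (rk B h) = even (rk B f)" if "h \<in> {1..n} - B" "f \<in> {1..n} - B" for h f
        using no that unfolding P_def by (metis linorder_neqE_nat)
      show False
      proof (cases "{1..n} - B = {}")
        case True
        then show False using ng[of 0] unfolding gale_def by blast
      next
        case False
        then obtain h where "h \<in> {1..n} - B" by blast
        then show False using ng[of "rk B h"] same unfolding gale_def by blast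
      qed
    qed
    then obtain q where "P (fst q) (snd q)" by auto
    \<comment> \<open>A pair at minimal distance: a non-member strictly between would form a closer
      pair with one of the two ends.\<close>
    then obtain q where q: "P (fst q) (snd q)"
      "\<And>q'. P (fst q') (snd q') \<Longrightarrow> snd q - fst q \<le> snd q' - fst q'"
      using ex_has_least_nat[of "\<lambda>q. P (fst q) (snd q)" q "\<lambda>q. snd q - fst q"] by blast
    have "g \<in> B" if g: "fst q < g" "g < snd q" for g
    proof (rule ccontr)
      assume "g \<notin> B"
      then have "P (fst q) g \<or> P g (snd q)" using q(1) g by (auto simp: P_def)
      then show False
        using q(2)[of "(fst q, g)"] q(2)[of "(g, snd q)"] g by auto
    qed
    with q(1) show ?thesis unfolding P_def by blast
  qed
  {
    case 0
    have fin: "finite B" by (rule finite_subset[OF 0(1) finite_atLeastAtMost])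
    show ?case
    proof (cases "\<exists>\<rho>. gale n B \<rho>")
      case True
      then show ?thesis using 0 by auto
    next
      case False
      then obtain h f where hf: "h \<in> {1..n} - B" "f \<in> {1..n} - B" "h < f"
        "even (rk B h) \<noteq> even (rk B f)"
        using adj by blast
      \<comment> \<open>Inserting both leaves the rank of h unchanged and raises that of f by one,
        so their different parities become equal.\<close>
      have r: "rk (insert h (insert f B)) g = rk B g + (if h < g then 1 else 0) + (if f < g then 1 else 0)" for g
        using hf fin by (simp add: rk_insert)
      have "same_parity (insert h (insert f B)) {h, f}"
        by (rule same_parityI[where \<epsilon>="even (rk B h)"]) (use hf r in auto)
      moreover have "insert h (insert f B) - B = {h, f}" using hf by auto
      ultimately show ?thesis
        using hf fin 0 by (intro disjI2 exI[of _ "insert h (insert f B)"]) auto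
    qed
  next
    case (Suc k)
    have fin: "finite B" by (rule finite_subset[OF Suc.prems(1) finite_atLeastAtMost])
    show ?case
    proof (cases "\<exists>\<rho>. gale n B \<rho>")
      case True
      then show ?thesis using gale_extend[of B n "Suc k"] Suc.prems by (metis Suc_leD add_Suc_right)
    next
      case False
      then obtain h f where hf: "h \<in> {1..n} - B" "f \<in> {1..n} - B" "h < f"
        "even (rk B h) \<noteq> even (rk B f)" and btw: "\<And>g. h < g \<Longrightarrow> g < f \<Longrightarrow> g \<in> B"
        using adj by blast
      have card: "card (insert h B) = Suc (card B)" using hf fin by simp
      have "(\<exists>\<mu> \<rho>. insert h B \<subseteq> \<mu> \<and> \<mu> \<subseteq> {1..n} \<and> card \<mu> = card (insert h B) + k \<and> gale n \<mu> \<rho>) \<or>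
        (\<exists>F. insert h B \<subseteq> F \<and> F \<subseteq> {1..n} \<and> card F = card (insert h B) + k + 2
        \<and> same_parity F (F - insert h B))"
        by (rule Suc.IH) (use hf Suc.prems card in auto)
      then show ?thesis
      proof
        assume "\<exists>\<mu> \<rho>. insert h B \<subseteq> \<mu> \<and> \<mu> \<subseteq> {1..n} \<and> card \<mu> = card (insert h B) + k \<and> gale n \<mu> \<rho>"
        then show ?thesis using card by auto
      next
        assume "\<exists>F. insert h B \<subseteq> F \<and> F \<subseteq> {1..n} \<and> card F = card (insert h B) + k + 2
          \<and> same_parity F (F - insert h B)"
        then obtain F where F: "insert h B \<subseteq> F" "F \<subseteq> {1..n}" "card F = card B + Suc k + 2"
          and par: "same_parity F (F - insert h B)"
          using card by auto
        have finF: "finite F" by (rule finite_subset[OF F(2) finite_atLeastAtMost])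
        define E where "E = F - {h}"
        have E: "F = insert h E" "h \<notin> E" "finite E" "B \<subseteq> E" using F(1) hf finF by (auto simp: E_def)
        \<comment> \<open>Strictly between h and f everything belongs to B, so B and E gain equally
          many members there, and the parity difference of h and f in B persists in E.\<close>
        have rkE: "rk E f = rk E h + rk B f - rk B h" "rk B h \<le> rk B f"
        proof -
          have "E \<inter> {..<f} = (E \<inter> {..<h}) \<union> (B \<inter> {h..<f})"
          proof (rule Set.set_eqI)
            fix g
            show "g \<in> E \<inter> {..<f} \<longleftrightarrow> g \<in> (E \<inter> {..<h}) \<union> (B \<inter> {h..<f})"
              using hf btw[of g] E(2,4) by (cases g h rule: linorder_cases) auto
          qed
          moreover have "B \<inter> {..<f} = (B \<inter> {..<h}) \<union> (B \<inter> {h..<f})"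
            using hf by auto
          moreover have "card ((E \<inter> {..<h}) \<union> (B \<inter> {h..<f})) = card (E \<inter> {..<h}) + card (B \<inter> {h..<f})"
            using E fin by (intro card_Un_disjoint) auto
          moreover have "card ((B \<inter> {..<h}) \<union> (B \<inter> {h..<f})) = card (B \<inter> {..<h}) + card (B \<inter> {h..<f})"
            using E fin by (intro card_Un_disjoint) auto
          ultimately show "rk E f = rk E h + rk B f - rk B h" "rk B h \<le> rk B f"
            unfolding rk_def by simp_all
        qed
        then have flip: "even (rk E f) \<noteq> even (rk E h)"
        proof -
          have "rk E f + rk B h = rk E h + rk B f" using rkE by simp
          then have "even (rk E f + rk B h) = even (rk E h + rk B f)" by simp
          then show ?thesis
            using hf(4) by (cases "even (rk B h)"; cases "even (rk E h)"; cases "even (rk E f)"; simp)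
        qed
        have rkF: "rk F g = (if h < g then Suc (rk E g) else rk E g)" for g
          using E rk_insert[of E h g] by simp
        show ?thesis
        proof (cases "\<forall>g\<in>F - insert h B. even (rk F g) = even (rk F h)")
          case True
          then have "even (rk F g) = even (rk F h)" if "g \<in> F - B" for g
            using that by (cases "g = h") simp_all
          then have "same_parity F (F - B)"
            by (rule same_parityI)
          moreover have "B \<subseteq> F" using F(1) by simp
          ultimately show ?thesis using F(2,3) by (intro disjI2 exI[of _ F]) simp
        next
          case False
          then have "\<exists>g0\<in>F - insert h B. even (rk F g0) \<noteq> even (rk F h)" by simp
          then obtain g0 where g0: "g0 \<in> F - insert h B" "even (rk F g0) \<noteq> even (rk F h)" ..
          have odd: "even (rk F g) \<noteq> even (rk F h)" if "g \<in> F - insert h B" for g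
            using same_parityD[OF par that g0(1)] g0(2) by simp
          \<comment> \<open>Were f in F, the presence of h would raise its rank by one and so give
            it the parity of h, which no other added element has.\<close>
          have "f \<notin> F"
          proof
            assume "f \<in> F"
            then have "even (rk F f) \<noteq> even (rk F h)" using odd[of f] hf by auto
            then show False using flip rkF[of f] rkF[of h] hf by simp
          qed
          then have fE: "f \<notin> E" using E by simp
          have rk': "rk (insert f E) g = (if f < g then Suc (rk E g) else rk E g)" for g
            using E fE rk_insert[of E f g] by simp
          \<comment> \<open>No other added element lies between h and f, so exchanging h for f
            leaves the ranks of these elements unchanged, and f already has their parity.\<close>
          have *: "even (rk (insert f E) g) = even (rk E f)" if "g \<in> insert f E - B" for g
          proof (cases "g = f")
            case True
            then show ?thesis by (simp add: rk')
          next
            case gf: False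
            then have g: "g \<in> F - insert h B" using that E by auto
            then have "(f < g) = (h < g)"
            proof (cases "g < f")
              case True
              then have "\<not> h < g" using btw[of g] g by auto
              then show ?thesis using True by simp
            next
              case False
              then show ?thesis using gf hf(3) by simp
            qed
            then have "rk (insert f E) g = rk F g" by (simp add: rk' rkF)
            then show ?thesis using odd[OF g] flip rkF[of h] by simp
          qed
          have "card (insert f E) = card B + Suc k + 2"
            using F(3) E fE by simp
          moreover have "same_parity (insert f E) (insert f E - B)"
            by (rule same_parityI) (rule *)
          moreover have "B \<subseteq> insert f E" "insert f E \<subseteq> {1..n}" using E F(2) hf(2) by auto
          ultimately show ?thesis by blast
        qed
      qed
    qed
  }
qed

section \<open>Cones and norms\<close>

text \<open>The condition \<open>steps_at\<close> does not stop at n: beyond the largest element of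
  \<nu> it forces constancy up to indices above n, where the entries are 0. This replaces the
  separate vanishing clause.\<close>

lemma Rcone_eq:
  assumes "\<nu> \<subseteq> {1..n}"
  shows "Rcone n \<nu> = {x \<in> decr n. steps_at \<nu> x}"
proof (intro equalityI subsetI)
  have fin: "finite \<nu>" by (rule finite_subset[OF assms finite_atLeastAtMost])
  fix x assume x: "x \<in> Rcone n \<nu>"
  have "x i = x (Suc i)" if i: "1 \<le> i" "i \<notin> \<nu>" for i
  proof -
    have "i \<noteq> topidx \<nu>"
      using i Max_in[OF fin] by (cases "\<nu> = {}") (simp add: topidx_def, auto simp: topidx_def)
    then consider "i < topidx \<nu>" | "topidx \<nu> < i" by linarith
    then show ?thesis
      using x i by cases (auto simp: Rcone_def)
  qed
  then have "steps_at \<nu> x" by (rule steps_atI)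
  moreover have "x \<in> decr n" using x by (simp add: Rcone_def decr_def)
  ultimately show "x \<in> {x \<in> decr n. steps_at \<nu> x}" by simp
next
  have fin: "finite \<nu>" by (rule finite_subset[OF assms finite_atLeastAtMost])
  fix x assume "x \<in> {x \<in> decr n. steps_at \<nu> x}"
  then have x: "x \<in> decr n" "steps_at \<nu> x" by auto
  have "x i = 0" if i: "topidx \<nu> < i" for i
  proof -
    have "\<nu> \<subseteq> {..topidx \<nu>}" using fin by (auto simp: topidx_def)
    with i have "\<nu> \<subseteq> {..<i}" "\<nu> \<subseteq> {..<i + Suc n}" by auto
    then have "rk \<nu> i = rk \<nu> (i + Suc n)" by (simp add: rk_eq_card)
    then have "x i = x (i + Suc n)"
      using i by (intro steps_at_rk_eq[OF fin x(2)]) auto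
    also have "\<dots> = 0" using x(1) by (simp add: decr_def orthant_def)
    finally show ?thesis .
  qed
  moreover have "x i = x (i + 1)" if "1 \<le> i" "i \<notin> \<nu>" for i
    using steps_atD[OF x(2) that] by simp
  ultimately show "x \<in> Rcone n \<nu>"
    using x(1) unfolding Rcone_def decr_def by blast
qed

section \<open>Coordinates of a cone with respect to its ray generators\<close>

definition comb :: "nat set \<Rightarrow> (nat \<Rightarrow> real) \<Rightarrow> nat \<Rightarrow> real" where
  "comb F c i = (\<Sum>k\<in>F. c k * gen k i)"

lemma comb_0 [simp]: "comb F c 0 = 0"
  by (simp add: comb_def gen_def)

lemma comb_1: "0 \<notin> F \<Longrightarrow> comb F c 1 = sum c F"
  unfolding comb_def by (rule sum.cong) (auto simp: gen_def Suc_le_eq intro: gr0I)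

lemma comb_step:
  assumes "finite F" "1 \<le> i"
  shows "comb F c i = comb F c (Suc i) + (if i \<in> F then c i else 0)"
proof -
  have "comb F c i = (\<Sum>k\<in>F. c k * gen k (Suc i) + (if k = i then c i else 0))"
    unfolding comb_def by (rule sum.cong) (use assms in \<open>auto simp: gen_def\<close>)
  then show ?thesis
    using assms by (simp add: sum.distrib comb_def)
qed

lemma comb_steps_at:
  assumes "finite F" shows "steps_at F (comb F c)"
proof (rule steps_atI)
  fix i assume "1 \<le> i" "i \<notin> F"
  then show "comb F c i = comb F c (Suc i)" using comb_step[OF assms, of i c] by simp
qed

lemma comb_decr:
  assumes F: "F \<subseteq> {1..Suc n}" and c: "\<And>k. k \<in> F \<Longrightarrow> 0 \<le> c k" "Suc n \<in> F \<Longrightarrow> c (Suc n) = 0"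
  shows "comb F c \<in> decr n"
proof -
  have fin: "finite F" by (rule finite_subset[OF F finite_atLeastAtMost])
  have "0 \<le> comb F c i" for i
    unfolding comb_def using c by (intro sum_nonneg) (auto simp: gen_def)
  moreover have zero: "comb F c i = 0" if "n < i" for i
    unfolding comb_def
  proof (rule sum.neutral, rule ballI)
    fix k assume "k \<in> F"
    then show "c k * gen k i = 0"
      using that F c(2) by (cases "k = Suc n") (auto simp: gen_def)
  qed
  moreover have "comb F c (Suc i) \<le> comb F c i" if "1 \<le> i" for i
    using comb_step[OF fin that, of c] c(1)[of i] by (auto split: if_splits)
  moreover have "comb F c i = 0" if "i \<notin> {1..n}" for i
    using that zero[of i] by (cases "i = 0") auto
  ultimately show ?thesis
    by (simp add: decr_def orthant_def)
qed

lemma decr_0: "x \<in> decr n \<Longrightarrow> x 0 = 0"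
  by (simp add: decr_def orthant_def)

lemma decr_beyond: "x \<in> decr n \<Longrightarrow> n < i \<Longrightarrow> x i = 0"
  by (simp add: decr_def orthant_def)

text \<open>The coefficient of a generator is the step at its index. The difference of the two sides
  then has no steps on positive indices, and it is 0 beyond n and all of F.\<close>

lemma decr_eq_comb:
  assumes x: "x \<in> decr n" "steps_at F x" and F: "finite F"
  shows "x = comb F (\<lambda>k. x k - x (Suc k))"
proof
  fix i
  define e where "e i = x i - comb F (\<lambda>k. x k - x (Suc k)) i" for i
  have "e i = e (Suc i)" if "1 \<le> i" for i
    using comb_step[OF F that, of "\<lambda>k. x k - x (Suc k)"] steps_atD[OF x(2) that]
    by (cases "i \<in> F") (simp_all add: e_def)
  then have st: "steps_at {} e" unfolding steps_at_def by blast
  define N where "N = Suc (n + Max (insert 0 F))"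
  have "gen k N = 0" if "k \<in> F" for k
  proof -
    have "k \<le> Max (insert 0 F)" using F that by (intro Max_ge) auto
    then show ?thesis by (simp add: gen_def N_def)
  qed
  then have eN: "e N = 0"
    using decr_beyond[OF x(1), of N] by (simp add: e_def comb_def N_def)
  show "x i = comb F (\<lambda>k. x k - x (Suc k)) i"
  proof (cases "i = 0")
    case True
    then show ?thesis using decr_0[OF x(1)] by simp
  next
    case False
    then have "e i = e N"
      by (intro steps_at_rk_eq[OF _ st]) (auto simp: rk_def N_def)
    with eN show ?thesis by (simp add: e_def)
  qed
qed

text \<open>For decreasing x these are the generators occurring with positive coefficient, that is,
  those of the smallest cone containing x.\<close>

definition jumps :: "(nat \<Rightarrow> real) \<Rightarrow> nat set" where
  "jumps x = {i. 1 \<le> i \<and> x (Suc i) < x i}"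

lemma jumps_subset:
  assumes "x \<in> decr n" shows "jumps x \<subseteq> {1..n}"
proof
  fix i assume i: "i \<in> jumps x"
  have "i \<le> n"
  proof (rule ccontr)
    assume "\<not> i \<le> n"
    then show False using decr_beyond[OF assms, of i] decr_beyond[OF assms, of "Suc i"] i
      by (simp add: jumps_def)
  qed
  then show "i \<in> {1..n}" using i by (simp add: jumps_def)
qed

lemma steps_at_jumps:
  assumes "x \<in> decr n" shows "steps_at (jumps x) x"
  unfolding steps_at_def
proof (intro allI impI)
  fix i assume "1 \<le> i" "i \<notin> jumps x"
  then show "x i = x (Suc i)" using decr_antimono[OF assms, of i "Suc i"] by (simp add: jumps_def)
qed

lemma decr_first_pos:
  assumes x: "x \<in> decr n" "x \<noteq> (\<lambda>_. 0)"
  shows "0 < x 1"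
proof (rule ccontr)
  assume "\<not> 0 < x 1"
  then have "x i = 0" for i
    using decr_antimono[OF x(1), of 1 i] decr_nonneg[OF x(1), of i] decr_0[OF x(1)]
    by (cases "i = 0") auto
  with x(2) show False by auto
qed

lemma decr_scale: "x \<in> decr n \<Longrightarrow> 0 \<le> t \<Longrightarrow> (\<lambda>i. t * x i) \<in> decr n"
  by (auto simp: decr_def orthant_def mult_left_mono)

lemma steps_at_scale:
  assumes "steps_at F x" shows "steps_at F (\<lambda>i. t * x i)"
proof (rule steps_atI)
  fix i assume "1 \<le> i" "i \<notin> F"
  then have "x i = x (Suc i)" by (rule steps_atD[OF assms])
  then show "t * x i = t * x (Suc i)" by (rule arg_cong)
qed

lemma inj_on_gen: "inj_on gen {1..}"
proof (rule inj_onI)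
  fix k l :: nat assume kl: "k \<in> {1..}" "l \<in> {1..}" "gen k = gen l"
  from fun_cong[OF kl(3), of k] fun_cong[OF kl(3), of l] kl(1,2) show "k = l"
    by (auto simp: gen_def split: if_splits)
qed

text \<open>Every \<open>gen k\<close> with k \<ge> 1 has first entry 1, so the coefficient sum of a
  combination is its first entry, and the simplex is the slice of the cone at height 1.\<close>

lemma cross_section_eq:
  assumes \<nu>: "\<nu> \<subseteq> {1..n}"
  shows "cross_section \<nu> = {x \<in> decr n. steps_at \<nu> x \<and> x 1 = 1}"
proof (intro equalityI subsetI)
  have fin: "finite \<nu>" by (rule finite_subset[OF \<nu> finite_atLeastAtMost])
  have inj: "inj_on gen \<nu>" by (rule inj_on_subset[OF inj_on_gen]) (use \<nu> in auto)
  have \<nu>0: "0 \<notin> \<nu>" using \<nu> by auto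
  {
    fix x assume "x \<in> cross_section \<nu>"
    then obtain c where c: "\<forall>v\<in>gen ` \<nu>. 0 \<le> c v" "(\<Sum>v\<in>gen ` \<nu>. c v) = 1"
      and x: "x = (\<lambda>i. \<Sum>v\<in>gen ` \<nu>. c v * v i)"
      by (auto simp: cross_section_def simplex_hull_def)
    have x: "x = comb \<nu> (c \<circ> gen)"
      unfolding x comb_def by (rule ext) (simp add: sum.reindex[OF inj])
    have "x 1 = 1" unfolding x using comb_1[OF \<nu>0] c(2) by (simp add: sum.reindex[OF inj])
    moreover have "x \<in> decr n"
      unfolding x using \<nu> c(1) by (intro comb_decr) auto
    moreover have "steps_at \<nu> x" unfolding x by (rule comb_steps_at[OF fin])
    ultimately show "x \<in> {x \<in> decr n. steps_at \<nu> x \<and> x 1 = 1}" by simp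
  next
    fix x assume "x \<in> {x \<in> decr n. steps_at \<nu> x \<and> x 1 = 1}"
    then have x: "x \<in> decr n" "steps_at \<nu> x" "x 1 = 1" by auto
    define c where "c k = x k - x (Suc k)" for k
    have xc: "x = comb \<nu> c"
      using decr_eq_comb[OF x(1,2) fin] by (simp add: c_def[abs_def])
    \<comment> \<open>The coefficients in \<open>simplex_hull\<close> are indexed by the vectors
      themselves; injectivity of \<open>gen\<close> carries them over from the indices.\<close>
    define c' where "c' = c \<circ> inv_into \<nu> gen"
    have c': "c' (gen k) = c k" if "k \<in> \<nu>" for k
      using that inj by (simp add: c'_def)
    have "x = (\<lambda>i. \<Sum>v\<in>gen ` \<nu>. c' v * v i)"
      by (subst xc) (auto simp: comb_def sum.reindex[OF inj] c')
    moreover have "\<forall>v\<in>gen ` \<nu>. 0 \<le> c' v"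
    proof
      fix v assume "v \<in> gen ` \<nu>"
      then obtain k where "k \<in> \<nu>" "v = gen k" by auto
      then show "0 \<le> c' v" using c'[of k] decr_antimono[OF x(1), of k "Suc k"] \<nu> by (auto simp: c_def)
    qed
    moreover have "(\<Sum>v\<in>gen ` \<nu>. c' v) = 1"
      using x(3) comb_1[OF \<nu>0, of c] by (simp add: sum.reindex[OF inj] c' xc[symmetric])
    ultimately show "x \<in> cross_section \<nu>"
      unfolding cross_section_def simplex_hull_def by blast
  }
qed

lemma cross_section_scaling:
  assumes \<nu>: "\<nu> \<subseteq> {1..n}" and x: "x \<in> Rcone n \<nu> - {\<lambda>_. 0}"
  shows "\<exists>!y. y \<in> cross_section \<nu> \<and> (\<exists>t>0. x = (\<lambda>i. t * y i))"
proof -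
  have x': "x \<in> decr n" "steps_at \<nu> x" "x \<noteq> (\<lambda>_. 0)" using x Rcone_eq[OF \<nu>] by auto
  have pos: "0 < x 1" by (rule decr_first_pos[OF x'(1,3)])
  show ?thesis
  proof (intro ex1I conjI exI)
    show "(\<lambda>i. inverse (x 1) * x i) \<in> cross_section \<nu>"
      using x' pos decr_scale[of x n "inverse (x 1)"] steps_at_scale[of \<nu> x] by (simp add: cross_section_eq[OF \<nu>])
    show "0 < x 1" by fact
    show "x = (\<lambda>i. x 1 * (inverse (x 1) * x i))"
      using pos by (simp add: mult.assoc[symmetric])
  next
    fix y assume "y \<in> cross_section \<nu> \<and> (\<exists>t>0. x = (\<lambda>i. t * y i))"
    then obtain t where t: "y \<in> cross_section \<nu>" "0 < t" "x = (\<lambda>i. t * y i)" by blast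
    then have "y 1 = 1" by (simp add: cross_section_eq[OF \<nu>])
    then show "y = (\<lambda>i. inverse (x 1) * x i)" using t by auto
  qed
qed

lemma cross_section_subset:
  assumes \<nu>: "\<nu> \<subseteq> {1..n}"
  shows "cross_section \<nu> \<subseteq> Rcone n \<nu> - {\<lambda>_. 0}"
  by (auto simp: Rcone_eq[OF \<nu>] cross_section_eq[OF \<nu>])

text \<open>Sort the entries: power sums are symmetric.\<close>

lemma ex_decr_same_psum:
  assumes x: "x \<in> orthant n"
  shows "\<exists>y\<in>decr n. \<forall>p. psum n p y = psum n p x"
proof -
  define xs where "xs = rev (sort (map x [1..<Suc n]))"
  have len: "length xs = n" by (simp add: xs_def)
  have nn: "0 \<le> xs ! i" if "i < n" for i
  proof -
    have "xs ! i \<in> set xs" using that len by simp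
    then show ?thesis using orthant_nonneg[OF x] by (auto simp: xs_def)
  qed
  define y where "y i = (if i \<in> {1..n} then xs ! (i - 1) else 0)" for i
  have "y (i + 1) \<le> y i" if "1 \<le> i" "i < n" for i
    using that len sorted_rev_nth_mono[of xs "i - 1" i] by (simp add: y_def xs_def)
  then have "y \<in> decr n"
    using nn by (auto simp: decr_def orthant_def y_def)
  moreover have "psum n p y = psum n p x" for p
  proof -
    have "psum n p y = (\<Sum>i<n. (xs ! i) ^ p)"
      unfolding psum_def by (rule sum.reindex_bij_witness[of _ Suc "\<lambda>i. i - 1"]) (auto simp: y_def)
    also have "\<dots> = sum_list (map (\<lambda>z. z ^ p) xs)"
      by (simp add: sum_list_sum_nth len atLeast0LessThan)
    also have "\<dots> = sum_mset (image_mset (\<lambda>z. z ^ p) (mset xs))"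
      by (simp only: mset_map[symmetric] sum_mset_sum_list)
    also have "\<dots> = sum_mset (image_mset (\<lambda>z. z ^ p) (mset (map x [1..<Suc n])))"
      by (simp add: xs_def)
    also have "\<dots> = sum_list (map (\<lambda>i. x i ^ p) [1..<Suc n])"
      by (simp only: mset_map[symmetric] sum_mset_sum_list map_map o_def)
    also have "\<dots> = psum n p x"
      unfolding psum_def by (simp only: interv_sum_list_conv_sum_set_nat) (rule sum.cong, auto)
    finally show ?thesis .
  qed
  ultimately show ?thesis by blast
qed

section \<open>Positivity and scaling of power sums and norms\<close>

lemma psum_nonneg: "x \<in> orthant n \<Longrightarrow> 0 \<le> psum n p x"
  unfolding psum_def by (intro sum_nonneg zero_le_power orthant_nonneg)

lemma psum_pos:
  assumes x: "x \<in> orthant n" "x \<noteq> (\<lambda>_. 0)"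
  shows "0 < psum n p x"
proof -
  obtain i where i: "x i \<noteq> 0" using x(2) by auto
  then have "i \<in> {1..n}" using x(1) by (auto simp: orthant_def)
  moreover have "0 < x i ^ p" using i orthant_nonneg[OF x(1), of i] by simp
  ultimately show ?thesis
    unfolding psum_def by (intro sum_pos2[where i=i] zero_le_power orthant_nonneg[OF x(1)]) auto
qed

lemma psum_zero: "0 < p \<Longrightarrow> psum n p (\<lambda>_. 0) = 0"
  by (simp add: psum_def)

lemma psum_scale: "psum n p (\<lambda>i. t * x i) = t ^ p * psum n p x"
  by (simp add: psum_def power_mult_distrib sum_distrib_left)

lemma pnorm_psum: "pnorm n p x = psum n p x powr (1 / real p)"
  by (simp add: pnorm_def psum_def)

lemma pnorm_nonneg: "0 \<le> pnorm n p x"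
  by (simp add: pnorm_psum)

lemma pnorm_pos: "x \<in> orthant n \<Longrightarrow> x \<noteq> (\<lambda>_. 0) \<Longrightarrow> 0 < pnorm n p x"
  using psum_pos[of x n p] by (simp add: pnorm_psum)

lemma pnorm_power:
  assumes "x \<in> orthant n" "0 < p"
  shows "pnorm n p x ^ p = psum n p x"
proof (cases "psum n p x = 0")
  case True
  then show ?thesis using assms by (simp add: pnorm_psum)
next
  case False
  then have "0 < psum n p x" using psum_nonneg[OF assms(1), of p] by simp
  then show ?thesis using assms by (simp add: pnorm_psum powr_power)
qed

lemma pnorm_scale:
  assumes "x \<in> orthant n" "0 < p" "0 \<le> t"
  shows "pnorm n p (\<lambda>i. t * x i) = t * pnorm n p x"
proof (cases "t = 0")
  case True
  then show ?thesis using assms by (simp add: pnorm_psum psum_def)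
next
  case False
  then show ?thesis
    using assms psum_nonneg[of x n p] by (simp add: pnorm_psum psum_scale powr_mult powr_powr powr_realpow[symmetric])
qed

lemma pnorm_eq_iff:
  assumes "x \<in> orthant n" "y \<in> orthant n" "0 < p"
  shows "pnorm n p x = pnorm n p y \<longleftrightarrow> psum n p x = psum n p y"
proof
  assume "pnorm n p x = pnorm n p y"
  then show "psum n p x = psum n p y"
    by (simp only: pnorm_power[OF assms(1,3), symmetric] pnorm_power[OF assms(2,3), symmetric])
qed (simp add: pnorm_psum)

section \<open>Topology of the cells\<close>

lemma continuous_on_psum: "continuous_on S (psum n p)"
  unfolding psum_def
  by (intro continuous_on_sum continuous_on_power continuous_on_subset[OF continuous_on_product_coordinates]) auto

text \<open>Invariance of domain takes the place of a nonvanishing Jacobian: continuity and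
  injectivity in M parameters suffice. The coordinates of \<open>Euclidean_space M\<close> start at
  0, which causes the shift \<open>a (Suc j)\<close> later on.\<close>

lemma psum_open_image:
  fixes X :: "(nat \<Rightarrow> real) \<Rightarrow> nat \<Rightarrow> real"
  assumes U: "openin (Euclidean_space M) U"
    and X: "\<And>i. continuous_on UNIV (\<lambda>e. X e i)"
    and inj: "\<And>e e'. e \<in> U \<Longrightarrow> e' \<in> U \<Longrightarrow> (\<And>j. j < M \<Longrightarrow> psum N (b j) (X e) = psum N (b j) (X e')) \<Longrightarrow> e = e'"
  shows "openin (Euclidean_space M) ((\<lambda>e j. if j < M then psum N (b j) (X e) else 0) ` U)"
proof (rule invariance_of_domain_Euclidean_space[OF U])
  define f where "f = (\<lambda>e j. if j < M then psum N (b j) (X e) else 0)"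
  have "continuous_on UNIV (\<lambda>e. f e j)" for j
  proof (cases "j < M")
    case True
    have "continuous_on UNIV (\<lambda>e. \<Sum>i=1..N. X e i ^ b j)"
      by (intro continuous_on_sum continuous_on_power X)
    then show ?thesis using True by (simp add: f_def psum_def)
  qed (simp add: f_def)
  then have "continuous_on UNIV f"
    by (rule continuous_on_coordinatewise_then_product)
  then have "continuous_map (powertop_real UNIV) (powertop_real UNIV) f"
    by (simp add: euclidean_product_topology)
  then show "continuous_map (subtopology (Euclidean_space M) U) (Euclidean_space M)
      (\<lambda>e j. if j < M then psum N (b j) (X e) else 0)"
    unfolding f_def[symmetric] Euclidean_space_def
    by (auto simp: continuous_map_in_subtopology f_def intro!: continuous_map_from_subtopology)
  show "inj_on (\<lambda>e j. if j < M then psum N (b j) (X e) else 0) U"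
  proof (rule inj_onI)
    fix e e' assume e: "e \<in> U" "e' \<in> U"
      and eq: "(\<lambda>j. if j < M then psum N (b j) (X e) else 0) = (\<lambda>j. if j < M then psum N (b j) (X e') else 0)"
    have "psum N (b j) (X e) = psum N (b j) (X e')" if "j < M" for j
      using fun_cong[OF eq, of j] that by simp
    then show "e = e'" by (rule inj[OF e])
  qed
qed

lemma openin_Euclidean_space_iff:
  "openin (Euclidean_space M) U \<longleftrightarrow> (\<exists>T. open T \<and> U = T \<inter> {x. \<forall>i\<ge>M. x i = 0})"
  by (auto simp: Euclidean_space_def openin_subtopology euclidean_product_topology)

lemma openin_positive_orthant:
  "openin (Euclidean_space M) {e. (\<forall>i\<ge>M. e i = 0) \<and> (\<forall>i<M. i \<in> S \<longrightarrow> 0 < e i)}"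
proof -
  have "open (\<Inter>i\<in>{..<M} \<inter> S. {e :: nat \<Rightarrow> real. 0 < e i})"
    by (intro open_INT ballI open_Collect_less continuous_on_const continuous_on_product_coordinates) auto
  moreover have "{e. (\<forall>i\<ge>M. e i = 0) \<and> (\<forall>i<M. i \<in> S \<longrightarrow> 0 < e i)}
      = (\<Inter>i\<in>{..<M} \<inter> S. {e :: nat \<Rightarrow> real. 0 < e i}) \<inter> {x. \<forall>i\<ge>M. x i = 0}"
    by auto
  ultimately show ?thesis
    unfolding openin_Euclidean_space_iff by (intro exI conjI)
qed

lemma continuous_on_Min_image:
  fixes f :: "'a::topological_space \<Rightarrow> 'b \<Rightarrow> real"
  assumes "finite G" "G \<noteq> {}" "\<And>g. g \<in> G \<Longrightarrow> continuous_on S (\<lambda>e. f e g)"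
  shows "continuous_on S (\<lambda>e. Min (f e ` G))"
  using assms
proof (induction G rule: finite_ne_induct)
  case (insert g G)
  then show ?case by (auto intro!: continuous_on_min)
qed simp

lemma closed_decr: "closed (decr n)"
proof -
  have c: "continuous_on UNIV (\<lambda>x :: nat \<Rightarrow> real. x i)" for i by simp
  have "decr n = (\<Inter>i\<in>{1..n}. {x. 0 \<le> x i}) \<inter> (\<Inter>i\<in>-{1..n}. {x. x i = 0})
      \<inter> (\<Inter>i\<in>{1..<n}. {x. x (i + 1) \<le> x i})"
    by (auto simp: decr_def orthant_def)
  moreover have "closed \<dots>"
    by (intro closed_Int closed_INT ballI closed_Collect_le closed_Collect_eq c continuous_on_const)
  ultimately show ?thesis by simp
qed

lemma closed_steps_at: "closed {x. steps_at F x}"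
proof -
  have c: "continuous_on UNIV (\<lambda>x :: nat \<Rightarrow> real. x i)" for i by simp
  have "{x. steps_at F x} = (\<Inter>i\<in>{1..} - F. {x :: nat \<Rightarrow> real. x i = x (Suc i)})"
  proof (intro equalityI subsetI)
    fix x :: "nat \<Rightarrow> real" assume "x \<in> {x. steps_at F x}"
    then show "x \<in> (\<Inter>i\<in>{1..} - F. {x. x i = x (Suc i)})" using steps_atD[of F x] by blast
  next
    fix x :: "nat \<Rightarrow> real" assume x: "x \<in> (\<Inter>i\<in>{1..} - F. {x. x i = x (Suc i)})"
    have "steps_at F x"
    proof (rule steps_atI)
      fix i assume "1 \<le> i" "i \<notin> F"
      then have "i \<in> {1..} - F" by simp
      with x show "x i = x (Suc i)" by blast
    qed
    then show "x \<in> {x. steps_at F x}" by simp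
  qed
  moreover have "closed \<dots>"
    by (intro closed_INT ballI closed_Collect_eq c)
  ultimately show ?thesis by simp
qed

text \<open>The first entry bounds all others, so this is a closed subset of a Tychonoff
  cube.\<close>

lemma compact_decr_bounded: "compact {x \<in> decr n. x 1 \<le> T}"
proof -
  have "compactin (product_topology (\<lambda>_. euclidean) UNIV) (PiE UNIV (\<lambda>_::nat. {0..T}))"
    unfolding compactin_PiE by simp
  then have "compact (PiE UNIV (\<lambda>_::nat. {0..T}))"
    by (simp add: euclidean_product_topology)
  moreover have "closed {x :: nat \<Rightarrow> real. x 1 \<le> T}"
    by (intro closed_Collect_le continuous_on_const continuous_on_product_coordinates)
  ultimately have "compact (PiE UNIV (\<lambda>_::nat. {0..T}) \<inter> (decr n \<inter> {x. x 1 \<le> T}))"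
    using closed_decr[of n] by (intro compact_Int_closed closed_Int)
  moreover have "PiE UNIV (\<lambda>_::nat. {0..T}) \<inter> (decr n \<inter> {x. x 1 \<le> T}) = {x \<in> decr n. x 1 \<le> T}"
  proof -
    have "x i \<in> {0..T}" if x: "x \<in> decr n" "x 1 \<le> T" for x i
      using decr_nonneg[OF x(1), of i] decr_antimono[OF x(1), of 1 i] decr_0[OF x(1)] x(2) decr_nonneg[OF x(1), of 1]
      by (cases "i = 0") auto
    then show ?thesis unfolding PiE_UNIV_domain by blast
  qed
  ultimately show ?thesis by simp
qed

lemma compact_cross_section:
  assumes "\<nu> \<subseteq> {1..n}"
  shows "compact (cross_section \<nu>)"
proof -
  have "closed {x :: nat \<Rightarrow> real. x 1 = 1}"
    by (intro closed_Collect_eq continuous_on_const continuous_on_product_coordinates)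
  then have "compact ({x \<in> decr n. x 1 \<le> 1} \<inter> ({x. x 1 = 1} \<inter> {x. steps_at \<nu> x}))"
    by (intro compact_Int_closed compact_decr_bounded closed_Int closed_steps_at)
  moreover have "{x \<in> decr n. x 1 \<le> 1} \<inter> ({x. x 1 = 1} \<inter> {x. steps_at \<nu> x}) = cross_section \<nu>"
    unfolding cross_section_eq[OF assms] by auto
  ultimately show ?thesis by simp
qed

section \<open>The normalised norm map on a single cone\<close>

locale power_norms =
  fixes m n :: nat and a :: "nat \<Rightarrow> nat"
  assumes m: "1 \<le> m" "m \<le> n" and a_mono: "strict_mono_on {1..m} a" and a_pos: "\<forall>j\<in>{1..m}. 0 < a j"
begin

abbreviation "\<psi> \<equiv> psiA m a n"

abbreviation "punctured \<equiv> orthant n - {\<lambda>_. 0}"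

definition norm_sum :: "(nat \<Rightarrow> real) \<Rightarrow> real" where
  "norm_sum x = (\<Sum>k=1..m. pnorm n (a k) x)"

lemma psi_eq: "\<psi> x j = (if j \<in> {1..m} then pnorm n (a j) x / norm_sum x else 0)"
  by (simp add: psiA_def norm_sum_def)

lemma norm_sum_pos: "x \<in> punctured \<Longrightarrow> 0 < norm_sum x"
  unfolding norm_sum_def using m by (intro sum_pos pnorm_pos) auto

lemma decr_orthant: "x \<in> decr n \<Longrightarrow> x \<in> orthant n"
  by (simp add: decr_def)

lemma orthant_scale: "x \<in> orthant n \<Longrightarrow> 0 \<le> t \<Longrightarrow> (\<lambda>i. t * x i) \<in> orthant n"
  by (auto simp: orthant_def)

lemma psi_cong:
  assumes "\<And>j. j \<in> {1..m} \<Longrightarrow> psum n (a j) x = psum n (a j) y"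
  shows "\<psi> x = \<psi> y"
proof -
  have "pnorm n (a j) x = pnorm n (a j) y" if "j \<in> {1..m}" for j
    using assms[OF that] by (simp add: pnorm_psum)
  then show ?thesis by (auto simp: psi_eq norm_sum_def intro!: ext sum.cong arg_cong2[where f="(/)"])
qed

lemma pnorm_scale': "x \<in> orthant n \<Longrightarrow> 0 \<le> t \<Longrightarrow> j \<in> {1..m} \<Longrightarrow>
    pnorm n (a j) (\<lambda>i. t * x i) = t * pnorm n (a j) x"
  using a_pos by (intro pnorm_scale) auto

lemma norm_sum_scale: "x \<in> orthant n \<Longrightarrow> 0 \<le> t \<Longrightarrow> norm_sum (\<lambda>i. t * x i) = t * norm_sum x"
  unfolding norm_sum_def sum_distrib_left by (intro sum.cong pnorm_scale') auto

lemma psi_scale: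
  assumes "x \<in> orthant n" "0 < t"
  shows "\<psi> (\<lambda>i. t * x i) = \<psi> x"
proof
  fix j
  show "\<psi> (\<lambda>i. t * x i) j = \<psi> x j"
    using pnorm_scale'[OF assms(1), of t j] norm_sum_scale[OF assms(1), of t] assms(2) by (simp add: psi_eq)
qed

text \<open>The point \<open>\<psi> y\<close> fixes the norms up to a common factor, which scaling y
  supplies. N need not come from a vector beforehand: the boundary argument inserts perturbed
  norms.\<close>

lemma psi_rescale:
  assumes y: "y \<in> punctured" and eq: "\<And>j. j \<in> {1..m} \<Longrightarrow> \<psi> y j = N j / sum N {1..m}"
    and N: "0 < sum N {1..m}"
  shows "\<exists>t>0. \<forall>j\<in>{1..m}. pnorm n (a j) (\<lambda>i. t * y i) = N j"
proof (intro exI[of _ "sum N {1..m} / norm_sum y"] conjI ballI)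
  note pos = norm_sum_pos[OF y] N
  show t: "0 < sum N {1..m} / norm_sum y" using pos by simp
  fix j assume j: "j \<in> {1..m}"
  have "pnorm n (a j) y / norm_sum y = N j / sum N {1..m}"
    using eq[OF j] j by (simp add: psi_eq)
  then have "pnorm n (a j) y * sum N {1..m} / norm_sum y = N j"
    using pos by (simp add: field_simps)
  then show "pnorm n (a j) (\<lambda>i. sum N {1..m} / norm_sum y * y i) = N j"
    using pnorm_scale'[of y "sum N {1..m} / norm_sum y" j] y j t by (simp add: mult.commute)
qed

lemma psi_eqD:
  assumes x: "x \<in> punctured" and y: "y \<in> punctured" and eq: "\<psi> x = \<psi> y"
  shows "\<exists>t>0. \<forall>j\<in>{1..m}. psum n (a j) x = psum n (a j) (\<lambda>i. t * y i)"
proof -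
  have "\<exists>t>0. \<forall>j\<in>{1..m}. pnorm n (a j) (\<lambda>i. t * y i) = pnorm n (a j) x"
  proof (rule psi_rescale[OF y])
    show "0 < (\<Sum>j=1..m. pnorm n (a j) x)"
      using norm_sum_pos[OF x] by (simp add: norm_sum_def)
    fix j assume "j \<in> {1..m}"
    then show "\<psi> y j = pnorm n (a j) x / (\<Sum>j=1..m. pnorm n (a j) x)"
      unfolding eq[symmetric] by (simp add: psi_eq norm_sum_def)
  qed
  then obtain t where t: "0 < t" "\<And>j. j \<in> {1..m} \<Longrightarrow> pnorm n (a j) (\<lambda>i. t * y i) = pnorm n (a j) x"
    by blast
  have "psum n (a j) x = psum n (a j) (\<lambda>i. t * y i)" if "j \<in> {1..m}" for j
    using t(2)[OF that] pnorm_eq_iff[of x n "\<lambda>i. t * y i" "a j"] x y orthant_scale[of y t] t(1) a_pos that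
    by auto
  with t(1) show ?thesis by blast
qed

lemma psi_hyperplane: "x \<in> punctured \<Longrightarrow> \<psi> x \<in> hyperplane m"
  using norm_sum_pos[of x] by (auto simp: hyperplane_def psi_eq sum_divide_distrib[symmetric] norm_sum_def)

lemma exponents: "strict_mono_on {..<m} (\<lambda>j. a (Suc j))" "0 < a (Suc 0)"
  using a_mono a_pos m by (auto simp: monotone_on_def)

lemma decr_inj:
  assumes x: "x \<in> decr n" and y: "y \<in> decr n" and st: "steps_at F (\<lambda>i. x i - y i)"
    and F: "finite F" "card F \<le> m" "0 \<notin> F"
    and eq: "\<And>j. j \<in> {1..m} \<Longrightarrow> psum n (a j) x = psum n (a j) y"
  shows "x = y"
  by (rule psum_inj_steps_at[OF x y st F(1) _ F(3) _ exponents m(1)]) (use F(2) eq in auto)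

lemma continuous_on_psi: "continuous_on punctured \<psi>"
proof (rule continuous_on_coordinatewise_then_product)
  fix j
  have c: "continuous_on punctured (pnorm n p)" for p
    unfolding pnorm_psum
    by (intro continuous_on_powr continuous_on_psum continuous_on_const) (rule ballI, use psum_pos[where p=p] in force)
  have "continuous_on punctured norm_sum"
    unfolding norm_sum_def by (intro continuous_on_sum c)
  then show "continuous_on punctured (\<lambda>x. \<psi> x j)"
  proof (cases "j \<in> {1..m}")
    case True
    have "\<forall>x\<in>punctured. norm_sum x \<noteq> 0" using norm_sum_pos by force
    with \<open>continuous_on punctured norm_sum\<close>
    have "continuous_on punctured (\<lambda>x. pnorm n (a j) x / norm_sum x)"
      by (intro continuous_on_divide c)
    then show ?thesis using True by (simp add: psi_eq)
  next
    case False
    then have "\<psi> x j = 0" for x by (simp only: psi_eq if_False)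
    then show ?thesis by simp
  qed
qed

lemma cross_section_punctured: "\<nu> \<subseteq> {1..n} \<Longrightarrow> cross_section \<nu> \<subseteq> punctured"
  by (auto simp: cross_section_eq decr_orthant)

text \<open>Facets are covered as well, since the hull of the remaining generators is again a
  cross-section. For empty \<nu>, which occurs as a facet when m = 1, both sides are empty.\<close>

lemma psi_cross_section:
  assumes \<nu>: "\<nu> \<subseteq> {1..n}"
  shows "\<psi> ` cross_section \<nu> = Bset m a n \<nu>"
proof (intro equalityI subsetI)
  fix u assume "u \<in> \<psi> ` cross_section \<nu>"
  then show "u \<in> Bset m a n \<nu>" using cross_section_subset[OF \<nu>] by (auto simp: Bset_def)
next
  fix u assume "u \<in> Bset m a n \<nu>"
  then obtain x where x: "x \<in> Rcone n \<nu> - {\<lambda>_. 0}" "u = \<psi> x" by (auto simp: Bset_def)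
  from cross_section_scaling[OF \<nu> x(1)] obtain y t
    where y: "y \<in> cross_section \<nu>" "0 < t" "x = (\<lambda>i. t * y i)" by blast
  have "y \<in> orthant n" using y(1) cross_section_punctured[OF \<nu>] by auto
  then have "u = \<psi> y" using x(2) y psi_scale by simp
  with y(1) show "u \<in> \<psi> ` cross_section \<nu>" by simp
qed

lemma inj_on_psi_cross_section:
  assumes \<nu>: "\<nu> \<subseteq> {1..n}" "card \<nu> \<le> m"
  shows "inj_on \<psi> (cross_section \<nu>)"
proof (rule inj_onI)
  fix x y assume x: "x \<in> cross_section \<nu>" and y: "y \<in> cross_section \<nu>" and eq: "\<psi> x = \<psi> y"
  have fin: "finite \<nu>" by (rule finite_subset[OF \<nu>(1) finite_atLeastAtMost])
  note x' = x[unfolded cross_section_eq[OF \<nu>(1)], simplified]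
  note y' = y[unfolded cross_section_eq[OF \<nu>(1)], simplified]
  from psi_eqD[OF _ _ eq] obtain t where t: "0 < t"
    "\<And>j. j \<in> {1..m} \<Longrightarrow> psum n (a j) x = psum n (a j) (\<lambda>i. t * y i)"
    using x y cross_section_punctured[OF \<nu>(1)] by blast
  have xy: "x = (\<lambda>i. t * y i)"
  proof (rule decr_inj[OF _ _ _ fin \<nu>(2)])
    show "x \<in> decr n" "(\<lambda>i. t * y i) \<in> decr n"
      using x' y' t(1) by (auto intro: decr_scale)
    show "steps_at \<nu> (\<lambda>i. x i - t * y i)"
      using x' y' by (intro steps_at_diff steps_at_scale) auto
    show "0 \<notin> \<nu>" using \<nu>(1) by auto
  qed (rule t(2))
  then have "t = 1" using x' y' fun_cong[OF xy, of 1] by simp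
  with xy show "x = y" by simp
qed

lemma homeomorphism_psi:
  assumes \<nu>: "\<nu> \<subseteq> {1..n}" "card \<nu> \<le> m"
  shows "\<exists>g. homeomorphism (cross_section \<nu>) (Bset m a n \<nu>) \<psi> g"
  using compact_cross_section[OF \<nu>(1)]
    continuous_on_subset[OF continuous_on_psi cross_section_punctured[OF \<nu>(1)]]
    psi_cross_section[OF \<nu>(1)] inj_on_psi_cross_section[OF \<nu>]
  by (rule homeomorphism_compact)

lemma psi_mem_Bset:
  assumes "x \<in> decr n" "x \<noteq> (\<lambda>_. 0)" "jumps x \<subseteq> \<nu>" "\<nu> \<subseteq> {1..n}"
  shows "\<psi> x \<in> Bset m a n \<nu>"
  using assms steps_at_mono[OF steps_at_jumps[OF assms(1)] assms(3)] by (auto simp: Bset_def Rcone_eq)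

lemma Bset_subset_image: "\<nu> \<subseteq> {1..n} \<Longrightarrow> Bset m a n \<nu> \<subseteq> \<psi> ` punctured"
  using psi_cross_section[of \<nu>] cross_section_punctured[of \<nu>] by blast

end

section \<open>Image and boundary\<close>

lemma alternates_swap:
  "alternates n M s (\<lambda>i. y i - x i) \<longleftrightarrow> alternates n M (- s) (\<lambda>i. x i - y i)"
proof -
  have "s * (-1) ^ k * (y i - x i) = - s * (-1) ^ k * (x i - y i)" for k i :: nat
    by (simp add: algebra_simps)
  then show ?thesis by (simp only: alternates_def)
qed

context power_norms
begin

text \<open>Openness in m-space of power sums passes to the hyperplane: a point u near
  \<open>\<psi> x\<close>, rescaled by r and raised to the powers, lands in V and is realised by
  some y. Roots of nonnegative numbers being unique, y has the norms r * u.\<close>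

lemma interior_not_frontier:
  assumes V: "openin (Euclidean_space m) V"
    and sub: "\<And>q. q \<in> V \<Longrightarrow> \<exists>y\<in>orthant n. \<forall>j<m. q j = psum n (a (Suc j)) y"
    and x: "x \<in> punctured" "(\<lambda>j. if j < m then psum n (a (Suc j)) x else 0) \<in> V"
  shows "\<psi> x \<notin> subtopology euclidean (hyperplane m) frontier_of (\<psi> ` punctured)"
proof -
  obtain T where T: "open T" "V = T \<inter> {x. \<forall>i\<ge>m. x i = 0}"
    using V unfolding openin_Euclidean_space_iff by blast
  define r where "r = norm_sum x"
  have r: "0 < r" using norm_sum_pos[OF x(1)] by (simp add: r_def)
  \<comment> \<open>The power sums that a vector with norms r * u would have; at
    \<open>\<psi> x\<close> they are those of x, because r is the sum of the norms of x.\<close>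
  define Q where "Q u j = (if j < m then (r * u (Suc j)) ^ a (Suc j) else 0)" for u j
  have "continuous_on UNIV (\<lambda>u. Q u j)" for j
  proof (cases "j < m")
    case True
    have "continuous_on UNIV (\<lambda>u. (r * u (Suc j)) ^ a (Suc j))"
      by (intro continuous_on_power continuous_on_mult continuous_on_const continuous_on_product_coordinates)
    then show ?thesis using True by (simp add: Q_def)
  qed (simp add: Q_def)
  then have "continuous_on UNIV Q" by (rule continuous_on_coordinatewise_then_product)
  then have "open (Q -` T)" using T(1) by (simp add: open_vimage)
  moreover have "open (\<Inter>j\<in>{1..m}. {u :: nat \<Rightarrow> real. 0 < u j})"
    by (intro open_INT ballI open_Collect_less continuous_on_const continuous_on_product_coordinates) auto
  ultimately have "open (Q -` T \<inter> (\<Inter>j\<in>{1..m}. {u. 0 < u j}))" by (rule open_Int)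
  then have W: "openin (top_of_set (hyperplane m)) (hyperplane m \<inter> (Q -` T \<inter> (\<Inter>j\<in>{1..m}. {u. 0 < u j})))"
    by (rule openin_open_Int)
  have rpsi: "r * \<psi> x (Suc j) = pnorm n (a (Suc j)) x" if "j < m" for j
    using r that by (simp add: psi_eq r_def[symmetric])
  have "Q (\<psi> x) = (\<lambda>j. if j < m then psum n (a (Suc j)) x else 0)"
  proof
    fix j
    show "Q (\<psi> x) j = (if j < m then psum n (a (Suc j)) x else 0)"
      using rpsi[of j] pnorm_power[of x n "a (Suc j)"] x(1) a_pos by (simp add: Q_def)
  qed
  then have "Q (\<psi> x) \<in> T" using x(2) T(2) by simp
  moreover have "0 < \<psi> x j" if "j \<in> {1..m}" for j
    using pnorm_pos[of x n "a j"] x(1) r that by (simp add: psi_eq r_def[symmetric])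
  ultimately have mem: "\<psi> x \<in> hyperplane m \<inter> (Q -` T \<inter> (\<Inter>j\<in>{1..m}. {u. 0 < u j}))"
    using psi_hyperplane[OF x(1)] by simp
  have W_sub: "hyperplane m \<inter> (Q -` T \<inter> (\<Inter>j\<in>{1..m}. {u. 0 < u j})) \<subseteq> \<psi> ` punctured"
  proof
    fix u assume "u \<in> hyperplane m \<inter> (Q -` T \<inter> (\<Inter>j\<in>{1..m}. {u. 0 < u j}))"
    then have u: "u \<in> hyperplane m" "Q u \<in> T" and u_pos: "u \<in> (\<Inter>j\<in>{1..m}. {u. 0 < u j})"
      by blast+
    note u = u INT_D[OF u_pos, THEN CollectD]
    have "Q u \<in> V" using u(2) T(2) by (simp add: Q_def)
    from sub[OF this] obtain y where y: "y \<in> orthant n" "\<And>j. j < m \<Longrightarrow> Q u j = psum n (a (Suc j)) y"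
      by blast
    have pn: "pnorm n (a j) y = r * u j" if j: "j \<in> {1..m}" for j
    proof -
      have "pnorm n (a j) y ^ a j = (r * u j) ^ a j"
      proof -
        have "j - 1 < m" "Suc (j - 1) = j" using j by auto
        then show ?thesis
          using pnorm_power[OF y(1), of "a j"] y(2)[of "j - 1"] j a_pos by (simp add: Q_def)
      qed
      then show ?thesis
      proof (rule power_eq_imp_eq_base)
        show "0 \<le> r * u j" using u(3)[OF j] r by (intro mult_nonneg_nonneg) linarith+
        show "0 < a j" using a_pos j by blast
      qed (rule pnorm_nonneg)
    qed
    have "y \<noteq> (\<lambda>_. 0)"
    proof
      assume "y = (\<lambda>_. 0)"
      then have "pnorm n (a 1) y = 0" using a_pos m by (simp add: pnorm_psum psum_zero)
      moreover have "0 < r * u 1" using u(3)[of 1] r m by simp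
      moreover have "pnorm n (a 1) y = r * u 1" using pn[of 1] m by simp
      ultimately show False by linarith
    qed
    then have yp: "y \<in> punctured" using y(1) by simp
    have "norm_sum y = (\<Sum>k=1..m. r * u k)"
      unfolding norm_sum_def by (rule sum.cong[OF refl pn])
    also have "\<dots> = r"
      using u(1) by (simp add: sum_distrib_left[symmetric] hyperplane_def)
    finally have "norm_sum y = r" .
    have "\<psi> y j = u j" for j
    proof (cases "j \<in> {1..m}")
      case True
      then show ?thesis using pn[OF True] r \<open>norm_sum y = r\<close> by (simp add: psi_eq)
    next
      case False
      then have "u j = 0" using u(1) unfolding hyperplane_def by blast
      then show ?thesis using False by (simp only: psi_eq if_False)
    qed
    then have "\<psi> y = u" by (rule ext)
    with yp show "u \<in> \<psi> ` punctured" by blast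
  qed
  have "\<psi> x \<in> top_of_set (hyperplane m) interior_of (\<psi> ` punctured)"
    by (rule subsetD[OF interior_of_maximal[OF W_sub W] mem])
  then show ?thesis by (simp add: frontier_of_def)
qed

text \<open>The fan of all combinations of the generators in F whose coefficients on G have minimum 0 is
  parametrised by an m-dimensional space: normalise the coefficient of one element of G to 0, and
  subtract the minimum over G. The index n + 1 is allowed in F as a dummy generator, whose
  coefficient is then always 0; this covers the interior of a single cone with m generators.\<close>

lemma fan_not_frontier:
  assumes F: "F \<subseteq> {1..Suc n}" "card F = Suc m" and G: "G \<subseteq> F" "G \<noteq> {}" "same_parity F G"
    and Suc_n: "Suc n \<in> F \<Longrightarrow> G = {Suc n}"
    and x: "x \<in> decr n" "x \<noteq> (\<lambda>_. 0)" "jumps x = F - G"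
  shows "\<psi> x \<notin> subtopology euclidean (hyperplane m) frontier_of (\<psi> ` punctured)"
proof -
  have fin: "finite F" by (rule finite_subset[OF F(1) finite_atLeastAtMost])
  have finG: "finite G" by (rule finite_subset[OF G(1) fin])
  have F0: "0 \<notin> F" using F(1) by auto
  obtain g0 where g0: "g0 \<in> G" using G(2) by blast
  have "card (F - {g0}) = m" using F(2) g0 G(1) fin by auto
  then obtain h where h: "bij_betw h {0..<m} (F - {g0})"
    using ex_bij_betw_nat_finite[of "F - {g0}"] fin by auto
  define \<iota> where "\<iota> = the_inv_into {0..<m} h"
  have \<iota>: "h (\<iota> k) = k" "\<iota> k < m" if "k \<in> F" "k \<noteq> g0" for k
    using f_the_inv_into_f_bij_betw[OF h, of k] bij_betwE[OF bij_betw_the_inv_into[OF h]] that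
    by (auto simp: \<iota>_def)
  have \<iota>h: "\<iota> (h i) = i" "h i \<in> F" "h i \<noteq> g0" if "i < m" for i
    using the_inv_into_f_f[of h "{0..<m}" i] h that bij_betwE[OF h] by (auto simp: \<iota>_def bij_betw_def)
  define E where "E e k = (if k = g0 then 0 else e (\<iota> k) :: real)" for e k
  define mn where "mn e = Min (E e ` G)" for e
  define C where "C e k = (if k \<in> G then E e k - mn e else E e k)" for e k
  define X where "X e = comb F (C e)" for e
  \<comment> \<open>Only coordinates belonging to generators outside G must be positive; those in G
    range over all reals, since subtracting the minimum makes them nonnegative.\<close>
  define U where "U = {e :: nat \<Rightarrow> real. (\<forall>i\<ge>m. e i = 0) \<and> (\<forall>i<m. i \<in> {i. h i \<notin> G} \<longrightarrow> 0 < e i)}"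
  have contE: "continuous_on UNIV (\<lambda>e. E e k)" for k
    by (cases "k = g0") (simp_all add: E_def)
  have "continuous_on UNIV mn"
    unfolding mn_def using finG G(2) contE by (rule continuous_on_Min_image)
  then have "continuous_on UNIV (\<lambda>e. C e k)" for k
    using contE by (cases "k \<in> G") (simp_all add: C_def continuous_on_diff)
  then have contX: "continuous_on UNIV (\<lambda>e. X e i)" for i
    unfolding X_def comb_def by (intro continuous_on_sum continuous_on_mult continuous_on_const)
  have U: "openin (Euclidean_space m) U"
    unfolding U_def by (rule openin_positive_orthant)
  have C_nonneg: "0 \<le> C e k" if "e \<in> U" "k \<in> F" for e k
  proof (cases "k \<in> G")
    case True
    then show ?thesis using finG by (simp add: C_def mn_def)
  next
    case False
    then have "k \<noteq> g0" using g0 by auto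
    then show ?thesis using \<iota>[OF that(2)] False that(1) by (simp add: C_def E_def U_def less_imp_le)
  qed
  have X_decr: "X e \<in> decr n" if "e \<in> U" for e
    unfolding X_def
  proof (rule comb_decr[OF F(1) C_nonneg[OF that]])
    assume "Suc n \<in> F"
    then have "G = {Suc n}" by (rule Suc_n)
    then show "C e (Suc n) = 0" by (simp add: C_def mn_def)
  qed
  have X_zero: "\<exists>g\<in>G. X e g = X e (Suc g)" for e
  proof -
    have "mn e \<in> E e ` G" unfolding mn_def using finG G(2) by (intro Min_in) auto
    then obtain g where g: "g \<in> G" "E e g = mn e" by auto
    then have "C e g = 0" "g \<in> F" "1 \<le> g" using G(1) F(1) by (auto simp: C_def)
    then have "X e g = X e (Suc g)" using comb_step[OF fin, of g "C e"] by (simp add: X_def)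
    with g(1) show ?thesis by blast
  qed
  have inj: "e = e'" if e: "e \<in> U" "e' \<in> U"
    and eq: "\<And>j. j < m \<Longrightarrow> psum n (a (Suc j)) (X e) = psum n (a (Suc j)) (X e')" for e e'
  proof -
    have XX: "X e = X e'"
    proof (rule psum_inj_steps_at[where G=G, OF X_decr[OF e(1)] X_decr[OF e(2)] _ fin _ F0 _ exponents m(1) eq])
      show "steps_at F (\<lambda>i. X e i - X e' i)"
        unfolding X_def by (intro steps_at_diff comb_steps_at fin)
      show "card F \<le> Suc m" using F(2) by simp
      show "G \<subseteq> F \<and> same_parity F G \<and> (\<exists>g\<in>G. X e g = X e (Suc g)) \<and> (\<exists>g\<in>G. X e' g = X e' (Suc g))"
        by (intro conjI G X_zero)
    qed
    have CC: "C e k = C e' k" if "k \<in> F" for k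
    proof -
      have "1 \<le> k" using that F(1) by auto
      then show ?thesis
        using comb_step[OF fin, of k "C e"] comb_step[OF fin, of k "C e'"] that XX by (simp add: X_def)
    qed
    \<comment> \<open>The coefficient of g0 is 0 minus the minimum, so the subtracted minimum can be
      read off and the normalisation undone.\<close>
    have "mn e = mn e'"
      using CC[of g0] g0 G(1) by (auto simp: C_def E_def)
    then have EE: "E e k = E e' k" if "k \<in> F" for k
      using CC[OF that] by (auto simp: C_def split: if_splits)
    show ?thesis
    proof
      fix i
      show "e i = e' i"
      proof (cases "i < m")
        case True
        then show ?thesis using EE[of "h i"] \<iota>h[OF True] by (simp add: E_def)
      next
        case False
        then show ?thesis using e by (simp add: U_def)
      qed
    qed
  qed
  have V: "openin (Euclidean_space m) ((\<lambda>e j. if j < m then psum n (a (Suc j)) (X e) else 0) ` U)"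
    by (rule psum_open_image[where b="\<lambda>j. a (Suc j)", OF U contX inj])
  define c where "c k = x k - x (Suc k)" for k
  \<comment> \<open>The parameter of x itself: its coefficients on G are all 0, so nothing is
    subtracted.\<close>
  define e0 where "e0 i = (if i < m then c (h i) else 0)" for i
  have cG: "c g = 0" if "g \<in> G" for g
    using steps_atD[OF steps_at_jumps[OF x(1)], of g] that G(1) F(1) x(3) by (auto simp: c_def)
  have E0: "E e0 k = c k" if "k \<in> F" for k
    using \<iota>[OF that] cG[OF g0] by (simp add: E_def e0_def)
  have "E e0 ` G = {0}" using E0 cG G by (auto simp: image_iff subset_iff)
  then have "mn e0 = 0" by (simp add: mn_def)
  then have "C e0 k = c k" if "k \<in> F" for k using E0[OF that] by (simp add: C_def)
  then have "X e0 = comb F c"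
    unfolding X_def comb_def by (auto intro!: ext sum.cong)
  also have "\<dots> = x"
  proof -
    have "jumps x \<subseteq> F" using x(3) by simp
    then have "steps_at F x" by (rule steps_at_mono[OF steps_at_jumps[OF x(1)]])
    then show ?thesis unfolding c_def by (rule decr_eq_comb[OF x(1) _ fin, symmetric])
  qed
  finally have X0: "X e0 = x" .
  have "e0 \<in> U"
    unfolding U_def
  proof (intro CollectI conjI allI impI)
    fix i assume i: "i < m" "i \<in> {i. h i \<notin> G}"
    then have "h i \<in> jumps x" using \<iota>h(2)[OF i(1)] x(3) by simp
    then show "0 < e0 i" using i by (simp add: e0_def c_def jumps_def)
  qed (simp add: e0_def)
  then have mem: "(\<lambda>j. if j < m then psum n (a (Suc j)) x else 0)
      \<in> (\<lambda>e j. if j < m then psum n (a (Suc j)) (X e) else 0) ` U"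
    using X0 by (intro image_eqI[of _ _ e0]) auto
  show ?thesis
  proof (rule interior_not_frontier[OF V _ _ mem])
    show "x \<in> punctured" using x decr_orthant by simp
    fix q assume "q \<in> (\<lambda>e j. if j < m then psum n (a (Suc j)) (X e) else 0) ` U"
    then obtain e where e: "e \<in> U" "q = (\<lambda>j. if j < m then psum n (a (Suc j)) (X e) else 0)" by blast
    then show "\<exists>y\<in>orthant n. \<forall>j<m. q j = psum n (a (Suc j)) y"
      by (intro bexI[of _ "X e"] decr_orthant X_decr) auto
  qed
qed

section \<open>The image is covered by the cones with m generators\<close>

lemma ex_few_jumps:
  assumes y: "y \<in> decr n"
  shows "\<exists>z\<in>decr n. (\<forall>j\<in>{1..m}. psum n (a j) z = psum n (a j) y) \<and> card (jumps z) \<le> m"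
proof -
  define K where "K = {z \<in> decr n. \<forall>j\<in>{1..m}. psum n (a j) z = psum n (a j) y}"
  define s where "s = psum n (a 1) y"
  \<comment> \<open>An entry z 1 \<ge> 1 satisfies z 1 \<le> z 1 ^ a 1 \<le> s, so the fibre is
    bounded.\<close>
  have bound: "z 1 \<le> 1 + s" if z: "z \<in> K" for z
  proof (rule ccontr)
    have zd: "z \<in> decr n" "psum n (a 1) z = s" using z m by (auto simp: K_def s_def)
    have s: "0 \<le> s" using psum_nonneg[OF decr_orthant[OF y]] by (simp add: s_def)
    assume "\<not> z 1 \<le> 1 + s"
    then have "1 \<le> z 1" "s < z 1" using s by auto
    moreover have "z 1 ^ a 1 \<le> psum n (a 1) z"
      unfolding psum_def using m decr_nonneg[OF zd(1)] by (intro member_le_sum) auto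
    moreover have "z 1 \<le> z 1 ^ a 1" using \<open>1 \<le> z 1\<close> a_pos m by (intro self_le_power) auto
    ultimately show False using zd(2) by simp
  qed
  have "K = {z \<in> decr n. z 1 \<le> 1 + s} \<inter> (\<Inter>j\<in>{1..m}. {z. psum n (a j) z = psum n (a j) y})"
    using bound by (auto simp: K_def)
  moreover have "compact \<dots>"
    by (intro compact_Int_closed compact_decr_bounded closed_INT ballI closed_Collect_eq
        continuous_on_psum continuous_on_const)
  ultimately have K: "compact K" by simp
  have "y \<in> K" using y by (simp add: K_def)
  then have "K \<noteq> {}" by blast
  \<comment> \<open>A minimiser with more than m jumps could be moved within the fibre, since m + 1 of its
    jumps together allow all small changes of the m + 1 power sums.\<close>
  from continuous_attains_inf[OF K this continuous_on_psum, of n "Suc (a m)"]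
  obtain z where z: "z \<in> K" and min: "\<And>w. w \<in> K \<Longrightarrow> psum n (Suc (a m)) z \<le> psum n (Suc (a m)) w"
    by blast
  have zd: "z \<in> decr n" using z by (simp add: K_def)
  note J = jumps_subset[OF zd]
  have fin: "finite (jumps z)" by (rule finite_subset[OF J finite_atLeastAtMost])
  have "card (jumps z) \<le> m"
  proof (rule ccontr)
    assume "\<not> card (jumps z) \<le> m"
    then obtain L where L: "L \<subseteq> jumps z" "card L = Suc m" "finite L"
      using obtain_subset_with_card_n[of "Suc m" "jumps z"] by (metis not_less_eq_eq)
    obtain h where h: "bij_betw h {0..<Suc m} L"
      using ex_bij_betw_nat_finite[of L] L by auto
    define \<iota> where "\<iota> = the_inv_into {0..<Suc m} h"
    have \<iota>: "h (\<iota> k) = k" "\<iota> k < Suc m" if "k \<in> L" for k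
      using f_the_inv_into_f_bij_betw[OF h, of k] bij_betwE[OF bij_betw_the_inv_into[OF h]] that
      by (auto simp: \<iota>_def)
    have \<iota>h: "\<iota> (h i) = i" "h i \<in> L" if "i < Suc m" for i
      using the_inv_into_f_f[of h "{0..<Suc m}" i] h that bij_betwE[OF h] by (auto simp: \<iota>_def bij_betw_def)
    define c where "c k = z k - z (Suc k)" for k
    \<comment> \<open>Only the coefficients in L vary. Two such points therefore differ by a
      function with steps at the m + 1 elements of L, even if z has more jumps.\<close>
    define C where "C e k = (if k \<in> L then e (\<iota> k) else c k)" for e k
    define X where "X e = comb (jumps z) (C e)" for e
    \<comment> \<open>The further exponent exceeds all the others, so injectivity applies to m + 1
      exponents and m + 1 steps.\<close>
    define b where "b j = (if j < m then a (Suc j) else Suc (a m))" for j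
    define U where "U = {e :: nat \<Rightarrow> real. (\<forall>i\<ge>Suc m. e i = 0) \<and> (\<forall>i<Suc m. i \<in> UNIV \<longrightarrow> 0 < e i)}"
    have cpos: "0 < c k" if "k \<in> jumps z" for k using that by (simp add: c_def jumps_def)
    have U: "openin (Euclidean_space (Suc m)) U"
      unfolding U_def by (rule openin_positive_orthant)
    have "continuous_on UNIV (\<lambda>e. C e k)" for k
      by (cases "k \<in> L") (simp_all add: C_def)
    then have contX: "continuous_on UNIV (\<lambda>e. X e i)" for i
      unfolding X_def comb_def by (intro continuous_on_sum continuous_on_mult continuous_on_const)
    have X_decr: "X e \<in> decr n" if "e \<in> U" for e
      unfolding X_def
    proof (rule comb_decr)
      show "jumps z \<subseteq> {1..Suc n}" using J by auto
      show "Suc n \<in> jumps z \<Longrightarrow> C e (Suc n) = 0" using J by auto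
      fix k assume "k \<in> jumps z"
      then show "0 \<le> C e k" using cpos[of k] \<iota>(2)[of k] that by (auto simp: C_def U_def less_imp_le)
    qed
    have X_step: "X e k = X e (Suc k) + (if k \<in> jumps z then C e k else 0)" if "1 \<le> k" for e k
      unfolding X_def by (rule comb_step[OF fin that])
    have L1: "1 \<le> k" "k \<in> jumps z" if "k \<in> L" for k using that L(1) J by auto
    have bm: "strict_mono_on {..<Suc m} b" "0 < b 0"
    proof (rule strict_mono_on_lessThanI)
      fix k assume k: "Suc k < Suc m"
      show "b k < b (Suc k)"
      proof (cases "Suc k < m")
        case True
        then show ?thesis using exponents(1) by (simp add: b_def monotone_on_def)
      next
        case False
        then have "Suc k = m" using k by simp
        then show ?thesis by (auto simp: b_def)
      qed
    next
      show "0 < b 0" using m exponents by (simp add: b_def)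
    qed
    have inj: "e = e'" if e: "e \<in> U" "e' \<in> U"
      and eq: "\<And>j. j < Suc m \<Longrightarrow> psum n (b j) (X e) = psum n (b j) (X e')" for e e'
    proof -
      have XX: "X e = X e'"
      proof (rule psum_inj_steps_at[OF X_decr[OF e(1)] X_decr[OF e(2)] _ L(3) _ _ _ bm _ eq])
        show "steps_at L (\<lambda>i. X e i - X e' i)"
        proof (rule steps_atI)
          fix i assume i: "1 \<le> i" "i \<notin> L"
          then show "X e i - X e' i = X e (Suc i) - X e' (Suc i)"
            using X_step[OF i(1), of e] X_step[OF i(1), of e'] by (simp add: C_def)
        qed
        show "0 \<notin> L" using L1 by force
      qed (use L(2) in auto)
      show ?thesis
      proof
        fix i
        show "e i = e' i"
        proof (cases "i < Suc m")
          case True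
          note hi = \<iota>h[OF True]
          have "C e (h i) = C e' (h i)"
            using X_step[OF L1(1)[OF hi(2)], of e] X_step[OF L1(1)[OF hi(2)], of e'] L1(2)[OF hi(2)] XX by simp
          then show ?thesis using hi by (simp add: C_def)
        next
          case False
          then show ?thesis using e by (simp add: U_def)
        qed
      qed
    qed
    define f where "f = (\<lambda>e j. if j < Suc m then psum n (b j) (X e) else 0)"
    have "openin (Euclidean_space (Suc m)) (f ` U)"
      unfolding f_def by (rule psum_open_image[OF U contX inj])
    then obtain T where T: "open T" "f ` U = T \<inter> {x. \<forall>i\<ge>Suc m. x i = 0}"
      unfolding openin_Euclidean_space_iff by blast
    define e0 where "e0 i = (if i < Suc m then c (h i) else 0)" for i
    have "C e0 k = c k" for k using \<iota>[of k] by (simp add: C_def e0_def)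
    then have X0: "X e0 = z"
      unfolding X_def c_def using decr_eq_comb[OF zd steps_at_jumps[OF zd] fin] by (simp add: comb_def[abs_def])
    have "e0 \<in> U"
      using cpos L1(2) \<iota>h(2) by (auto simp: U_def e0_def)
    then have f0: "f e0 \<in> T" using T(2) by blast
    \<comment> \<open>Only the minimised power sum is lowered; the m prescribed ones are kept, so
      the path stays in the fibre.\<close>
    define \<gamma> where "\<gamma> t = (f e0)(m := f e0 m - t)" for t :: real
    have "continuous_on UNIV \<gamma>"
    proof (rule continuous_on_coordinatewise_then_product)
      fix j
      show "continuous_on UNIV (\<lambda>t. \<gamma> t j)"
        by (cases "j = m") (auto simp: \<gamma>_def intro!: continuous_intros)
    qed
    then have "open (\<gamma> -` T)" using T(1) by (simp add: open_vimage)
    moreover have "0 \<in> \<gamma> -` T" using f0 by (simp add: \<gamma>_def)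
    ultimately obtain \<epsilon> where \<epsilon>: "0 < \<epsilon>" "ball 0 \<epsilon> \<subseteq> \<gamma> -` T"
      by (rule openE)
    then have "\<epsilon> / 2 \<in> \<gamma> -` T" by (auto simp: subset_iff)
    then have "\<gamma> (\<epsilon> / 2) \<in> f ` U"
      unfolding T(2) by (simp add: \<gamma>_def f_def)
    then obtain e where e: "e \<in> U" "f e = \<gamma> (\<epsilon> / 2)" by force
    have eq: "psum n (b j) (X e) = (if j = m then psum n (b j) z - \<epsilon> / 2 else psum n (b j) z)" if "j < Suc m" for j
      using fun_cong[OF e(2), of j] that X0 by (simp add: f_def \<gamma>_def)
    have "psum n (a j) (X e) = psum n (a j) z" if "j \<in> {1..m}" for j
    proof -
      have "j - 1 < m" "Suc (j - 1) = j" using that by auto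
      then show ?thesis using eq[of "j - 1"] by (simp add: b_def)
    qed
    then have "X e \<in> K" using z X_decr[OF e(1)] by (simp add: K_def)
    from min[OF this] eq[of m] \<epsilon>(1) show False by (simp add: b_def)
  qed
  with z show ?thesis by (auto simp: K_def)
qed

lemma psi_preimage_few_jumps:
  assumes x: "x \<in> punctured"
  obtains z where "z \<in> decr n" "z \<noteq> (\<lambda>_. 0)" "card (jumps z) \<le> m" "\<psi> z = \<psi> x"
proof -
  from x obtain y where y: "y \<in> decr n" "\<And>p. psum n p y = psum n p x"
    using ex_decr_same_psum by blast
  from ex_few_jumps[OF y(1)] obtain z where z: "z \<in> decr n"
    "\<And>j. j \<in> {1..m} \<Longrightarrow> psum n (a j) z = psum n (a j) x" "card (jumps z) \<le> m"
    using y(2) by auto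
  have "z \<noteq> (\<lambda>_. 0)"
  proof
    assume "z = (\<lambda>_. 0)"
    then have "psum n (a 1) z = 0" using a_pos m by (simp add: psum_zero)
    then show False using z(2)[of 1] psum_pos[of x n "a 1"] x m by simp
  qed
  moreover have "\<psi> z = \<psi> x" by (rule psi_cong) (rule z(2))
  ultimately show thesis using that z by blast
qed

lemma image_psi: "\<psi> ` punctured = (\<Union>\<nu>\<in>{\<nu>. \<nu> \<subseteq> {1..n} \<and> card \<nu> = m}. Bset m a n \<nu>)"
proof (intro equalityI subsetI)
  fix u assume "u \<in> \<psi> ` punctured"
  then obtain x where x: "u = \<psi> x" "x \<in> punctured" by (rule imageE)
  obtain z where z: "z \<in> decr n" "z \<noteq> (\<lambda>_. 0)" "card (jumps z) \<le> m" "\<psi> z = \<psi> x"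
    by (rule psi_preimage_few_jumps[OF x(2)])
  obtain \<nu> where "jumps z \<subseteq> \<nu>" "\<nu> \<subseteq> {1..n}" "card \<nu> = m"
    using exists_subset_between[OF z(3) _ jumps_subset[OF z(1)]] m(2) by auto
  then show "u \<in> (\<Union>\<nu>\<in>{\<nu>. \<nu> \<subseteq> {1..n} \<and> card \<nu> = m}. Bset m a n \<nu>)"
    using psi_mem_Bset[OF z(1,2)] x(1) z(4) by auto
next
  fix u assume "u \<in> (\<Union>\<nu>\<in>{\<nu>. \<nu> \<subseteq> {1..n} \<and> card \<nu> = m}. Bset m a n \<nu>)"
  then show "u \<in> \<psi> ` punctured" using Bset_subset_image by auto
qed

section \<open>The boundary of the image\<close>

lemma closed_image_psi: "closed (\<psi> ` punctured)"
proof -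
  have "compact (Bset m a n \<nu>)" if "\<nu> \<subseteq> {1..n}" for \<nu>
    unfolding psi_cross_section[OF that, symmetric]
    by (intro compact_continuous_image compact_cross_section[OF that]
        continuous_on_subset[OF continuous_on_psi cross_section_punctured[OF that]])
  then have "compact (\<psi> ` punctured)"
    unfolding image_psi by (intro compact_UN) auto
  then show ?thesis by (rule compact_imp_closed)
qed

lemma image_psi_hyperplane: "\<psi> ` punctured \<subseteq> hyperplane m"
  using psi_hyperplane by blast

text \<open>The image is closed, so a boundary point has a preimage z with at most m jumps. Exactly
  m jumps make it interior, by the fan with the dummy generator. With fewer, either the jumps extend
  to a Gale set of size m - 1, or the same-parity set F of size m + 1 gives a fan around z.\<close>

lemma frontier_subset_gale:
  assumes u: "u \<in> subtopology euclidean (hyperplane m) frontier_of (\<psi> ` punctured)"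
  shows "\<exists>\<mu> \<rho>. \<mu> \<subseteq> {1..n} \<and> card \<mu> = m - 1 \<and> gale n \<mu> \<rho> \<and> u \<in> Bset m a n \<mu>"
proof -
  have "closedin (top_of_set (hyperplane m)) (\<psi> ` punctured)"
    by (rule closed_subset[OF image_psi_hyperplane closed_image_psi])
  from subsetD[OF frontier_of_subset_closedin[OF this] u]
  obtain x where x: "u = \<psi> x" "x \<in> punctured" by (rule imageE)
  obtain z where z: "z \<in> decr n" "z \<noteq> (\<lambda>_. 0)" "card (jumps z) \<le> m" "\<psi> z = \<psi> x"
    by (rule psi_preimage_few_jumps[OF x(2)])
  note J = jumps_subset[OF z(1)]
  have fin: "finite (jumps z)" by (rule finite_subset[OF J finite_atLeastAtMost])
  have front: "\<psi> z \<in> subtopology euclidean (hyperplane m) frontier_of (\<psi> ` punctured)"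
    using u x(1) z(4) by simp
  have "card (jumps z) \<noteq> m"
  proof
    assume c: "card (jumps z) = m"
    have "Suc n \<notin> jumps z" using J by auto
    then have "\<psi> z \<notin> subtopology euclidean (hyperplane m) frontier_of (\<psi> ` punctured)"
      using J c fin z
      by (intro fan_not_frontier[where F="insert (Suc n) (jumps z)" and G="{Suc n}"] same_parityI) auto
    with front show False by simp
  qed
  with z(3) have less: "card (jumps z) < m" by simp
  define k where "k = m - 1 - card (jumps z)"
  have k: "card (jumps z) + k = m - 1" "Suc (card (jumps z) + k) \<le> n" using less m by (auto simp: k_def)
  from gale_or_same_parity[OF J k(2)] show ?thesis
  proof
    assume "\<exists>\<mu> \<rho>. jumps z \<subseteq> \<mu> \<and> \<mu> \<subseteq> {1..n} \<and> card \<mu> = card (jumps z) + k \<and> gale n \<mu> \<rho>"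
    then obtain \<mu> \<rho> where \<mu>: "jumps z \<subseteq> \<mu>" "\<mu> \<subseteq> {1..n}" "card \<mu> = card (jumps z) + k" "gale n \<mu> \<rho>"
      by blast
    then show ?thesis using psi_mem_Bset[OF z(1,2) \<mu>(1,2)] k(1) x(1) z(4) by auto
  next
    assume "\<exists>F. jumps z \<subseteq> F \<and> F \<subseteq> {1..n} \<and> card F = card (jumps z) + k + 2 \<and> same_parity F (F - jumps z)"
    then obtain F where F: "jumps z \<subseteq> F" "F \<subseteq> {1..n}" "card F = card (jumps z) + k + 2"
      "same_parity F (F - jumps z)" by blast
    have "\<psi> z \<notin> subtopology euclidean (hyperplane m) frontier_of (\<psi> ` punctured)"
    proof (rule fan_not_frontier[OF _ _ _ _ F(4) _ z(1,2)])
      show "card F = Suc m" using F(3) k(1) m by simp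
      then show "F - jumps z \<noteq> {}" using less card_mono[OF fin, of F] by auto
    qed (use F in auto)
    with front show ?thesis by simp
  qed
qed

text \<open>Were u interior, the norms of x with the last one slightly moved would still be
  realised, up to scale, by a decreasing y. Then x and y share m - 1 power sums, and the order of
  the last ones forces the alternation that Gale's condition forbids.\<close>

lemma gale_subset_frontier:
  assumes \<mu>: "\<mu> \<subseteq> {1..n}" "card \<mu> = m - 1" "gale n \<mu> \<rho>"
  shows "Bset m a n \<mu> \<subseteq> subtopology euclidean (hyperplane m) frontier_of (\<psi> ` punctured)"
proof
  fix u assume u: "u \<in> Bset m a n \<mu>"
  then obtain x where x: "x \<in> decr n" "steps_at \<mu> x" "x \<noteq> (\<lambda>_. 0)" "u = \<psi> x"
    by (auto simp: Bset_def Rcone_eq[OF \<mu>(1)])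
  have xp: "x \<in> punctured" using x decr_orthant by simp
  have u_im: "u \<in> \<psi> ` punctured" using x(4) xp by simp
  have "u \<in> top_of_set (hyperplane m) closure_of (\<psi> ` punctured)"
    using closure_of_subset[of "\<psi> ` punctured" "top_of_set (hyperplane m)"] image_psi_hyperplane u_im by auto
  moreover have "u \<notin> top_of_set (hyperplane m) interior_of (\<psi> ` punctured)"
  proof
    assume "u \<in> top_of_set (hyperplane m) interior_of (\<psi> ` punctured)"
    then obtain O' where O': "open O'" "u \<in> O'" "hyperplane m \<inter> O' \<subseteq> \<psi> ` punctured"
      unfolding interior_of_def openin_open by auto
    \<comment> \<open>For even \<rho> the forbidden pattern starts with x > y, so the last norm must
      drop; for odd \<rho> it must grow.\<close>
    define \<theta> :: real where "\<theta> = (if even \<rho> then -1 else 1)"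
    define N where "N t j = pnorm n (a j) x + (if j = m then \<theta> * t else 0)" for t j
    define w where "w t j = (if j \<in> {1..m} then N t j / sum (N t) {1..m} else 0)" for t j
    \<comment> \<open>A change by at most half of the last norm keeps it positive.\<close>
    define \<delta> where "\<delta> = pnorm n (a m) x / 2"
    have \<delta>: "0 < \<delta>" using pnorm_pos[of x n "a m"] xp by (simp add: \<delta>_def)
    have Npos: "0 < N t j" if "t \<in> {0..\<delta>}" for t j
    proof -
      have "0 < pnorm n (a j) x" "\<bar>\<theta> * t\<bar> \<le> \<delta>" using pnorm_pos[of x n "a j"] xp that by (auto simp: \<theta>_def abs_mult)
      moreover have "\<delta> < pnorm n (a m) x" using \<delta> by (simp add: \<delta>_def)
      ultimately show ?thesis by (auto simp: N_def)
    qed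
    have Spos: "0 < sum (N t) {1..m}" if "t \<in> {0..\<delta>}" for t
      using Npos[OF that] m by (intro sum_pos) auto
    have contN: "continuous_on {0..\<delta>} (\<lambda>t. N t j)" for j
      by (cases "j = m") (auto simp: N_def intro!: continuous_intros)
    have "continuous_on {0..\<delta>} w"
    proof (rule continuous_on_coordinatewise_then_product)
      fix j
      show "continuous_on {0..\<delta>} (\<lambda>t. w t j)"
      proof (cases "j \<in> {1..m}")
        case True
        have "continuous_on {0..\<delta>} (\<lambda>t. N t j / sum (N t) {1..m})"
          using Spos by (intro continuous_on_divide continuous_on_sum contN) force
        then show ?thesis using True by (simp add: w_def)
      next
        case False
        then have "w t j = 0" for t by (simp only: w_def if_False)
        then show ?thesis by simp
      qed
    qed
    then obtain A where A: "open A" "A \<inter> {0..\<delta>} = w -` O' \<inter> {0..\<delta>}"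
      using O'(1) unfolding continuous_on_open_invariant by blast
    have N0: "N 0 = (\<lambda>j. pnorm n (a j) x)" by (rule ext) (simp add: N_def)
    have "w 0 j = u j" for j
      by (simp only: w_def N0 x(4) psi_eq norm_sum_def)
    then have "w 0 = u" by (rule ext)
    then have "0 \<in> w -` O' \<inter> {0..\<delta>}" using O'(2) \<delta> by simp
    then have "0 \<in> A" by (simp only: A(2)[symmetric] Int_iff)
    then obtain \<epsilon> where \<epsilon>: "0 < \<epsilon>" "ball 0 \<epsilon> \<subseteq> A" by (rule openE[OF A(1)])
    define t where "t = min \<delta> (\<epsilon> / 2)"
    have t: "0 < t" "t \<in> {0..\<delta>}" using \<epsilon>(1) \<delta> by (simp_all add: t_def)
    have "t < \<epsilon>" using \<epsilon>(1) by (simp add: t_def min_less_iff_disj)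
    then have "t \<in> A" using t(1) by (intro subsetD[OF \<epsilon>(2)]) simp
    then have "t \<in> w -` O' \<inter> {0..\<delta>}" using t(2) by (simp only: A(2)[symmetric] Int_iff)
    then have "w t \<in> O'" by simp
    moreover have "w t \<in> hyperplane m"
    proof -
      have "(\<Sum>j=1..m. w t j) = (\<Sum>j=1..m. N t j / sum (N t) {1..m})"
        by (rule sum.cong) (simp_all add: w_def)
      also have "\<dots> = 1" using Spos[OF t(2)] by (simp add: sum_divide_distrib[symmetric])
      finally have "(\<Sum>j=1..m. w t j) = 1" .
      moreover have "w t j = 0" if "j \<notin> {1..m}" for j
        using that by (simp only: w_def if_False)
      ultimately show ?thesis unfolding hyperplane_def by simp
    qed
    ultimately have "w t \<in> \<psi> ` punctured" by (intro subsetD[OF O'(3)] IntI)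
    then obtain y' where y': "w t = \<psi> y'" "y' \<in> punctured" by (rule imageE)
    obtain s where s: "0 < s" "\<And>j. j \<in> {1..m} \<Longrightarrow> pnorm n (a j) (\<lambda>i. s * y' i) = N t j"
    proof -
      have "\<psi> y' j = N t j / sum (N t) {1..m}" if "j \<in> {1..m}" for j
        using that by (simp only: y'(1)[symmetric] w_def if_True)
      from psi_rescale[OF y'(2) this Spos[OF t(2)]] show thesis using that by blast
    qed
    have sy: "(\<lambda>i. s * y' i) \<in> orthant n" using y'(2) s(1) by (intro orthant_scale) auto
    obtain y where y: "y \<in> decr n" "\<And>p. psum n p y = psum n p (\<lambda>i. s * y' i)"
      using ex_decr_same_psum[OF sy] by blast
    have py: "psum n (a j) y = N t j ^ a j" if "j \<in> {1..m}" for j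
      using pnorm_power[OF sy, of "a j"] s(2)[OF that] y(2) a_pos that by simp
    have px: "psum n (a j) x = pnorm n (a j) x ^ a j" if "j \<in> {1..m}" for j
      using pnorm_power[of x n "a j"] xp a_pos that by simp
    define b where "b j = a (Suc j)" for j
    have b: "strict_mono_on {..m - 1} b" "0 < b 0"
      using exponents m by (auto simp: b_def monotone_on_def)
    have eq: "psum n (b j) x = psum n (b j) y" if "j < m - 1" for j
    proof -
      have "Suc j \<in> {1..m}" "Suc j \<noteq> m" using that by auto
      then show ?thesis using py[of "Suc j"] px[of "Suc j"] by (simp add: b_def N_def)
    qed
    have am: "0 < a m" "m \<in> {1..m}" using a_pos m by auto
    have bm: "b (m - 1) = a m" using m by (simp add: b_def)
    have card: "Suc (card \<mu>) = m" "Suc (m - 1) = m" using \<mu>(2) m by auto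
    have no_alt: "\<not> alternates n m ((-1) ^ \<rho>) (\<lambda>i. x i - y i)"
      using gale_not_alternates[OF \<mu>(1,3) x(1,2) y(1)] card by simp
    show False
    proof (cases "even \<rho>")
      case True
      then have "N t m < pnorm n (a m) x" using t(1) by (simp add: N_def \<theta>_def)
      then have lt: "psum n (a m) y < psum n (a m) x"
        unfolding py[OF am(2)] px[OF am(2)] using Npos[OF t(2), of m] am(1) by (intro power_strict_mono) auto
      then have "x \<noteq> y" by auto
      have "alternates n (Suc (m - 1)) 1 (\<lambda>i. x i - y i)"
        by (rule psum_alternates[OF x(1) y(1) \<open>x \<noteq> y\<close> b eq]) (use lt in \<open>simp_all only: bm less_imp_le\<close>)
      then have "alternates n m ((-1) ^ \<rho>) (\<lambda>i. x i - y i)" using True by (simp only: card(2)) simp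
      with no_alt show False by contradiction
    next
      case False
      then have "pnorm n (a m) x < N t m" using t(1) by (simp add: N_def \<theta>_def)
      then have lt: "psum n (a m) x < psum n (a m) y"
        unfolding py[OF am(2)] px[OF am(2)] using pnorm_nonneg[of n "a m" x] am(1)
        by (intro power_strict_mono) auto
      then have "y \<noteq> x" by auto
      have "alternates n (Suc (m - 1)) 1 (\<lambda>i. y i - x i)"
        by (rule psum_alternates[OF y(1) x(1) \<open>y \<noteq> x\<close> b eq[symmetric]]) (use lt in \<open>simp_all only: bm less_imp_le\<close>)
      then have "alternates n m ((-1) ^ \<rho>) (\<lambda>i. x i - y i)"
        using False by (simp only: card(2) alternates_swap[of n m 1]) simp
      with no_alt show False by contradiction
    qed
  qed
  ultimately show "u \<in> subtopology euclidean (hyperplane m) frontier_of (\<psi> ` punctured)"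
    by (simp add: frontier_of_def)
qed

lemma frontier_psi:
  "subtopology euclidean (hyperplane m) frontier_of (\<psi> ` punctured)
    = (\<Union>\<mu>\<in>{\<mu>. \<mu> \<subseteq> {1..n} \<and> card \<mu> = m - 1 \<and> (\<exists>\<rho>. gale n \<mu> \<rho>)}. Bset m a n \<mu>)"
proof (intro equalityI subsetI)
  fix u assume "u \<in> subtopology euclidean (hyperplane m) frontier_of (\<psi> ` punctured)"
  from frontier_subset_gale[OF this]
  show "u \<in> (\<Union>\<mu>\<in>{\<mu>. \<mu> \<subseteq> {1..n} \<and> card \<mu> = m - 1 \<and> (\<exists>\<rho>. gale n \<mu> \<rho>)}. Bset m a n \<mu>)"
    by (elim exE conjE) (rule UN_I, rule CollectI, intro conjI exI)
next
  fix u assume "u \<in> (\<Union>\<mu>\<in>{\<mu>. \<mu> \<subseteq> {1..n} \<and> card \<mu> = m - 1 \<and> (\<exists>\<rho>. gale n \<mu> \<rho>)}. Bset m a n \<mu>)"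
  then show "u \<in> subtopology euclidean (hyperplane m) frontier_of (\<psi> ` punctured)"
    by (elim UN_E CollectE exE conjE) (rule subsetD[OF gale_subset_frontier])
qed

end

section \<open>Zariski closures and types\<close>

definition block_size :: "nat set \<Rightarrow> nat \<Rightarrow> nat" where
  "block_size \<mu> j = card {i. 1 \<le> i \<and> rk \<mu> i = j}"

text \<open>The block values w need not decrease. This allows vectors outside the cone of \<mu>
  whose power sums are still given by its block sizes.\<close>

definition spread :: "nat set \<Rightarrow> (nat \<Rightarrow> real) \<Rightarrow> nat \<Rightarrow> real" where
  "spread \<mu> w i = (if 1 \<le> i \<and> rk \<mu> i < card \<mu> then w (rk \<mu> i) else 0)"

lemma sorted_list_of_set_step:
  assumes "finite \<mu>" "i < j" "j < card \<mu>"
  shows "sorted_list_of_set \<mu> ! i < sorted_list_of_set \<mu> ! j"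
  by (rule sorted_wrt_nth_less[OF strict_sorted_list_of_set]) (use assms in simp_all)

lemma rk_nth:
  assumes "finite \<mu>" "j < card \<mu>"
  shows "rk \<mu> (sorted_list_of_set \<mu> ! j) = j"
proof -
  let ?L = "sorted_list_of_set \<mu>"
  have "\<mu> \<inter> {..<?L ! j} = (!) ?L ` {..<j}"
  proof (intro equalityI subsetI)
    fix k assume k: "k \<in> \<mu> \<inter> {..<?L ! j}"
    then have "k \<in> set ?L" using assms(1) by simp
    then obtain i where "i < length ?L" "?L ! i = k" unfolding in_set_conv_nth by (elim exE conjE)
    then have i: "i < card \<mu>" "k = ?L ! i" by simp_all
    have "i < j"
    proof (rule ccontr)
      assume "\<not> i < j"
      then have "?L ! j \<le> ?L ! i"
        using sorted_list_of_set_step[OF assms(1), of j i] i(1) by (cases "i = j") auto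
      with k i(2) show False by simp
    qed
    with i(2) show "k \<in> (!) ?L ` {..<j}" by simp
  next
    fix k assume "k \<in> (!) ?L ` {..<j}"
    then obtain i where i: "i < j" "k = ?L ! i" by auto
    have "?L ! i \<in> set ?L" using i(1) assms(2) by (intro nth_mem) simp
    then have "k \<in> set ?L" using i(2) by simp
    then show "k \<in> \<mu> \<inter> {..<?L ! j}"
      using i sorted_list_of_set_step[OF assms(1) i(1) assms(2)] assms(1) by simp
  qed
  moreover have "inj_on ((!) ?L) {..<j}"
    using assms by (intro inj_on_nth) auto
  ultimately show ?thesis by (simp add: rk_def card_image)
qed

lemma less_rk_iff:
  assumes "finite \<mu>" "j < card \<mu>"
  shows "j < rk \<mu> i \<longleftrightarrow> sorted_list_of_set \<mu> ! j < i"
proof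
  assume "j < rk \<mu> i"
  then show "sorted_list_of_set \<mu> ! j < i"
    using rk_mono[OF assms(1), of i "sorted_list_of_set \<mu> ! j"] rk_nth[OF assms]
    by (cases "sorted_list_of_set \<mu> ! j < i") auto
next
  assume less: "sorted_list_of_set \<mu> ! j < i"
  have "sorted_list_of_set \<mu> ! j \<in> set (sorted_list_of_set \<mu>)" using assms by (intro nth_mem) simp
  then have "sorted_list_of_set \<mu> ! j \<in> \<mu>" using assms(1) by simp
  from rk_strict[OF assms(1) this less] show "j < rk \<mu> i" using rk_nth[OF assms] by simp
qed

text \<open>The indices of rank j form the half-open interval between two consecutive elements of
  \<mu>, starting from 0.\<close>

lemma nu_type_block_size:
  assumes "\<mu> \<subseteq> {1..n}"
  shows "nu_type \<mu> = mset (map (block_size \<mu>) [0..<card \<mu>])"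
proof -
  have fin: "finite \<mu>" by (rule finite_subset[OF assms finite_atLeastAtMost])
  let ?L = "sorted_list_of_set \<mu>"
  have "map2 (\<lambda>a b. a - b) ?L (0 # ?L) = map (block_size \<mu>) [0..<card \<mu>]"
  proof (rule nth_equalityI)
    fix j assume "j < length (map2 (\<lambda>a b. a - b) ?L (0 # ?L))"
    then have j: "j < card \<mu>" by simp
    have "{i. 1 \<le> i \<and> rk \<mu> i = j} = {(0 # ?L) ! j<..?L ! j}"
    proof (cases j)
      case 0
      have "1 \<le> i \<and> rk \<mu> i = j \<longleftrightarrow> 0 < i \<and> i \<le> ?L ! j" for i
        using less_rk_iff[OF fin j, of i] unfolding 0 by linarith
      then show ?thesis by (simp only: 0 nth_Cons_0 greaterThanAtMost_def greaterThan_def atMost_def Collect_conj_eq)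
    next
      case (Suc k)
      then have k: "k < card \<mu>" using j by simp
      have "1 \<le> i \<and> rk \<mu> i = j \<longleftrightarrow> ?L ! k < i \<and> i \<le> ?L ! j" for i
        using less_rk_iff[OF fin j, of i] less_rk_iff[OF fin k, of i] unfolding Suc by linarith
      then show ?thesis
        by (simp only: Suc nth_Cons_Suc greaterThanAtMost_def greaterThan_def atMost_def Collect_conj_eq)
    qed
    then have "block_size \<mu> j = ?L ! j - (0 # ?L) ! j" by (simp add: block_size_def)
    then show "map2 (\<lambda>a b. a - b) ?L (0 # ?L) ! j = map (block_size \<mu>) [0..<card \<mu>] ! j"
      using j fin by simp
  qed (use fin in simp)
  then show ?thesis by (simp add: nu_type_def)
qed

lemma rk_first:
  assumes "\<mu> \<subseteq> {1..n}" shows "rk \<mu> 1 = 0"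
proof -
  have "0 \<notin> \<mu>" using subsetD[OF assms, of 0] by auto
  then show ?thesis by (simp add: rk_def lessThan_Suc)
qed

lemma subset_lessThan:
  fixes \<mu> :: "nat set"
  assumes "\<mu> \<subseteq> {1..n}" "n < i" shows "\<mu> \<subseteq> {..<i}"
  using assms(1) by (rule order.trans) (use assms(2) in auto)

lemma spread_beyond:
  assumes "\<mu> \<subseteq> {1..n}" "i \<notin> {1..n}"
  shows "spread \<mu> w i = 0"
proof (cases "i = 0")
  case False
  then have "n < i" using assms(2) by simp
  then have "\<mu> \<subseteq> {..<i}" by (rule subset_lessThan[OF assms(1)])
  then show ?thesis by (simp add: spread_def rk_eq_card)
qed (simp add: spread_def)

lemma block_subset:
  assumes "\<mu> \<subseteq> {1..n}" "j < card \<mu>"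
  shows "{i. 1 \<le> i \<and> rk \<mu> i = j} \<subseteq> {1..n}"
proof
  fix i assume i: "i \<in> {i. 1 \<le> i \<and> rk \<mu> i = j}"
  have "i \<le> n"
  proof (rule ccontr)
    assume "\<not> i \<le> n"
    then have "\<mu> \<subseteq> {..<i}" using subset_lessThan[OF assms(1), of i] by simp
    then show False using i assms(2) by (simp add: rk_eq_card)
  qed
  with i show "i \<in> {1..n}" by simp
qed

lemma psum_spread:
  assumes \<mu>: "\<mu> \<subseteq> {1..n}" and p: "0 < p"
  shows "psum n p (spread \<mu> w) = (\<Sum>j<card \<mu>. real (block_size \<mu> j) * w j ^ p)"
proof -
  have fin: "finite \<mu>" by (rule finite_subset[OF \<mu> finite_atLeastAtMost])
  have block: "{i \<in> {i \<in> {1..n}. rk \<mu> i < card \<mu>}. rk \<mu> i = j} = {i. 1 \<le> i \<and> rk \<mu> i = j}"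
    if "j < card \<mu>" for j
  proof (intro equalityI subsetI)
    fix i assume "i \<in> {i. 1 \<le> i \<and> rk \<mu> i = j}"
    with subsetD[OF block_subset[OF \<mu> that] this] that
    show "i \<in> {i \<in> {i \<in> {1..n}. rk \<mu> i < card \<mu>}. rk \<mu> i = j}" by simp
  qed simp
  have "psum n p (spread \<mu> w) = (\<Sum>i\<in>{i \<in> {1..n}. rk \<mu> i < card \<mu>}. w (rk \<mu> i) ^ p)"
    unfolding psum_def
  proof (rule sum.mono_neutral_cong_right)
    show "\<forall>i\<in>{1..n} - {i \<in> {1..n}. rk \<mu> i < card \<mu>}. spread \<mu> w i ^ p = 0"
      using p by (simp add: spread_def)
  qed (simp_all add: spread_def subset_iff)
  also have "\<dots> = (\<Sum>j<card \<mu>. \<Sum>i\<in>{i \<in> {i \<in> {1..n}. rk \<mu> i < card \<mu>}. rk \<mu> i = j}. w (rk \<mu> i) ^ p)"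
    by (rule sum.group[symmetric]) auto
  also have "\<dots> = (\<Sum>j<card \<mu>. real (block_size \<mu> j) * w j ^ p)"
  proof (rule sum.cong[OF refl])
    fix j assume "j \<in> {..<card \<mu>}"
    then have "(\<Sum>i\<in>{i \<in> {i \<in> {1..n}. rk \<mu> i < card \<mu>}. rk \<mu> i = j}. w (rk \<mu> i) ^ p)
        = (\<Sum>i\<in>{i. 1 \<le> i \<and> rk \<mu> i = j}. w j ^ p)"
      using block[of j] by (intro sum.cong) auto
    then show "(\<Sum>i\<in>{i \<in> {i \<in> {1..n}. rk \<mu> i < card \<mu>}. rk \<mu> i = j}. w (rk \<mu> i) ^ p)
        = real (block_size \<mu> j) * w j ^ p"
      by (simp add: block_size_def)
  qed
  finally show ?thesis .
qed

lemma spread_steps_at: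
  assumes "finite \<mu>" shows "steps_at \<mu> (spread \<mu> w)"
proof (rule steps_atI)
  fix i assume "1 \<le> i" "i \<notin> \<mu>"
  then show "spread \<mu> w i = spread \<mu> w (Suc i)"
    using rk_Suc[OF assms, of i] by (simp add: spread_def)
qed

lemma spread_decr:
  assumes \<mu>: "\<mu> \<subseteq> {1..n}" and nn: "\<And>j. j < card \<mu> \<Longrightarrow> 0 \<le> w j"
    and anti: "\<And>j. Suc j < card \<mu> \<Longrightarrow> w (Suc j) \<le> w j"
  shows "spread \<mu> w \<in> decr n"
proof -
  have fin: "finite \<mu>" by (rule finite_subset[OF \<mu> finite_atLeastAtMost])
  have nonneg: "0 \<le> spread \<mu> w i" for i using nn by (simp add: spread_def)
  have "spread \<mu> w (Suc i) \<le> spread \<mu> w i" if "1 \<le> i" for i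
  proof (cases "rk \<mu> (Suc i) < card \<mu>")
    case True
    then show ?thesis using rk_Suc[OF fin, of i] anti[of "rk \<mu> i"] that by (auto simp: spread_def split: if_splits)
  next
    case False
    then have "spread \<mu> w (Suc i) = 0" by (simp add: spread_def)
    then show ?thesis using nonneg[of i] by simp
  qed
  then show ?thesis
    using nonneg spread_beyond[OF \<mu>, of _ w] by (simp add: decr_def orthant_def)
qed

lemma decr_eq_spread:
  assumes \<mu>: "\<mu> \<subseteq> {1..n}" and x: "x \<in> decr n" "steps_at \<mu> x"
  obtains w where "x = spread \<mu> w" "\<And>j. j < card \<mu> \<Longrightarrow> 0 \<le> w j"
proof
  have fin: "finite \<mu>" by (rule finite_subset[OF \<mu> finite_atLeastAtMost])
  define w where "w j = x (LEAST i. 1 \<le> i \<and> rk \<mu> i = j)" for j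
  show "0 \<le> w j" for j unfolding w_def by (rule decr_nonneg[OF x(1)])
  show "x = spread \<mu> w"
  proof
    fix i
    show "x i = spread \<mu> w i"
    proof (cases "i = 0")
      case True
      then show ?thesis using decr_0[OF x(1)] by (simp add: spread_def)
    next
      case False
      then have i: "1 \<le> i" by simp
      show ?thesis
      proof (cases "rk \<mu> i < card \<mu>")
        case True
        define l where "l = (LEAST l. 1 \<le> l \<and> rk \<mu> l = rk \<mu> i)"
        have "1 \<le> l \<and> rk \<mu> l = rk \<mu> i"
          unfolding l_def by (rule LeastI[of _ i]) (use i in simp)
        then have "x i = x l" using i by (intro steps_at_rk_eq[OF fin x(2)]) simp_all
        then show ?thesis using True i by (simp add: spread_def w_def l_def)
      next
        case False
        have "\<mu> \<subseteq> {..<Suc n}" by (rule subset_lessThan[OF \<mu>]) simp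
        then have "rk \<mu> i = rk \<mu> (Suc n)" using False rk_le_card[OF fin, of i] by (simp add: rk_eq_card)
        then have "x i = x (Suc n)" using i by (intro steps_at_rk_eq[OF fin x(2)]) simp_all
        then show ?thesis using False decr_beyond[OF x(1), of "Suc n"] by (simp add: spread_def)
      qed
    qed
  qed
qed

text \<open>An exponent in (0, 1] shrinks the argument, so the right half-plane is preserved. This
  keeps sums of complexified norms away from 0.\<close>

lemma Re_powr_pos:
  assumes "0 < Re z" "0 < r" "r \<le> 1"
  shows "0 < Re (z powr of_real r)"
proof -
  have z: "z \<noteq> 0" using assms(1) by auto
  have "\<bar>Im (Ln z)\<bar> < pi / 2" using Re_Ln_pos_lt[OF z] assms(1) by simp
  then have "\<bar>r * Im (Ln z)\<bar> < pi / 2"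
    using assms(2,3) mult_left_le_one_le[of "\<bar>Im (Ln z)\<bar>" r] by (simp add: abs_mult)
  then have "0 < cos (r * Im (Ln z))" by (intro cos_gt_zero_pi) (simp_all add: abs_less_iff)
  then show ?thesis using z by (simp add: powr_def Re_exp)
qed

context power_norms
begin

lemma poly_fun_holomorphic:
  assumes Q: "Q \<in> poly_fun m"
    and hol: "\<And>j. j \<in> {1..m} \<Longrightarrow> U j holomorphic_on S"
    and real: "\<And>j t. j \<in> {1..m} \<Longrightarrow> t \<in> {0..1} \<Longrightarrow> U j (of_real t) = of_real (u t j)"
  shows "\<exists>F. F holomorphic_on S \<and> (\<forall>t\<in>{0..1}. F (of_real t) = of_real (Q (u t) :: real))"
  using Q
proof induction
  case (const c)
  show ?case by (rule exI[of _ "\<lambda>_. of_real c"]) simp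
next
  case (var j)
  show ?case by (rule exI[of _ "U j"]) (use hol[OF var] real[OF var] in simp)
next
  case (add p q)
  then obtain F G where "F holomorphic_on S" "\<forall>t\<in>{0..1}. F (of_real t) = of_real (p (u t))"
    "G holomorphic_on S" "\<forall>t\<in>{0..1}. G (of_real t) = of_real (q (u t))" by blast
  then show ?case by (intro exI[of _ "\<lambda>z. F z + G z"]) (simp add: holomorphic_on_add)
next
  case (mult p q)
  then obtain F G where "F holomorphic_on S" "\<forall>t\<in>{0..1}. F (of_real t) = of_real (p (u t))"
    "G holomorphic_on S" "\<forall>t\<in>{0..1}. G (of_real t) = of_real (q (u t))" by blast
  then show ?case by (intro exI[of _ "\<lambda>z. F z * G z"]) (simp add: holomorphic_on_mult)
qed

text \<open>The identity theorem: t \<mapsto> Q (\<psi> (Y t)) extends holomorphically to a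
  connected open set containing [0, 1], and its zeros accumulate at 0. PC is the complexification of
  the power sums along Y.\<close>

lemma poly_fun_vanishing_along_segment:
  fixes P :: "nat \<Rightarrow> real \<Rightarrow> real" and PC :: "nat \<Rightarrow> complex \<Rightarrow> complex"
  assumes PC: "\<And>j. PC j holomorphic_on UNIV" "\<And>j t. j \<in> {1..m} \<Longrightarrow> PC j (of_real t) = of_real (psum n (a j) (Y t))"
    and Y: "\<And>t. t \<in> {0..1} \<Longrightarrow> Y t \<in> punctured"
    and Q: "Q \<in> poly_fun m" and \<delta>: "0 < \<delta>" "\<delta> \<le> 1"
    and zero: "\<And>t. t \<in> {0<..\<delta>} \<Longrightarrow> Q (\<psi> (Y t)) = 0"
  shows "Q (\<psi> (Y 1)) = 0"
proof -
  \<comment> \<open>Where these real parts are positive, the principal roots are holomorphic with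
    positive real part, so the denominator of \<psi> has no zero. The component of 0 is taken to
    make the domain connected; it still contains the segment.\<close>
  define S0 where "S0 = (\<Inter>j\<in>{1..m}. {z. 0 < Re (PC j z)})"
  have "open {z. 0 < Re (PC j z)}" for j
    by (intro open_Collect_less continuous_on_const continuous_on_Re holomorphic_on_imp_continuous_on PC(1))
  then have S0: "open S0" unfolding S0_def by (intro open_INT) auto
  have seg: "of_real ` {0..1} \<subseteq> S0"
  proof
    fix z :: complex assume "z \<in> of_real ` {0..1}"
    then obtain t :: real where t: "t \<in> {0..1}" "z = of_real t" by (rule imageE)
    have "0 < psum n (a j) (Y t)" for j using psum_pos[of "Y t" n "a j"] Y[OF t(1)] by simp
    then have "0 < Re (PC j z)" if "j \<in> {1..m}" for j
      unfolding t(2) PC(2)[OF that] by simp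
    then show "z \<in> S0" by (simp add: S0_def)
  qed
  define S where "S = connected_component_set S0 0"
  have S: "open S" "connected S" "S \<subseteq> S0"
    using S0 by (simp_all add: S_def open_connected_component connected_component_subset)
  have "connected (of_real ` {0..1::real} :: complex set)"
    by (intro connected_continuous_image continuous_on_of_real_id connected_Icc)
  then have seg_S: "of_real ` {0..1} \<subseteq> S"
    unfolding S_def using seg by (intro connected_component_maximal) (auto intro: image_eqI[of _ _ 0])
  define NC where "NC j z = PC j z powr of_real (1 / real (a j))" for j z
  have ReP: "0 < Re (PC j z)" if "z \<in> S" "j \<in> {1..m}" for z j
    using that S(3) by (auto simp: S0_def)
  have holN: "NC j holomorphic_on S" if "j \<in> {1..m}" for j
    unfolding NC_def
  proof (intro holomorphic_intros)
    show "PC j holomorphic_on S" using PC(1) by (rule holomorphic_on_subset) simp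
    fix z assume "z \<in> S"
    from ReP[OF this that] show "PC j z \<notin> \<real>\<^sub>\<le>\<^sub>0" by (auto simp: complex_nonpos_Reals_iff)
  qed
  have ReN: "0 < Re (NC j z)" if "z \<in> S" "j \<in> {1..m}" for z j
  proof -
    have "0 < a j" using a_pos that(2) by blast
    then show ?thesis unfolding NC_def by (intro Re_powr_pos ReP[OF that]) simp_all
  qed
  have sumN: "(\<Sum>k=1..m. NC k z) \<noteq> 0" if "z \<in> S" for z
  proof -
    have "0 < (\<Sum>k=1..m. Re (NC k z))" using m ReN[OF that] by (intro sum_pos) auto
    then have "0 < Re (\<Sum>k=1..m. NC k z)" by simp
    then show ?thesis by (metis zero_complex.sel(1) less_irrefl)
  qed
  have realN: "NC j (of_real t) = of_real (pnorm n (a j) (Y t))" if "t \<in> {0..1}" "j \<in> {1..m}" for j t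
  proof -
    have "0 \<le> psum n (a j) (Y t)" using Y[OF that(1)] by (intro psum_nonneg) simp
    then show ?thesis unfolding NC_def PC(2)[OF that(2)] pnorm_psum by (rule powr_of_real)
  qed
  have "\<exists>F. F holomorphic_on S \<and> (\<forall>t\<in>{0..1}. F (of_real t) = of_real (Q (\<psi> (Y t))))"
  proof (rule poly_fun_holomorphic[OF Q, where U="\<lambda>j z. NC j z / (\<Sum>k=1..m. NC k z)"])
    show "(\<lambda>z. NC j z / (\<Sum>k=1..m. NC k z)) holomorphic_on S" if "j \<in> {1..m}" for j
      by (intro holomorphic_on_divide holomorphic_on_sum holN that sumN)
    show "NC j (of_real t) / (\<Sum>k=1..m. NC k (of_real t)) = of_real (\<psi> (Y t) j)"
      if "j \<in> {1..m}" "t \<in> {0..1}" for j t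
    proof -
      have "(\<Sum>k=1..m. NC k (of_real t)) = of_real (norm_sum (Y t))"
        unfolding norm_sum_def of_real_sum by (rule sum.cong[OF refl realN[OF that(2)]])
      then show ?thesis using that(1) by (simp add: realN[OF that(2,1)] psi_eq)
    qed
  qed
  then obtain F where F: "F holomorphic_on S" "\<And>t. t \<in> {0..1} \<Longrightarrow> F (of_real t) = of_real (Q (\<psi> (Y t)))"
    by blast
  have "F 1 = 0"
  proof (rule analytic_continuation[OF F(1) S(1,2), where U="of_real ` {0<..\<delta>}" and \<xi>=0])
    show "of_real ` {0<..\<delta>} \<subseteq> S" using seg_S \<delta>(2) by (auto simp: image_subset_iff)
    show "0 \<in> S" using seg_S by (force simp: image_subset_iff)
    show "1 \<in> S" using subsetD[OF seg_S, of "of_real 1"] by simp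
    show "0 islimpt (of_real ` {0<..\<delta>} :: complex set)"
      unfolding islimpt_approachable
    proof (intro allI impI)
      fix e :: real assume e: "0 < e"
      define t where "t = min \<delta> (e / 2)"
      have "t \<in> {0<..\<delta>}" "t < e" using e \<delta> by (auto simp: t_def min_less_iff_disj)
      then show "\<exists>x'\<in>of_real ` {0<..\<delta>}. x' \<noteq> 0 \<and> dist x' (0::complex) < e"
        by (intro bexI[of _ "of_real t"]) auto
    qed
    fix z :: complex assume "z \<in> of_real ` {0<..\<delta>}"
    then obtain t where t: "z = of_real t" "t \<in> {0<..\<delta>}" by (rule imageE)
    then show "F z = 0" using F(2)[of t] zero[OF t(2)] \<delta>(2) by simp
  qed
  then show ?thesis using F(2)[of 1] by simp
qed

lemma poly_fun_vanishing_same_type: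
  assumes \<mu>: "\<mu> \<subseteq> {1..n}" and \<mu>': "\<mu>' \<subseteq> {1..n}" and type: "nu_type \<mu> = nu_type \<mu>'"
    and Q: "Q \<in> poly_fun m" and zero: "\<And>v. v \<in> Bset m a n \<mu> \<Longrightarrow> Q v = 0"
    and v: "v \<in> Bset m a n \<mu>'"
  shows "Q v = 0"
proof -
  have fin: "finite \<mu>" by (rule finite_subset[OF \<mu> finite_atLeastAtMost])
  define l where "l = card \<mu>"
  from arg_cong[OF type, of size] have l': "card \<mu>' = l"
    by (simp add: nu_type_block_size[OF \<mu>] nu_type_block_size[OF \<mu>'] l_def)
  from v obtain x' where x': "x' \<in> decr n" "steps_at \<mu>' x'" "x' \<noteq> (\<lambda>_. 0)" "v = \<psi> x'"
    by (auto simp: Bset_def Rcone_eq[OF \<mu>'])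
  obtain w' where w': "x' = spread \<mu>' w'" "\<And>j. j < l \<Longrightarrow> 0 \<le> w' j"
    using decr_eq_spread[OF \<mu>' x'(1,2)] l' by metis
  have l: "0 < l"
  proof (rule ccontr)
    assume "\<not> 0 < l"
    then have "x' = (\<lambda>_. 0)" unfolding w'(1) using l' by (auto simp: spread_def)
    with x'(3) show False by simp
  qed
  have "mset (map (block_size \<mu>) [0..<l]) = mset (map (block_size \<mu>') [0..<l])"
    using type by (simp add: nu_type_block_size[OF \<mu>] nu_type_block_size[OF \<mu>'] l' l_def)
  then obtain p where p: "p permutes {..<l}" "permute_list p (map (block_size \<mu>') [0..<l]) = map (block_size \<mu>) [0..<l]"
    by (rule mset_eq_permutation) simp
  have p_less: "p j < l" if "j < l" for j
    using permutes_in_image[OF p(1), of j] that by simp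
  have p_size: "block_size \<mu>' (p j) = block_size \<mu> j" if "j < l" for j
    using arg_cong[OF p(2), of "\<lambda>xs. xs ! j"] that p_less[OF that] p(1) by (simp add: permute_list_nth)
  \<comment> \<open>The values of x' redistributed to the blocks of \<mu> of the same size. The
    power sums are those of x', though the result may lie outside the cone of \<mu>.\<close>
  define z where "z j = w' (p j)" for j
  have z: "0 \<le> z j" if "j < l" for j unfolding z_def by (rule w'(2)[OF p_less[OF that]])
  have psum_z: "psum n q (spread \<mu> z) = psum n q x'" if "0 < q" for q
  proof -
    have "psum n q (spread \<mu> z) = (\<Sum>j<l. real (block_size \<mu>' (p j)) * w' (p j) ^ q)"
      unfolding psum_spread[OF \<mu> that] l_def[symmetric] by (rule sum.cong) (simp_all add: p_size z_def)
    also have "\<dots> = (\<Sum>j<l. real (block_size \<mu>' j) * w' j ^ q)"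
      by (rule sum.permute[OF p(1), symmetric, unfolded comp_def])
    also have "\<dots> = psum n q x'"
      unfolding w'(1) psum_spread[OF \<mu>' that] l' ..
    finally show ?thesis .
  qed
  \<comment> \<open>At t = 0 the block values are l, ..., 1, a point in the relative interior of the
    cone of \<mu>; at t = 1 they are those of the reordered point.\<close>
  define W where "W t j = (1 - t) * real (l - j) + t * z j" for t :: real and j
  define Y where "Y t = spread \<mu> (W t)" for t
  define PC where "PC j s = (\<Sum>i<l. of_nat (block_size \<mu> i) * ((1 - s) * of_nat (l - i) + s * of_real (z i)) ^ a j)"
    for j and s :: complex
  define Z where "Z = (\<Sum>j<l. z j)"
  \<comment> \<open>Consecutive block values differ by 1 at t = 0, and no z j exceeds Z; so for t
    \<le> \<delta> they drop by at least (1 - t) - t * Z \<ge> t, and Y t is in the cone.\<close>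
  define \<delta> where "\<delta> = 1 / (2 + Z)"
  have Z: "0 \<le> Z" unfolding Z_def using z by (intro sum_nonneg) simp
  have zZ: "z j \<le> Z" if "j < l" for j
    unfolding Z_def using z that by (intro member_le_sum) auto
  have \<delta>: "0 < \<delta>" "\<delta> \<le> 1" "\<delta> < 1" using Z by (simp_all add: \<delta>_def)
  have W_nonneg: "0 \<le> W t j" if "t \<in> {0..1}" "j < l" for t j
    unfolding W_def using that z[OF that(2)] by (intro add_nonneg_nonneg mult_nonneg_nonneg) auto
  have Y_orthant: "Y t \<in> orthant n" if "t \<in> {0..1}" for t
    using spread_beyond[OF \<mu>, of _ "W t"] W_nonneg[OF that]
    by (simp add: orthant_def Y_def) (simp add: spread_def l_def)
  have psum_Y1: "psum n (a j) (Y 1) = psum n (a j) x'" if "j \<in> {1..m}" for j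
  proof -
    have "W 1 = z" by (rule ext) (simp add: W_def)
    then show ?thesis using psum_z[of "a j"] a_pos that by (simp add: Y_def)
  qed
  have Y: "Y t \<in> punctured" if t: "t \<in> {0..1}" for t
  proof -
    have "Y t \<noteq> (\<lambda>_. 0)"
    proof (cases "t = 1")
      case True
      have am: "0 < a 1" "1 \<in> {1..m}" using a_pos m by auto
      have "0 < psum n (a 1) (Y t)"
        unfolding True psum_Y1[OF am(2)] by (rule psum_pos[OF decr_orthant[OF x'(1)] x'(3)])
      then show ?thesis using psum_zero[OF am(1), of n] by auto
    next
      case False
      have "0 < (1 - t) * real l" using False t l by simp
      then have "0 < W t 0" using t z[OF l] by (simp add: W_def add_pos_nonneg)
      moreover have "Y t 1 = W t 0" using rk_first[OF \<mu>] l by (simp add: Y_def spread_def l_def)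
      ultimately show ?thesis by (metis less_irrefl)
    qed
    with Y_orthant[OF t] show ?thesis by simp
  qed
  have small: "\<psi> (Y t) \<in> Bset m a n \<mu>" if t: "t \<in> {0<..\<delta>}" for t
  proof -
    have t01: "t \<in> {0..1}" using t \<delta> by auto
    have "t * (2 + Z) \<le> 1" using t Z by (simp add: \<delta>_def field_simps)
    have anti: "W t (Suc j) \<le> W t j" if j: "Suc j < l" for j
    proof -
      have "real (l - j) = real (l - Suc j) + 1" using j by (simp add: of_nat_diff)
      then have "W t j - W t (Suc j) = (1 - t) + t * z j - t * z (Suc j)"
        by (simp add: W_def algebra_simps)
      moreover have "t * z (Suc j) \<le> t * Z" "0 \<le> t * z j"
        using t zZ[OF j] z[of j] j by (auto intro: mult_left_mono)
      moreover have "t * (2 + Z) = 2 * t + t * Z" by (simp add: algebra_simps)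
      ultimately show ?thesis using \<open>t * (2 + Z) \<le> 1\<close> t
        unfolding greaterThanAtMost_iff by linarith
    qed
    have "Y t \<in> decr n"
      unfolding Y_def using \<mu> W_nonneg[OF t01] anti by (intro spread_decr) (simp_all add: l_def)
    moreover have "steps_at \<mu> (Y t)" unfolding Y_def by (rule spread_steps_at[OF fin])
    ultimately show ?thesis using Y[OF t01] by (auto simp: Bset_def Rcone_eq[OF \<mu>])
  qed
  have "Q (\<psi> (Y 1)) = 0"
  proof (rule poly_fun_vanishing_along_segment[where PC=PC and Y=Y and \<delta>=\<delta>])
    show "PC j holomorphic_on UNIV" for j
      unfolding PC_def by (intro holomorphic_intros)
    show "Y t \<in> punctured" if "t \<in> {0..1}" for t by (rule Y[OF that])
    show "PC j (of_real t) = of_real (psum n (a j) (Y t))" if "j \<in> {1..m}" for j t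
    proof -
      have "0 < a j" using a_pos that by blast
      from psum_spread[OF \<mu> this, of "W t"] show ?thesis by (simp add: PC_def Y_def W_def l_def)
    qed
  qed (use \<delta> Q small zero in auto)
  moreover have "\<psi> (Y 1) = v"
    unfolding x'(4) by (rule psi_cong) (rule psum_Y1)
  ultimately show ?thesis by simp
qed

lemma zariski_closure_same_type:
  assumes "\<mu> \<subseteq> {1..n}" "\<mu>' \<subseteq> {1..n}" "nu_type \<mu> = nu_type \<mu>'"
  shows "zariski_closure m (Bset m a n \<mu>) = zariski_closure m (Bset m a n \<mu>')"
proof -
  have "(\<forall>v\<in>Bset m a n \<mu>. Q v = 0) \<longleftrightarrow> (\<forall>v\<in>Bset m a n \<mu>'. Q v = 0)" if "Q \<in> poly_fun m" for Q
    using poly_fun_vanishing_same_type[OF assms that]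
      poly_fun_vanishing_same_type[OF assms(2,1) assms(3)[symmetric] that] by metis
  then show ?thesis unfolding zariski_closure_def by (simp cong: ball_cong imp_cong)
qed

end

text \<open>Blocks are nonempty disjoint subsets of {1..n}, which bounds the sum from both sides.
  Conversely, the partial sums of the parts, listed in any order, form a set of the given
  type.\<close>

lemma nu_type_image:
  "nu_type ` {\<mu>. \<mu> \<subseteq> {1..n} \<and> card \<mu> = l} = Tpart n l"
proof (intro equalityI subsetI)
  fix \<tau> assume "\<tau> \<in> nu_type ` {\<mu>. \<mu> \<subseteq> {1..n} \<and> card \<mu> = l}"
  then obtain \<mu> where \<mu>: "\<mu> \<subseteq> {1..n}" "card \<mu> = l" "\<tau> = nu_type \<mu>" by auto
  have fin: "finite \<mu>" by (rule finite_subset[OF \<mu>(1) finite_atLeastAtMost])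
  have \<tau>: "\<tau> = mset (map (block_size \<mu>) [0..<l])" using nu_type_block_size[OF \<mu>(1)] \<mu>(2,3) by simp
  have pos: "0 < block_size \<mu> j" if j: "j < l" for j
  proof -
    have f: "finite {i. 1 \<le> i \<and> rk \<mu> i = j}"
      using block_subset[OF \<mu>(1), of j] j \<mu>(2) by (intro finite_subset[OF _ finite_atLeastAtMost]) simp
    have jl: "j < card \<mu>" using j \<mu>(2) by simp
    have "sorted_list_of_set \<mu> ! j \<in> set (sorted_list_of_set \<mu>)" using jl by (intro nth_mem) simp
    then have "sorted_list_of_set \<mu> ! j \<in> \<mu>" using fin by simp
    then have "sorted_list_of_set \<mu> ! j \<in> {i. 1 \<le> i \<and> rk \<mu> i = j}"
      using rk_nth[OF fin jl] \<mu>(1) by auto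
    then show ?thesis using f by (auto simp: block_size_def card_gt_0_iff)
  qed
  have sum: "sum_mset \<tau> = (\<Sum>j<l. block_size \<mu> j)"
    unfolding \<tau> sum_mset_sum_list by (simp add: interv_sum_list_conv_sum_set_nat atLeast0LessThan)
  have "(\<Sum>j<l. block_size \<mu> j) = card (\<Union>j<l. {i. 1 \<le> i \<and> rk \<mu> i = j})"
  proof -
    have "finite {i. 1 \<le> i \<and> rk \<mu> i = j}" if "j < l" for j
      using block_subset[OF \<mu>(1), of j] that \<mu>(2) by (intro finite_subset[OF _ finite_atLeastAtMost]) simp
    then show ?thesis unfolding block_size_def by (subst card_UN_disjoint) auto
  qed
  also have "\<dots> \<le> card {1..n}"
    using block_subset[OF \<mu>(1)] \<mu>(2) by (intro card_mono UN_least) auto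
  finally have le: "sum_mset \<tau> \<le> n" using sum by simp
  have "(\<Sum>j<l. 1) \<le> (\<Sum>j<l. block_size \<mu> j)" using pos by (intro sum_mono) (simp add: Suc_le_eq)
  then have ge: "l \<le> sum_mset \<tau>" using sum by simp
  show "\<tau> \<in> Tpart n l"
    using le ge pos by (auto simp: Tpart_def \<tau>)
next
  fix \<tau> assume \<tau>: "\<tau> \<in> Tpart n l"
  obtain xs where xs: "mset xs = \<tau>" using ex_mset by blast
  have len: "length xs = l" using \<tau> xs by (auto simp: Tpart_def)
  have pos: "0 < xs ! j" if "j < l" for j
  proof -
    have "xs ! j \<in># \<tau>" using that len xs by (metis nth_mem_mset)
    then show ?thesis using \<tau> by (simp add: Tpart_def)
  qed
  define s where "s j = sum_list (take j xs)" for j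
  have s_Suc: "s (Suc j) = s j + xs ! j" if "j < l" for j
    using that len by (simp add: s_def take_Suc_conv_app_nth)
  have s_le: "s i \<le> s j" if "i \<le> j" "j \<le> l" for i j
    using that
  proof (induction j rule: dec_induct)
    case (step j)
    then show ?case using s_Suc[of j] by simp
  qed simp
  have sl: "s l \<le> n" using \<tau> xs len by (auto simp: s_def Tpart_def sum_mset_sum_list[symmetric])
  define L where "L = map (\<lambda>j. s (Suc j)) [0..<l]"
  have L: "sorted_wrt (<) L"
    unfolding L_def sorted_wrt_iff_nth_less
  proof (intro allI impI)
    fix i j assume "i < j" "j < length (map (\<lambda>j. s (Suc j)) [0..<l])"
    then have ij: "i < j" "j < l" by simp_all
    have "s (Suc i) \<le> s j" using ij by (intro s_le) simp_all
    then show "map (\<lambda>j. s (Suc j)) [0..<l] ! i < map (\<lambda>j. s (Suc j)) [0..<l] ! j"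
      using ij s_Suc[OF ij(2)] pos[OF ij(2)] by simp
  qed
  define \<mu> where "\<mu> = set L"
  have sorted_L: "sorted_list_of_set \<mu> = L"
    by (rule strict_sorted_equal[OF L strict_sorted_list_of_set]) (simp add: \<mu>_def)
  have "\<mu> \<subseteq> {1..n}"
  proof
    fix k assume "k \<in> \<mu>"
    then obtain j where j: "j < l" "k = s (Suc j)" by (auto simp: \<mu>_def L_def)
    have "s (Suc j) \<le> s l" using j(1) by (intro s_le) simp_all
    then show "k \<in> {1..n}" using j s_Suc[OF j(1)] pos[OF j(1)] sl by simp
  qed
  moreover have "card \<mu> = l"
  proof -
    have "distinct L" using L by (simp add: strict_sorted_iff)
    then have "card \<mu> = length L" unfolding \<mu>_def by (rule distinct_card)
    then show ?thesis by (simp add: L_def)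
  qed
  moreover have "nu_type \<mu> = \<tau>"
  proof -
    have "map2 (\<lambda>a b. a - b) L (0 # L) = xs"
    proof (rule nth_equalityI)
      show "length (map2 (\<lambda>a b. a - b) L (0 # L)) = length xs" by (simp add: L_def len)
      fix j assume "j < length (map2 (\<lambda>a b. a - b) L (0 # L))"
      then have j: "j < l" by (simp add: L_def)
      have "(0 # L) ! j = s j"
        using j by (cases j) (simp_all add: L_def s_def)
      moreover have "L ! j = s j + xs ! j" using j s_Suc[OF j] by (simp add: L_def)
      ultimately show "map2 (\<lambda>a b. a - b) L (0 # L) ! j = xs ! j"
        using j by (simp add: L_def)
    qed
    then show ?thesis using xs by (simp add: nu_type_def sorted_L)
  qed
  ultimately show "\<tau> \<in> nu_type ` {\<mu>. \<mu> \<subseteq> {1..n} \<and> card \<mu> = l}" by blast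
qed

theorem theorem5p4:
  fixes m n :: nat and a :: "nat \<Rightarrow> nat"
  assumes "1 \<le> m" and "m \<le> n"
    and "strict_mono_on {1..m} a" and "\<forall>j\<in>{1..m}. 0 < a j"
  shows
    \<comment> \<open>(i) image is the union of the B_nu, |nu| = m\<close>
    "psiA m a n ` (orthant n - {\<lambda>_. 0}) =
       (\<Union>\<nu>\<in>{\<nu>. \<nu> \<subseteq> {1..n} \<and> card \<nu> = m}. Bset m a n \<nu>)
     \<and> \<comment> \<open>each B_nu with |nu| = l <= m is a curvy (l-1)-simplex\<close>
     (\<forall>\<nu>. \<nu> \<subseteq> {1..n} \<and> 1 \<le> card \<nu> \<and> card \<nu> \<le> m \<longrightarrow>
        cross_section \<nu> \<subseteq> Rcone n \<nu> - {\<lambda>_. 0}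
        \<and> (\<forall>x \<in> Rcone n \<nu> - {\<lambda>_. 0}. \<exists>!y \<in> cross_section \<nu>. \<exists>t>0. x = (\<lambda>i. t * y i))
        \<and> (\<exists>g. homeomorphism (cross_section \<nu>) (Bset m a n \<nu>) (psiA m a n) g))
     \<and> \<comment> \<open>curvy facets of the curvy (m-1)-simplices\<close>
     (\<forall>\<nu>. \<nu> \<subseteq> {1..n} \<and> card \<nu> = m \<longrightarrow>
        (\<forall>k\<in>\<nu>. psiA m a n ` simplex_hull (gen ` (\<nu> - {k})) = Bset m a n (\<nu> - {k})))
     \<and> \<comment> \<open>boundary of the image is a union of some B_mu, |mu| = m-1\<close>
     (\<exists>M \<subseteq> {\<mu>. \<mu> \<subseteq> {1..n} \<and> card \<mu> = m - 1}.
        (subtopology euclidean (hyperplane m)) frontier_of (psiA m a n ` (orthant n - {\<lambda>_. 0}))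
          = (\<Union>\<mu>\<in>M. Bset m a n \<mu>))
     \<and> \<comment> \<open>(ii) same type implies same Zariski closure\<close>
     (\<forall>\<mu> \<mu>'. \<mu> \<subseteq> {1..n} \<and> card \<mu> = m - 1 \<and> \<mu>' \<subseteq> {1..n} \<and> card \<mu>' = m - 1
        \<and> nu_type \<mu> = nu_type \<mu>' \<longrightarrow>
        zariski_closure m (Bset m a n \<mu>) = zariski_closure m (Bset m a n \<mu>'))
     \<and> \<comment> \<open>the types of such mu are exactly T_{n,m-1}\<close>
     nu_type ` {\<mu>. \<mu> \<subseteq> {1..n} \<and> card \<mu> = m - 1} = Tpart n (m - 1)"
proof -
  interpret power_norms m n a
    using assms by unfold_locales auto
  have curvy_simplex: "cross_section \<nu> \<subseteq> Rcone n \<nu> - {\<lambda>_. 0}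
      \<and> (\<forall>x \<in> Rcone n \<nu> - {\<lambda>_. 0}. \<exists>!y \<in> cross_section \<nu>. \<exists>t>0. x = (\<lambda>i. t * y i))
      \<and> (\<exists>g. homeomorphism (cross_section \<nu>) (Bset m a n \<nu>) (psiA m a n) g)"
    if "\<nu> \<subseteq> {1..n} \<and> 1 \<le> card \<nu> \<and> card \<nu> \<le> m" for \<nu>
    using that by (intro conjI ballI cross_section_subset cross_section_scaling homeomorphism_psi) auto
  have facets: "psiA m a n ` simplex_hull (gen ` (\<nu> - {k})) = Bset m a n (\<nu> - {k})"
    if "\<nu> \<subseteq> {1..n} \<and> card \<nu> = m" for \<nu> k
    using that unfolding cross_section_def[symmetric] by (intro psi_cross_section) auto
  show ?thesis
  proof (intro conjI)
    show "psiA m a n ` (orthant n - {\<lambda>_. 0})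
        = (\<Union>\<nu>\<in>{\<nu>. \<nu> \<subseteq> {1..n} \<and> card \<nu> = m}. Bset m a n \<nu>)"
      by (rule image_psi)
    show "\<exists>M \<subseteq> {\<mu>. \<mu> \<subseteq> {1..n} \<and> card \<mu> = m - 1}.
        (subtopology euclidean (hyperplane m)) frontier_of (psiA m a n ` (orthant n - {\<lambda>_. 0}))
          = (\<Union>\<mu>\<in>M. Bset m a n \<mu>)"
    proof (intro exI conjI)
      show "{\<mu>. \<mu> \<subseteq> {1..n} \<and> card \<mu> = m - 1 \<and> (\<exists>\<rho>. gale n \<mu> \<rho>)}
          \<subseteq> {\<mu>. \<mu> \<subseteq> {1..n} \<and> card \<mu> = m - 1}"
        by blast
    qed (rule frontier_psi)
    show "nu_type ` {\<mu>. \<mu> \<subseteq> {1..n} \<and> card \<mu> = m - 1} = Tpart n (m - 1)"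
      by (rule nu_type_image)
  qed (use curvy_simplex facets zariski_closure_same_type in simp_all)
qed

end
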